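(* Let $p$ be a prime, $n\ge1$, $q=p^n$. The actions of $V$ and $F$ on $H^1_{\rm dR}(X_q)$ satisfy: (1) if $1\le t\le2^{n-1}$ then $V(B_t)=0$; (2) if $2^{n-1}+1\le t\le 2^n$ then $V$ restricts to an isomorphism $B_t\to B_{2t-2^n-1}$; (3) if $t$ is odd then $F(B_t)=0$; (4) if $t$ is even then $F$ restricts to an isomorphism $B_t\to B_{t/2}$.
   Context: $k$ is an algebraically closed field of characteristic $p$ and $X_q$ is the Hermitian curve $y^q+y=x^{q+1}$ over $k$ (smooth projective, unique point $P_\infty$ at infinity). Let $U_1=X_q\setminus\{P_\infty\}$, $U_2=X_q\setminus\{(0,y):y^q+y=0\}$; $H^1_{\rm dR}(X_q)$ is the space of triples $(\phi,\eta_1,\eta_2)$ with $\phi\in\mathcal{O}(U_1\cap U_2)$, $\eta_i\in\Omega^1(U_i)$, $d\phi=\eta_1-\eta_2$, modulo triples $(\kappa_1-\kappa_2,d\kappa_1,d\kappa_2)$, $\kappa_i\in\mathcal{O}(U_i)$; $F(\phi,\eta)=(\phi^p,0)$ ($p$-linear), $V(\phi,\eta)=(0,\mathcal{C}(\eta))$ ($p^{-1}$-linear, $\mathcal{C}$ the Cartier operator). Let $\Delta=\{(i,j)\in\mathbb{Z}^2:i,j\ge0,i+j\le q-2\}$; for $(i,j)\in\Delta$, $\omega_{i,j}=x^iy^jdx\in H^0(X_q,\Omega^1)\subset H^1_{\rm dR}(X_q)$, $f_{i,j}=\frac{y^{q-1}}{x^{i+1}y^j}$, and $\tilde f_{i,j}$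 is the class of $(f_{i,j},\,-(j+1)y^{q-j-2}x^{q-i-1}dx,\,(i+1)y^{q-j-1}x^{-i-2}dx)$; these form a basis $\mathbb{B}$. For $0\le m<p^n$ write $m=\sum m_lp^l$ ($0\le m_l\le p-1$), $m^+_h=\sum_{l=0}^{h-1}m_lp^l$. For $(i,j)\in\Delta$, $0\le h\le n-2$: $b_h(i,j)=0$ if $i^+_{h+1}+j^+_{h+1}<p^{h+1}-1$, else $1$. The vector of $\omega_{i,j}$ is $(b_0,\dots,b_{n-2},1)$ and of $\tilde f_{i,j}$ is $(b_0,\dots,b_{n-2},0)$. For $\vec b=(b_0,\dots,b_{n-1})\in(\mathbb{Z}/2)^n$ set $T(\vec b)=2^{n-1}b_0+\dots+2b_{n-2}+1$ if $b_{n-1}=1$ and $T(\vec b)=2^n-(2^{n-1}b_0+\dots+2b_{n-2})$ if $b_{n-1}=0$. For $1\le t\le 2^n$, $B_t$ is the span of the elements of $\mathbb{B}$ whose vector $\vec b$ has $T(\vec b)=t$. *)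

theory Defs
  imports
    "HOL-Computational_Algebra.Computational_Algebra"
    "HOL-Library.Function_Algebras"
    "HOL-Library.Product_Plus"
    "HOL-Library.Set_Algebras"
begin

section \<open>The Hermitian curve and its regular functions\<close>

text \<open>
  Points of the projective plane are given by their homogeneous coordinate vectors
  \<open>(X, Y, Z) \<noteq> (0, 0, 0)\<close>; every set of points below is stable under scaling, and a
  regular function is a function of coordinate vectors that is automatically constant on
  each projective point.
\<close>

type_synonym 'k pt = "'k \<times> 'k \<times> 'k"
type_synonym 'k rfun = "'k pt \<Rightarrow> 'k"

definition hform :: "nat \<Rightarrow> (nat \<Rightarrow> nat \<Rightarrow> 'k::field) \<Rightarrow> 'k pt \<Rightarrow> 'k" where
  "hform m c = (\<lambda>(X, Y, Z). \<Sum>i\<le>m. \<Sum>j\<le>m - i. c i j * X ^ i * Y ^ j * Z ^ (m - i - j))"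

text \<open>The projective closure of \<open>y^q + y = x^(q+1)\<close>, where \<open>x = X/Z\<close> and \<open>y = Y/Z\<close>.\<close>

definition hermitian_curve :: "nat \<Rightarrow> 'k::field pt set" where
  "hermitian_curve q =
     {(X, Y, Z). (X, Y, Z) \<noteq> (0, 0, 0) \<and> Y ^ q * Z + Y * Z ^ q = X ^ (q + 1)}"

text \<open>The point at infinity is \<open>[0 : 1 : 0]\<close>.\<close>

definition U1 :: "nat \<Rightarrow> 'k::field pt set" where
  "U1 q = hermitian_curve q - {(0, c, 0) | c. c \<noteq> 0}"

definition U2 :: "nat \<Rightarrow> 'k::field pt set" where
  "U2 q = hermitian_curve q - {(0, c * y, c) | c y. c \<noteq> 0 \<and> y ^ q + y = 0}"

abbreviation U12 :: "nat \<Rightarrow> 'k::field pt set" where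
  "U12 q \<equiv> U1 q \<inter> U2 q"

text \<open>
  \<open>regular U\<close> is the ring of regular functions on a Zariski open subset \<open>U\<close> of the curve
  (extended by \<open>0\<close> outside \<open>U\<close>): near each point, a quotient of two forms of equal degree.
  Shrinking a neighbourhood to the non-vanishing locus of a form and multiplying numerator
  and denominator by that form, one may take the neighbourhood to be the locus where the
  denominator does not vanish.
\<close>

definition regular :: "'k::field pt set \<Rightarrow> 'k rfun set" where
  "regular U = {f. (\<forall>P. P \<notin> U \<longrightarrow> f P = 0) \<and>
     (\<forall>P\<in>U. \<exists>m g h. hform m h P \<noteq> 0 \<and>
        (\<forall>Q\<in>U. hform m h Q \<noteq> 0 \<longrightarrow> f Q = hform m g Q / hform m h Q))}"

definition res12 :: "nat \<Rightarrow> 'k::field rfun \<Rightarrow> 'k rfun" where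
  "res12 q f = (\<lambda>P. if P \<in> U12 q then f P else 0)"

definition fx :: "nat \<Rightarrow> 'k::field rfun" where
  "fx q = res12 q (\<lambda>(X, Y, Z). X / Z)"

definition fy :: "nat \<Rightarrow> 'k::field rfun" where
  "fy q = res12 q (\<lambda>(X, Y, Z). Y / Z)"

section \<open>Differentials\<close>

text \<open>
  Let \<open>A\<close> be the coordinate ring of the smooth affine curve \<open>U12 q\<close>.  Since the
  module of Kaehler differentials of \<open>A\<close> over the ground field is projective of finite rank,
  it embeds into its double dual, i.e. into the functionals on \<open>Der(A, A)\<close>, with \<open>df\<close>
  becoming evaluation at \<open>f\<close>.  So a differential is represented by its pairing with derivations
  (and is \<open>0\<close> on arguments that are not derivations).
\<close>

type_synonym 'k dform = "('k rfun \<Rightarrow> 'k rfun) \<Rightarrow> 'k rfun"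

definition sc :: "'k::field \<Rightarrow> 'k rfun \<Rightarrow> 'k rfun" where
  "sc c f = (\<lambda>P. c * f P)"

definition derivations :: "nat \<Rightarrow> ('k::field rfun \<Rightarrow> 'k rfun) set" where
  "derivations q = {D.
     (\<forall>f\<in>regular (U12 q). D f \<in> regular (U12 q)) \<and>
     (\<forall>f\<in>regular (U12 q). \<forall>g\<in>regular (U12 q). D (f + g) = D f + D g) \<and>
     (\<forall>c. \<forall>f\<in>regular (U12 q). D (sc c f) = sc c (D f)) \<and>
     (\<forall>f\<in>regular (U12 q). \<forall>g\<in>regular (U12 q). D (f * g) = f * D g + g * D f)}"

definition dd :: "nat \<Rightarrow> 'k::field rfun \<Rightarrow> 'k dform" where
  "dd q f = (\<lambda>D. if D \<in> derivations q then D f else 0)"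

definition fmul :: "'k::field rfun \<Rightarrow> 'k dform \<Rightarrow> 'k dform" where
  "fmul f \<omega> = (\<lambda>D. f * \<omega> D)"

text \<open>
  \<open>Omega q U\<close> is \<open>\<Omega>\<^sup>1(U)\<close> for an affine open \<open>U \<supseteq> U12 q\<close>: the
  \<open>\<O>(U)\<close>-module generated by the differentials of elements of \<open>\<O>(U)\<close>.  Its
  elements are represented by their (injective) restriction to \<open>U12 q\<close>.  The sets
  \<open>U1 q\<close>, \<open>U2 q\<close> and \<open>U12 q\<close> are affine, being complements of finite nonempty sets
  in a smooth projective curve.
\<close>

definition Omega :: "nat \<Rightarrow> 'k::field pt set \<Rightarrow> 'k dform set" where
  "Omega q U = {\<omega>. \<exists>(m::nat) f g. (\<forall>i<m. f i \<in> regular U \<and> g i \<in> regular U) \<and>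
     \<omega> = (\<Sum>i<m. fmul (res12 q (f i)) (dd q (res12 q (g i))))}"

text \<open>
  The Cartier operator, through its characterizing properties; the last clause only fixes the
  value outside \<open>\<Omega>\<^sup>1(U1 \<inter> U2)\<close>.
\<close>

definition is_cartier :: "nat \<Rightarrow> nat \<Rightarrow> ('k::field dform \<Rightarrow> 'k dform) \<Rightarrow> bool" where
  "is_cartier p q C \<longleftrightarrow>
     (\<forall>\<omega>\<in>Omega q (U12 q). C \<omega> \<in> Omega q (U12 q)) \<and>
     (\<forall>\<omega>\<in>Omega q (U12 q). \<forall>\<eta>\<in>Omega q (U12 q). C (\<omega> + \<eta>) = C \<omega> + C \<eta>) \<and>
     (\<forall>f\<in>regular (U12 q). \<forall>\<omega>\<in>Omega q (U12 q). C (fmul (f ^ p) \<omega>) = fmul f (C \<omega>)) \<and>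
     (\<forall>f\<in>regular (U12 q). C (dd q f) = 0) \<and>
     (\<forall>f\<in>regular (U12 q). C (fmul (f ^ (p - 1)) (dd q f)) = dd q f) \<and>
     (\<forall>\<omega>. \<omega> \<notin> Omega q (U12 q) \<longrightarrow> C \<omega> = 0)"

definition cartier :: "nat \<Rightarrow> nat \<Rightarrow> 'k::field dform \<Rightarrow> 'k dform" where
  "cartier p q = (THE C. is_cartier p q C)"

section \<open>De Rham cohomology\<close>

type_synonym 'k cochain = "'k rfun \<times> 'k dform \<times> 'k dform"

definition dR_closed :: "nat \<Rightarrow> 'k::field cochain set" where
  "dR_closed q = {(\<phi>, \<eta>1, \<eta>2).
     \<phi> \<in> regular (U12 q) \<and> \<eta>1 \<in> Omega q (U1 q) \<and> \<eta>2 \<in> Omega q (U2 q) \<and> dd q \<phi> = \<eta>1 - \<eta>2}"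

definition dR_exact :: "nat \<Rightarrow> 'k::field cochain set" where
  "dR_exact q = {(res12 q \<kappa>1 - res12 q \<kappa>2, dd q (res12 q \<kappa>1), dd q (res12 q \<kappa>2)) | \<kappa>1 \<kappa>2.
     \<kappa>1 \<in> regular (U1 q) \<and> \<kappa>2 \<in> regular (U2 q)}"

text \<open>
  Cohomology classes are cosets of \<open>dR_exact q\<close>; the zero class is \<open>dR_exact q\<close> itself, and
  addition of classes is the addition of sets from \<open>Set_Algebras\<close>.  An additive map of cochains
  that preserves \<open>dR_exact q\<close> sends the coset \<open>K\<close> into the coset \<open>induced q L K\<close>.
\<close>

definition dR_class :: "nat \<Rightarrow> 'k::field cochain \<Rightarrow> 'k cochain set" where
  "dR_class q z = z +o dR_exact q"

definition H1_dR :: "nat \<Rightarrow> 'k::field cochain set set" where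
  "H1_dR q = dR_class q ` dR_closed q"

definition induced ::
    "nat \<Rightarrow> ('k::field cochain \<Rightarrow> 'k cochain) \<Rightarrow> 'k cochain set \<Rightarrow> 'k cochain set" where
  "induced q L K = L ` K + dR_exact q"

definition class_scale :: "nat \<Rightarrow> 'k::field \<Rightarrow> 'k cochain set \<Rightarrow> 'k cochain set" where
  "class_scale q c =
     induced q (\<lambda>(\<phi>, \<eta>1, \<eta>2). (sc c \<phi>, (\<lambda>D. sc c (\<eta>1 D)), (\<lambda>D. sc c (\<eta>2 D))))"

definition Frob :: "nat \<Rightarrow> nat \<Rightarrow> 'k::field cochain set \<Rightarrow> 'k cochain set" where
  "Frob p q = induced q (\<lambda>(\<phi>, \<eta>1, \<eta>2). (\<phi> ^ p, 0, 0))"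

definition Ver :: "nat \<Rightarrow> nat \<Rightarrow> 'k::field cochain set \<Rightarrow> 'k cochain set" where
  "Ver p q = induced q (\<lambda>(\<phi>, \<eta>1, \<eta>2). (0, cartier p q \<eta>1, cartier p q \<eta>2))"

inductive_set class_span :: "nat \<Rightarrow> 'k::field cochain set set \<Rightarrow> 'k cochain set set"
  for q :: nat and S :: "'k cochain set set" where
  span_zero: "dR_exact q \<in> class_span q S"
| span_base: "K \<in> S \<Longrightarrow> K \<in> class_span q S"
| span_add: "K \<in> class_span q S \<Longrightarrow> L \<in> class_span q S \<Longrightarrow> K + L \<in> class_span q S"
| span_scale: "K \<in> class_span q S \<Longrightarrow> class_scale q c K \<in> class_span q S"

text \<open>
  \<open>\<sigma>\<close>-semilinear isomorphisms; for the identity \<open>\<sigma>\<close> these are the linear ones.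
\<close>

definition semilinear_iso ::
    "nat \<Rightarrow> ('k \<Rightarrow> 'k) \<Rightarrow> ('k::field cochain set \<Rightarrow> 'k cochain set) \<Rightarrow>
     'k cochain set set \<Rightarrow> 'k cochain set set \<Rightarrow> bool" where
  "semilinear_iso q \<sigma> L A B \<longleftrightarrow> bij_betw L A B \<and>
     (\<forall>K\<in>A. \<forall>M\<in>A. L (K + M) = L K + L M) \<and>
     (\<forall>c. \<forall>K\<in>A. L (class_scale q c K) = class_scale q (\<sigma> c) (L K))"

section \<open>The basis and the subspaces \<open>B\<^sub>t\<close>\<close>

definition Delta :: "nat \<Rightarrow> (nat \<times> nat) set" where
  "Delta q = {(i, j). i + j \<le> q - 2}"

definition omega_class :: "nat \<Rightarrow> nat \<Rightarrow> nat \<Rightarrow> 'k::field cochain set" where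
  "omega_class q i j =
     (let \<omega> = fmul (fx q ^ i * fy q ^ j) (dd q (fx q)) in dR_class q (0, \<omega>, \<omega>))"

text \<open>
  Neither \<open>x\<close> nor \<open>y\<close> vanishes on \<open>U12 q\<close>, so the divisions are genuine there, and the
  functions below are \<open>0\<close> outside \<open>U12 q\<close>.
\<close>

definition f_fun :: "nat \<Rightarrow> nat \<Rightarrow> nat \<Rightarrow> 'k::field rfun" where
  "f_fun q i j = (\<lambda>P. fy q P ^ (q - 1) / (fx q P ^ (i + 1) * fy q P ^ j))"

definition f_eta1 :: "nat \<Rightarrow> nat \<Rightarrow> nat \<Rightarrow> 'k::field dform" where
  "f_eta1 q i j =
     fmul (\<lambda>P. - of_nat (j + 1) * fy q P ^ (q - j - 2) * fx q P ^ (q - i - 1)) (dd q (fx q))"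

definition f_eta2 :: "nat \<Rightarrow> nat \<Rightarrow> nat \<Rightarrow> 'k::field dform" where
  "f_eta2 q i j =
     fmul (\<lambda>P. of_nat (i + 1) * fy q P ^ (q - j - 1) / fx q P ^ (i + 2)) (dd q (fx q))"

definition f_class :: "nat \<Rightarrow> nat \<Rightarrow> nat \<Rightarrow> 'k::field cochain set" where
  "f_class q i j = dR_class q (f_fun q i j, f_eta1 q i j, f_eta2 q i j)"

definition digit :: "nat \<Rightarrow> nat \<Rightarrow> nat \<Rightarrow> nat" where
  "digit p m l = m div p ^ l mod p"

definition low_part :: "nat \<Rightarrow> nat \<Rightarrow> nat \<Rightarrow> nat" where
  "low_part p h m = (\<Sum>l<h. digit p m l * p ^ l)"

definition bval :: "nat \<Rightarrow> nat \<Rightarrow> nat \<Rightarrow> nat \<Rightarrow> nat" where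
  "bval p i j h =
     (if low_part p (h + 1) i + low_part p (h + 1) j < p ^ (h + 1) - 1 then 0 else 1)"

text \<open>A vector in \<open>(\<int>/2)^n\<close> is a function with values in \<open>{0, 1}\<close>, read at \<open>0, \<dots>, n - 1\<close>.\<close>

definition omega_vec :: "nat \<Rightarrow> nat \<Rightarrow> nat \<Rightarrow> nat \<Rightarrow> nat \<Rightarrow> nat" where
  "omega_vec p n i j = (\<lambda>h. if h = n - 1 then 1 else bval p i j h)"

definition f_vec :: "nat \<Rightarrow> nat \<Rightarrow> nat \<Rightarrow> nat \<Rightarrow> nat \<Rightarrow> nat" where
  "f_vec p n i j = (\<lambda>h. if h = n - 1 then 0 else bval p i j h)"

definition T_index :: "nat \<Rightarrow> (nat \<Rightarrow> nat) \<Rightarrow> nat" where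
  "T_index n b = (if b (n - 1) = 1 then (\<Sum>h<n - 1. 2 ^ (n - 1 - h) * b h) + 1
            else 2 ^ n - (\<Sum>h<n - 1. 2 ^ (n - 1 - h) * b h))"

definition B_space :: "nat \<Rightarrow> nat \<Rightarrow> nat \<Rightarrow> 'k::field cochain set set" where
  "B_space p n t = class_span (p ^ n)
     ({omega_class (p ^ n) i j | i j. (i, j) \<in> Delta (p ^ n) \<and> T_index n (omega_vec p n i j) = t} \<union>
      {f_class (p ^ n) i j | i j. (i, j) \<in> Delta (p ^ n) \<and> T_index n (f_vec p n i j) = t})"

end

theory Submission
  imports Defs
begin

text \<open>
  The curve is an etale \<open>q\<close>-fold cover of the affine \<open>x\<close>-line with group \<open>{a. a ^ q + a = 0}\<close>
  acting by \<open>y \<mapsto> y + a\<close>.  Interpolation on fibres and the norm of this group show that regular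
  functions on \<open>U1 \<inter> U2\<close> are the Laurent polynomials in \<open>x\<close> with coefficients in
  \<open>span {1, y, \<dots>, y ^ (q - 1)}\<close>; the monomials have pairwise different pole orders at infinity,
  which yields the linear independence of the classes.  Differentials are \<open>g dx\<close>, and the Cartier
  operator sends \<open>g dx\<close> to the \<open>p\<close>-th root of \<open>(d/dx) ^ (p - 1) g / (p - 1)!\<close> times \<open>dx\<close>.

  Substituting \<open>y = x ^ (q + 1) - y ^ q\<close> in \<open>x ^ i y ^ j dx\<close>, and \<open>y ^ q = x ^ (q + 1) - y\<close> in
  \<open>f ^ p\<close>, only one term of the binomial expansion survives.  Hence \<open>V\<close> and \<open>F\<close> permute the basis up
  to scalars: for bijections \<open>\<alpha>\<close>, \<open>\<beta>\<close> of index sets that shift base-\<open>p\<close> digits,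
  \<open>V \<omega>\<^sub>a = \<omega>\<^bsub>\<alpha> a\<^esub>\<close> and \<open>F f\<^bsub>\<alpha> a\<^esub> = f\<^sub>a\<close> if \<open>i mod p + j mod p \<ge> p - 1\<close>, \<open>V f\<^sub>a = \<omega>\<^bsub>\<beta> a\<^esub>\<close> and
  \<open>F f\<^bsub>\<beta> a\<^esub> = \<omega>\<^sub>a\<close> otherwise, and all other values vanish.
\<close>

section \<open>Forms and regular functions\<close>

text \<open>A form is encoded as a functional on Der(A, A), so this module has to be known first:
  every derivation is a multiple of the operator \<open>D0\<close> = d/dx, for which
  \<open>D0\<close> y = x^q, and evaluation at \<open>D0\<close> returns the coefficient of dx. The
  Cartier operator is given by a definite description, which is resolved by exhibiting an operator
  and proving it unique.

  The bits enter through S = 2^(n-1) b_0 + ... + 2 b_(n-2), which is even. So the classes of forms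
  have odd index S + 1, the classes of the f have even index 2^n - S, and each B_t is spanned by
  classes of one kind; independence is proved for each kind separately. The digit shifts satisfy
  S(\<alpha> a) = 2 S(a) - 2^n and S(\<beta> a) = 2^n - 2 - 2 S(a), which produces the index maps t
  -> 2t - 2^n - 1 and t -> t/2. To see that every basis element of the right index is reached, S
  modulo 4 is used: it tells the images of \<alpha> and \<beta> apart.\<close>

global_interpretation vs: vector_space "sc :: 'k::field \<Rightarrow> 'k rfun \<Rightarrow> 'k rfun"
  by unfold_locales (simp_all add: sc_def fun_eq_iff algebra_simps)

global_interpretation vp: vector_space_pair
  "sc :: 'k::field \<Rightarrow> 'k rfun \<Rightarrow> 'k rfun" "sc :: 'k::field \<Rightarrow> 'k rfun \<Rightarrow> 'k rfun"
  by unfold_locales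

lemma sc_apply [simp]: "sc c f P = c * f P"
  by (simp add: sc_def)

lemma sum_fun_apply [simp]: "(\<Sum>i\<in>I. f i) x = (\<Sum>i\<in>I. f i x)" for f :: "_ \<Rightarrow> _ \<Rightarrow> _::comm_monoid_add"
  by (induction I rule: infinite_finite_induct) auto

lemma power_fun_apply [simp]: "(f ^ m) x = f x ^ m" for f :: "_ \<Rightarrow> _::{power,monoid_mult}"
  by (induction m) auto

text \<open>With one factor fixed, the functions whose product with it lies in a given span form a
  subspace. Applied to each factor in turn, this reduces products to generators.\<close>

lemma span_mult:
  assumes "f \<in> vs.span S" "g \<in> vs.span T" "\<And>a b. a \<in> S \<Longrightarrow> b \<in> T \<Longrightarrow> a * b \<in> vs.span R"
  shows "f * g \<in> vs.span R"
proof -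
  have sub: "vs.subspace {h. h * g \<in> vs.span R}" for g
  proof (rule vs.subspaceI)
    show "0 \<in> {h. h * g \<in> vs.span R}" by (simp add: vs.span_zero)
    show "x + y \<in> {h. h * g \<in> vs.span R}"
      if "x \<in> {h. h * g \<in> vs.span R}" "y \<in> {h. h * g \<in> vs.span R}" for x y
      using that by (simp add: distrib_right vs.span_add)
    show "sc c x \<in> {h. h * g \<in> vs.span R}" if "x \<in> {h. h * g \<in> vs.span R}" for c x
    proof -
      have "sc c x * g = sc c (x * g)" by (simp add: fun_eq_iff mult.assoc)
      thus ?thesis using that by (simp add: vs.span_scale)
    qed
  qed
  have "a * g \<in> vs.span R" if "a \<in> S" for a
    using assms(2) vs.span_minimal[of T "{h. h * a \<in> vs.span R}"] sub[of a] assms(3)[OF that]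
    by (auto simp: mult.commute[of a])
  thus ?thesis
    using assms(1) vs.span_minimal[of S "{h. h * g \<in> vs.span R}"] sub[of g] by auto
qed

definition pmon :: "nat \<Rightarrow> nat \<Rightarrow> nat \<Rightarrow> 'k::field rfun" where
  "pmon i j k = (\<lambda>(X, Y, Z). X ^ i * Y ^ j * Z ^ k)"

lemma pmon_mult: "pmon i j k * pmon i' j' k' = pmon (i + i') (j + j') (k + k')"
  by (auto simp: pmon_def fun_eq_iff power_add)

definition forms :: "nat \<Rightarrow> 'k::field rfun set" where
  "forms m = vs.span {pmon i j k | i j k. i + j + k = m}"

lemma pmon_in_forms: "i + j + k = m \<Longrightarrow> pmon i j k \<in> forms m"
  unfolding forms_def by (auto intro!: vs.span_base)

lemma subspace_forms: "vs.subspace (forms m)"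
  unfolding forms_def by simp

text \<open>Replaces the coefficient sums of \<open>hform\<close> by a span, so that closure
  properties can be checked on monomials.\<close>

lemma range_hform: "range (hform m) = (forms m :: 'k::field rfun set)"
proof
  have eq: "hform m c = (\<Sum>i\<le>m. \<Sum>j\<le>m - i. sc (c i j) (pmon i j (m - i - j)))"
    for c :: "nat \<Rightarrow> nat \<Rightarrow> 'k"
    by (auto simp: hform_def pmon_def fun_eq_iff mult.assoc)
  have "pmon i j (m - i - j) \<in> (forms m :: 'k rfun set)" if "i \<le> m" "j \<le> m - i" for i j
    by (rule pmon_in_forms) (use that in auto)
  thus "range (hform m) \<subseteq> (forms m :: 'k rfun set)"
    unfolding eq
      by (auto intro!: vs.subspace_sum[OF subspace_forms] vs.subspace_scale[OF subspace_forms])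
  have add: "hform m c + hform m d = hform m (\<lambda>i j. c i j + d i j)" for c d :: "nat \<Rightarrow> nat \<Rightarrow> 'k"
    by (auto simp: hform_def fun_eq_iff sum.distrib algebra_simps)
  have scl: "sc a (hform m c) = hform m (\<lambda>i j. a * c i j)" for a and c :: "nat \<Rightarrow> nat \<Rightarrow> 'k"
    by (auto simp: hform_def fun_eq_iff sum_distrib_left mult.assoc)
  have zero: "0 = hform m (\<lambda>i j. 0 :: 'k)" by (auto simp: hform_def fun_eq_iff)
  have sub: "vs.subspace (range (hform m) :: 'k rfun set)"
    by (rule vs.subspaceI) (use zero add scl in blast)+
  have "pmon i j k = hform m (\<lambda>i' j'. if i' = i \<and> j' = j then 1 else 0 :: 'k)"
      if "i + j + k = m" for i j k
  proof -
    have "(\<Sum>i'\<le>m. \<Sum>j'\<le>m - i'. (if i' = i \<and> j' = j then 1 else 0) * X ^ i' * Y ^ j' * Z ^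
        (m - i' - j'))
       = (\<Sum>i'\<le>m. if i' = i then X ^ i * Y ^ j * Z ^ k else 0)" for X Y Z :: 'k
    proof (rule sum.cong)
      fix i' assume "i' \<in> {..m}"
      show "(\<Sum>j'\<le>m - i'. (if i' = i \<and> j' = j then 1 else 0) * X ^ i' * Y ^ j' * Z ^ (m - i' - j'))
        = (if i' = i then X ^ i * Y ^ j * Z ^ k else 0)"
      proof (cases "i' = i")
        case True
        have "(\<Sum>j'\<le>m - i'. (if i' = i \<and> j' = j then 1 else 0) * X ^ i' * Y ^ j' * Z ^ (m - i' - j'))
          = (\<Sum>j'\<le>m - i'. if j' = j then X ^ i * Y ^ j * Z ^ (m - i - j) else 0)"
          using True by (intro sum.cong) auto
        also have "\<dots> = X ^ i * Y ^ j * Z ^ k" using that True by (auto simp: sum.delta)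
        finally show ?thesis using True by simp
      qed simp
    qed simp
    thus ?thesis using that by (auto simp: hform_def pmon_def fun_eq_iff)
  qed
  thus "forms m \<subseteq> (range (hform m) :: 'k rfun set)"
    unfolding forms_def by (intro vs.span_minimal sub) auto
qed

lemma forms_mult: "f \<in> forms m \<Longrightarrow> g \<in> forms m' \<Longrightarrow> f * g \<in> forms (m + m')"
  unfolding forms_def
  by (erule (1) span_mult) (auto simp: pmon_mult simp flip: forms_def intro!: pmon_in_forms)

lemma forms_add: "f \<in> forms m \<Longrightarrow> g \<in> forms m \<Longrightarrow> f + g \<in> forms m"
  unfolding forms_def by (rule vs.span_add)

lemma forms_sc: "f \<in> forms m \<Longrightarrow> sc c f \<in> forms m"
  unfolding forms_def by (rule vs.span_scale)

lemma one_in_forms: "1 \<in> forms 0"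
proof -
  have "pmon 0 0 0 = (1 :: 'a::field rfun)" by (auto simp: pmon_def fun_eq_iff)
  thus ?thesis using pmon_in_forms[of 0 0 0 0, where ?'a = 'a] by simp
qed

lemma forms_power: "f \<in> forms m \<Longrightarrow> f ^ r \<in> forms (r * m)"
proof (induction r)
  case 0
  show ?case using one_in_forms by (simp only: power_0 mult_0)
next
  case (Suc r)
  thus ?case using forms_mult[of f m "f ^ r" "r * m"] by (simp only: power_Suc mult_Suc)
qed

text \<open>Squaring the denominator makes the local equation \<open>f * h = g\<close> valid on the whole open set.\<close>

lemma regular_iff:
  "f \<in> regular U \<longleftrightarrow> (\<forall>P. P \<notin> U \<longrightarrow> f P = 0) \<and>
     (\<forall>P\<in>U. \<exists>m. \<exists>h\<in>forms m. \<exists>g\<in>forms m. h P \<noteq> 0 \<and> (\<forall>Q\<in>U. f Q * h Q = g Q))"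
proof -
  have loc: "(\<exists>m. \<exists>h\<in>forms m. \<exists>g\<in>forms m. h P \<noteq> 0 \<and> (\<forall>Q\<in>U. f Q * h Q = g Q)) \<longleftrightarrow>
    (\<exists>m g h. hform m h P \<noteq> 0 \<and> (\<forall>Q\<in>U. hform m h Q \<noteq> 0 \<longrightarrow> f Q = hform m g Q / hform m h Q))"
    (is "?L \<longleftrightarrow> ?R") if "P \<in> U" for P
  proof
    assume ?L
    then obtain m h g where "h \<in> forms m" "g \<in> forms m" and *: "h P \<noteq> 0" "\<forall>Q\<in>U. f Q * h Q = g Q"
      by auto
    then obtain h' g' where "h = hform m h'" "g = hform m g'"
      by (auto simp: range_hform[symmetric])
    with * show ?R
      by (intro exI[of _ m] exI[of _ g'] exI[of _ h']) (auto simp: nonzero_eq_divide_eq)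
  next
    assume ?R
    then obtain m g h where *: "hform m h P \<noteq> 0"
      "\<forall>Q\<in>U. hform m h Q \<noteq> 0 \<longrightarrow> f Q = hform m g Q / hform m h Q" by auto
    have "hform m h \<in> forms m" "hform m g \<in> forms m" by (auto simp: range_hform[symmetric])
    hence "hform m h * hform m h \<in> forms (m + m)" "hform m g * hform m h \<in> forms (m + m)"
      by (auto intro: forms_mult)
    moreover have "f Q * (hform m h * hform m h) Q = (hform m g * hform m h) Q" if "Q \<in> U" for Q
      using * that by (cases "hform m h Q = 0") auto
    ultimately show ?L using *
      by (intro exI[of _ "m + m"] bexI[of _ "hform m h * hform m h"]
          bexI[of _ "hform m g * hform m h"]) auto
  qed
  thus ?thesis
    unfolding regular_def mem_Collect_eq by (simp only: loc cong: ball_cong)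
qed

lemma regularI:
  assumes "\<And>P. P \<notin> U \<Longrightarrow> f P = 0"
    and "\<And>P. P \<in> U \<Longrightarrow> \<exists>m. \<exists>h\<in>forms m. \<exists>g\<in>forms m. h P \<noteq> 0 \<and> (\<forall>Q\<in>U. f Q * h Q = g Q)"
  shows "f \<in> regular U"
  using assms by (auto simp: regular_iff)

lemma regularE:
  assumes "f \<in> regular U" "P \<in> U"
  obtains m h g where "h \<in> forms m" "g \<in> forms m" "h P \<noteq> 0" "\<And>Q. Q \<in> U \<Longrightarrow> f Q * h Q = g Q"
  using assms unfolding regular_iff by blast

lemma regular_outside: "f \<in> regular U \<Longrightarrow> P \<notin> U \<Longrightarrow> f P = 0"
  unfolding regular_def by blast

lemma regular_restrict:
  assumes "f \<in> regular U" "V \<subseteq> U"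
  shows "(\<lambda>P. if P \<in> V then f P else 0) \<in> regular V"
proof (rule regularI)
  fix P assume "P \<in> V"
  with assms obtain m h g where "h \<in> forms m" "g \<in> forms m" "h P \<noteq> 0"
    "\<And>Q. Q \<in> U \<Longrightarrow> f Q * h Q = g Q" by (auto elim: regularE)
  with assms(2) show "\<exists>m. \<exists>h\<in>forms m. \<exists>g\<in>forms m. h P \<noteq> 0 \<and>
      (\<forall>Q\<in>V. (if Q \<in> V then f Q else 0) * h Q = g Q)"
    by (intro exI[of _ m] bexI[of _ h] bexI[of _ g]) auto
qed auto

text \<open>Each local equation is multiplied by the denominator of the other one; sums and products
  then need no case distinction.\<close>

lemma regular_common_denominator:
  assumes "f1 \<in> regular U" "f2 \<in> regular U" "P \<in> U"
  obtains m h g1 g2 where "h \<in> forms m" "g1 \<in> forms m" "g2 \<in> forms m" "h P \<noteq> 0"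
    "\<And>Q. Q \<in> U \<Longrightarrow> f1 Q * h Q = g1 Q" "\<And>Q. Q \<in> U \<Longrightarrow> f2 Q * h Q = g2 Q"
proof -
  obtain m h g where 1: "h \<in> forms m" "g \<in> forms m" "h P \<noteq> 0" "\<And>Q. Q \<in> U \<Longrightarrow> f1 Q * h Q = g Q"
    using regularE[OF assms(1,3)] by metis
  obtain m' h' g' where 2: "h' \<in> forms m'" "g' \<in> forms m'" "h' P \<noteq> 0"
     "\<And>Q. Q \<in> U \<Longrightarrow> f2 Q * h' Q = g' Q"
    using regularE[OF assms(2,3)] by metis
  show ?thesis
  proof
    show "h * h' \<in> forms (m + m')" "g * h' \<in> forms (m + m')" "h * g' \<in> forms (m + m')"
      using 1 2 by (auto intro: forms_mult)
    show "(h * h') P \<noteq> 0" using 1 2 by simp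
    show "f1 Q * (h * h') Q = (g * h') Q" "f2 Q * (h * h') Q = (h * g') Q" if "Q \<in> U" for Q
      using 1(4)[OF that, symmetric] 2(4)[OF that, symmetric] by (simp_all add: mult_ac)
  qed
qed

lemma regular_add:
  assumes "f1 \<in> regular U" "f2 \<in> regular U"
  shows "f1 + f2 \<in> regular U"
proof (rule regularI)
  fix P assume P: "P \<in> U"
  obtain m h g1 g2 where "h \<in> forms m" "g1 \<in> forms m" "g2 \<in> forms m" "h P \<noteq> 0"
    "\<And>Q. Q \<in> U \<Longrightarrow> f1 Q * h Q = g1 Q" "\<And>Q. Q \<in> U \<Longrightarrow> f2 Q * h Q = g2 Q"
    using regular_common_denominator[OF assms P] by metis
  thus "\<exists>m. \<exists>h\<in>forms m. \<exists>g\<in>forms m. h P \<noteq> 0 \<and> (\<forall>Q\<in>U. (f1 + f2) Q * h Q = g Q)"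
    by (intro exI[of _ m] bexI[of _ h] bexI[of _ "g1 + g2"]) (auto simp: forms_add distrib_right)
qed (use assms in \<open>auto simp: regular_outside\<close>)

lemma regular_mult:
  assumes "f1 \<in> regular U" "f2 \<in> regular U"
  shows "f1 * f2 \<in> regular U"
proof (rule regularI)
  fix P assume P: "P \<in> U"
  obtain m h g1 g2 where *: "h \<in> forms m" "g1 \<in> forms m" "g2 \<in> forms m" "h P \<noteq> 0"
    "\<And>Q. Q \<in> U \<Longrightarrow> f1 Q * h Q = g1 Q" "\<And>Q. Q \<in> U \<Longrightarrow> f2 Q * h Q = g2 Q"
    using regular_common_denominator[OF assms P] by metis
  have "(f1 * f2) Q * (h * h) Q = (g1 * g2) Q" if "Q \<in> U" for Q
    using *(5,6)[OF that, symmetric] by (simp add: mult_ac)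
  with *(1-4) show "\<exists>m. \<exists>h\<in>forms m. \<exists>g\<in>forms m. h P \<noteq> 0 \<and> (\<forall>Q\<in>U. (f1 * f2) Q * h Q = g Q)"
    by (intro exI[of _ "m + m"] bexI[of _ "h * h"] bexI[of _ "g1 * g2"]) (auto simp: forms_mult)
qed (use assms in \<open>auto simp: regular_outside\<close>)

lemma regular_sc:
  assumes "f \<in> regular U"
  shows "sc c f \<in> regular U"
proof (rule regularI)
  fix P assume P: "P \<in> U"
  obtain m h g where 1: "h \<in> forms m" "g \<in> forms m" "h P \<noteq> 0" "\<And>Q. Q \<in> U \<Longrightarrow> f Q * h Q = g Q"
    using regularE[OF assms(1) P] by metis
  show "\<exists>m. \<exists>h\<in>forms m. \<exists>g\<in>forms m. h P \<noteq> 0 \<and> (\<forall>Q\<in>U. (sc c f) Q * h Q = g Q)"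
    by (intro exI[of _ m] bexI[of _ h] bexI[of _ "sc c g"])
        (use 1 in \<open>auto simp: forms_sc mult.assoc\<close>)
qed (use assms in \<open>auto simp: regular_outside\<close>)

lemma regular_zero: "0 \<in> regular U"
proof (rule regularI)
  have "(0 :: 'a rfun) \<in> forms 0" by (intro vs.subspace_0 subspace_forms)
  thus "\<exists>m. \<exists>h\<in>forms m. \<exists>g\<in>forms m. h P \<noteq> 0 \<and> (\<forall>Q\<in>U. 0 Q * h Q = g Q)" for P :: "'a pt"
    using one_in_forms by (intro exI[of _ 0] bexI[of _ 1] bexI[of _ 0]) auto
qed (simp add: zero_fun_apply)

lemma subspace_regular: "vs.subspace (regular U)"
  by (rule vs.subspaceI) (auto simp: regular_add regular_sc regular_zero)

text \<open>The exponent is positive because regular functions are extended by 0 outside the open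
  set, where \<open>f ^ 0\<close> would be 1.\<close>

lemma regular_power: "f \<in> regular U \<Longrightarrow> m > 0 \<Longrightarrow> f ^ m \<in> regular U"
proof (induction m)
  case (Suc m)
  thus ?case using regular_mult[of f U "f ^ m"]
    by (cases "m = 0") (auto simp only: power_Suc power_0 mult_1_right)
qed simp

section \<open>Regular functions on the affine curve\<close>

definition xc :: "'k::field pt \<Rightarrow> 'k" where "xc = (\<lambda>(X, Y, Z). X / Z)"
definition yc :: "'k::field pt \<Rightarrow> 'k" where "yc = (\<lambda>(X, Y, Z). Y / Z)"

text \<open>The outer variable of a polynomial over polynomials stands for \<open>y\<close>, the inner one for \<open>x\<close>.\<close>

definition ev :: "'k::field poly poly \<Rightarrow> 'k rfun" where
  "ev F = (\<lambda>P. poly (poly F [:yc P:]) (xc P))"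

lemma ev_simps [simp]:
  "ev 0 P = 0" "ev 1 P = 1" "ev (F + G) P = ev F P + ev G P" "ev (F - G) P = ev F P - ev G P"
  "ev (F * G) P = ev F P * ev G P" "ev (F ^ m) P = ev F P ^ m" "ev [:r:] P = poly r (xc P)"
  "ev (smult r F) P = poly r (xc P) * ev F P" "ev (monom r m) P = poly r (xc P) * yc P ^ m"
  "ev (pCons r F) P = poly r (xc P) + yc P * ev F P"
  by (simp_all add: ev_def poly_monom)

lemma ev_sum [simp]: "ev (\<Sum>i\<in>I. F i) P = (\<Sum>i\<in>I. ev (F i) P)"
  by (induction I rule: infinite_finite_induct) auto

text \<open>A monomial of degree m is Z^m times a monomial in x = X/Z and y = Y/Z.\<close>

lemma forms_dehomogenize:
  assumes "h \<in> forms m"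
  obtains H where "\<And>X Y Z. Z \<noteq> 0 \<Longrightarrow> h (X, Y, Z) = Z ^ m * ev H (X, Y, Z)"
proof -
  let ?S = "{h :: 'a rfun. \<exists>H. \<forall>X Y Z. Z \<noteq> 0 \<longrightarrow> h (X, Y, Z) = Z ^ m * ev H (X, Y, Z)}"
  have "vs.subspace ?S"
  proof (rule vs.subspaceI)
    show "0 \<in> ?S" by (auto intro!: exI[of _ 0])
    fix f g assume "f \<in> ?S" "g \<in> ?S"
    then obtain F G where "\<forall>X Y Z. Z \<noteq> 0 \<longrightarrow> f (X, Y, Z) = Z ^ m * ev F (X, Y, Z)"
      "\<forall>X Y Z. Z \<noteq> 0 \<longrightarrow> g (X, Y, Z) = Z ^ m * ev G (X, Y, Z)" by auto
    thus "f + g \<in> ?S" by (auto intro!: exI[of _ "F + G"] simp: algebra_simps)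
  next
    fix c f assume "f \<in> ?S"
    then obtain F where "\<forall>X Y Z. Z \<noteq> 0 \<longrightarrow> f (X, Y, Z) = Z ^ m * ev F (X, Y, Z)" by auto
    thus "sc c f \<in> ?S" by (auto intro!: exI[of _ "smult [:c:] F"] simp: algebra_simps)
  qed
  moreover have "pmon i j k \<in> ?S" if "i + j + k = m" for i j k
    unfolding mem_Collect_eq
  proof (intro exI allI impI)
    fix X Y Z :: 'a assume Z: "Z \<noteq> 0"
    have "Z ^ m = Z ^ i * Z ^ j * Z ^ k" using that by (auto simp: power_add)
    thus "pmon i j k (X, Y, Z) = Z ^ m * ev (monom (monom 1 i) j) (X, Y, Z)"
      using Z by (simp add: pmon_def poly_monom xc_def yc_def power_divide)
  qed
  ultimately have "forms m \<subseteq> ?S"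
    unfolding forms_def by (intro vs.span_minimal) auto
  with assms that show ?thesis by blast
qed

text \<open>The parameter \<open>ty\<close> pins the field type, which no other parameter
  mentions.\<close>

locale hermitian =
  fixes p n q :: nat and ty :: "'k::alg_closed_field itself"
  assumes prime_p: "prime p" and n_pos: "n \<ge> 1" and q_def: "q = p ^ n" and char_k: "CHAR('k) = p"
begin

section \<open>Characteristic p: Frobenius and additive polynomials\<close>

lemma p_gt_1: "p > 1" using prime_p prime_gt_1_nat by auto

lemma q_gt_1: "q > 1" using p_gt_1 n_pos unfolding q_def by (intro one_less_power) auto

lemma of_nat_p [simp]: "(of_nat p :: 'k) = 0"
  using of_nat_CHAR[where ?'a = 'k] char_k by simp

lemma of_nat_q [simp]: "(of_nat q :: 'k) = 0"
  using n_pos p_gt_1 by (simp add: q_def)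

lemma frobenius_add: "(a + b :: 'k) ^ p = a ^ p + b ^ p"
  by (rule freshmans_dream) (simp_all add: prime_p char_k)

lemma frobenius_q_add: "(a + b :: 'k) ^ q = a ^ q + b ^ q"
  by (rule freshmans_dream') (simp_all add: prime_p char_k q_def)

lemma frobenius_minus: "(- a :: 'k) ^ p = - (a ^ p)"
proof -
  have "(a + - a) ^ p = 0" using p_gt_1 by simp
  thus ?thesis unfolding frobenius_add by (simp add: eq_neg_iff_add_eq_0 add.commute)
qed

lemma frobenius_q_minus: "(- a :: 'k) ^ q = - (a ^ q)"
proof -
  have "(a + - a) ^ q = 0" using q_gt_1 by simp
  thus ?thesis unfolding frobenius_q_add by (simp add: eq_neg_iff_add_eq_0 add.commute)
qed

lemma frobenius_q_diff: "(a - b :: 'k) ^ q = a ^ q - b ^ q"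
  using frobenius_q_add[of a "- b"] by (simp add: frobenius_q_minus)

lemma frobenius_inj: "(a :: 'k) ^ p = b ^ p \<Longrightarrow> a = b"
proof -
  assume "a ^ p = b ^ p"
  hence "(a + - b) ^ p = 0" unfolding frobenius_add frobenius_minus by simp
  thus ?thesis by simp
qed

text \<open>The polynomial \<open>y ^ p ^ m + y - c\<close> has derivative \<open>1\<close>, so its roots are simple.\<close>

lemma card_additive_roots:
  fixes c :: 'k
  assumes "m \<ge> 1"
  shows "card {y. y ^ p ^ m + y = c} = p ^ m"
proof -
  define Q where "Q = p ^ m"
  have Q: "Q > 1" using p_gt_1 assms unfolding Q_def by (intro one_less_power) auto
  have Q0: "(of_nat Q :: 'k) = 0" using assms p_gt_1 by (simp add: Q_def)
  define R where "R = monom 1 Q + [:- c, 1:]"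
  have deg: "degree R = Q" unfolding R_def using Q
    by (subst degree_add_eq_left) (auto simp: degree_monom_eq)
  have lead: "lead_coeff R = 1" using Q
    by (simp add: deg) (simp add: R_def coeff_pCons split: nat.splits)
  have roots: "{y. y ^ Q + y = c} = {y. poly R y = 0}"
    by (auto simp: R_def poly_monom eq_diff_eq algebra_simps add_eq_0_iff)
  have der: "pderiv R = 1"
    using Q0 by (simp add: R_def pderiv_add pderiv_monom pderiv_pCons)
  have "R \<noteq> 0" using lead by auto
  then obtain A where A: "size A = Q" "R = (\<Prod>x\<in>#A. [:-x, 1:])"
    using alg_closed_imp_factorization[of R] lead deg by auto
  have set: "{y. poly R y = 0} = set_mset A"
    unfolding A(2) by (auto simp: poly_prod_mset prod_mset_zero_iff)
  have "count A a = 1" if "a \<in># A" for a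
  proof (rule ccontr)
    assume neq: "count A a \<noteq> 1"
    obtain B where B: "A = add_mset a B" using multi_member_split[of a A] \<open>a \<in># A\<close> by auto
    have "count B a > 0" using neq that unfolding B by (cases "count B a") auto
    hence "a \<in># B" by simp
    then obtain C where C: "B = add_mset a C" using multi_member_split[of a B] by blast
    have "R = [:-a, 1:] * ([:-a, 1:] * (\<Prod>x\<in>#C. [:-x, 1:]))"
      by (subst A(2)) (simp only: B C image_mset_add_mset prod_mset.add_mset)
    hence "poly (pderiv R) a = 0" by (simp only: pderiv_mult poly_add poly_mult) simp
    with der show False by simp
  qed
  hence "size A = card (set_mset A)"
    unfolding size_multiset_overloaded_eq by simp
  with A(1) set roots show ?thesis by (simp add: Q_def)
qed

text \<open>The polynomials y^(p^m) + y have p^m distinct roots, more than any finite field of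
  bounded size can hold.\<close>

lemma infinite_UNIV_k: "infinite (UNIV :: 'k set)"
proof
  assume fin: "finite (UNIV :: 'k set)"
  define m where "m = Suc (card (UNIV :: 'k set))"
  have "p ^ m = card {y :: 'k. y ^ p ^ m + y = 0}" using card_additive_roots[of m 0]
    by (simp add: m_def)
  also have "\<dots> \<le> card (UNIV :: 'k set)" using fin by (intro card_mono) auto
  also have "\<dots> < m" by (simp add: m_def)
  also have "m < 2 ^ m" by simp
  also have "(2::nat) ^ m \<le> p ^ m" using p_gt_1 by (intro power_mono) auto
  finally show False by simp
qed

section \<open>Fibres over the x-line and reduction of polynomials modulo the curve equation\<close>

definition fibre :: "'k \<Rightarrow> 'k set" where "fibre c = {y. y ^ q + y = c ^ (q + 1)}"

lemma card_fibre: "card (fibre c) = q"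
  using card_additive_roots[OF n_pos, of "c ^ (q + 1)"] unfolding fibre_def q_def[symmetric] .

lemma finite_fibre [simp]: "finite (fibre c)"
  using card_fibre[of c] q_gt_1 by (intro card_ge_0_finite) auto

text \<open>After subtracting the constant, a polynomial in y of degree below q has the q points of
  the fibre as roots, so it is zero.\<close>

lemma ev_fibre_const:
  assumes deg: "degree F < q" and const: "\<And>y. y \<in> fibre c \<Longrightarrow> poly (poly F [:y:]) c = d"
  shows "poly (coeff F b) c = (if b = 0 then d else 0)"
proof -
  define G where "G = map_poly (\<lambda>r. poly r c) F - [:d:]"
  have pG: "poly G y = poly (poly F [:y:]) c - d" for y
  proof -
    have "poly (map_poly (\<lambda>r. poly r c) F) y = poly (poly F [:y:]) c"
      by (induction F) (auto simp: map_poly_pCons)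
    thus ?thesis by (simp add: G_def)
  qed
  have "degree G < q"
    unfolding G_def using deg q_gt_1
    by (intro degree_diff_less) (auto intro: le_less_trans[OF map_poly_degree_leq])
  moreover have "q \<le> card {y. poly G y = 0}" if "G \<noteq> 0"
    using that const card_mono[OF poly_roots_finite[OF that], of "fibre c"]
    by (simp add: pG card_fibre subset_iff)
  ultimately have "G = 0"
    using card_poly_roots_bound[of G] by fastforce
  hence "map_poly (\<lambda>r. poly r c) F = [:d:]" by (simp add: G_def)
  hence "coeff (map_poly (\<lambda>r. poly r c) F) b = coeff [:d:] b" by simp
  thus ?thesis by (simp add: coeff_map_poly coeff_pCons split: nat.splits)
qed

lemma poly_eq_0_if_infinite:
  fixes r :: "'k poly"
  assumes "infinite V" "\<And>c. c \<in> V \<Longrightarrow> poly r c = 0"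
  shows "r = 0"
proof (rule ccontr)
  assume "r \<noteq> 0"
  hence "finite {c. poly r c = 0}" by (rule poly_roots_finite)
  moreover have "V \<subseteq> {c. poly r c = 0}" using assms(2) by auto
  ultimately show False using assms(1) finite_subset by blast
qed

lemma normal_form_eq_0:
  assumes "degree F < q" "infinite V"
    and "\<And>c y. c \<in> V \<Longrightarrow> y \<in> fibre c \<Longrightarrow> poly (poly F [:y:]) c = 0"
  shows "F = 0"
proof (rule poly_eqI)
  fix b
  have "poly (coeff F b) c = 0" if "c \<in> V" for c
    using ev_fibre_const[of F c 0 b] assms(1,3) that by auto
  thus "coeff F b = coeff 0 b" using poly_eq_0_if_infinite[OF assms(2)] by simp
qed

text \<open>Division with remainder by the monic polynomial y^q + y - x^(q+1), one coefficient at a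
  time: multiplying a reduced polynomial by y raises the degree to at most q, and one multiple of
  \<open>E\<close> removes the top term.\<close>

lemma normal_form_exists:
  obtains F0 where "degree F0 < q"
    "\<And>c y. y \<in> fibre c \<Longrightarrow> poly (poly F0 [:y:]) c = poly (poly F [:y:]) (c :: 'k)"
proof -
  have "\<exists>F0. degree F0 < q \<and> (\<forall>c. \<forall>y\<in>fibre c. poly (poly F0 [:y:]) c = poly (poly F [:y:]) c)"
  proof (induction F)
    case 0
    show ?case using q_gt_1 by (intro exI[of _ 0]) auto
  next
    case (pCons a F)
    then obtain F0 where F0: "degree F0 < q"
      "\<And>c y. y \<in> fibre c \<Longrightarrow> poly (poly F0 [:y:]) c = poly (poly F [:y:]) c" by auto
    define E :: "'k poly poly" where "E = monom 1 q + [:- monom 1 (q + 1), 1:]"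
    define G where "G = pCons a F0 - smult (coeff (pCons a F0) q) E"
    have "coeff G i = 0" if "i \<ge> q" for i
    proof (cases "i = q")
      case True
      thus ?thesis using q_gt_1 by (auto simp: G_def E_def coeff_pCons split: nat.splits)
    next
      case False
      with that q_gt_1 F0(1) show ?thesis
        by (auto simp: G_def E_def coeff_pCons coeff_eq_0 split: nat.splits)
    qed
    hence "degree G < q" using q_gt_1
      by (metis degree_0 leading_coeff_0_iff linorder_not_le zero_less_one order.strict_trans)
    moreover have "poly (poly G [:y:]) c = poly (poly (pCons a F) [:y:]) c" if "y \<in> fibre c" for c y
    proof -
      have "poly (poly E [:y:]) c = 0"
        using that by (simp add: E_def fibre_def poly_monom diff_eq_eq algebra_simps)
      thus ?thesis using F0(2)[OF that] by (simp add: G_def)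
    qed
    ultimately show ?case by blast
  qed
  with that show ?thesis by blast
qed

text \<open>Treats \<open>U1 q\<close> and \<open>U12 q\<close> uniformly: they are the parts of the
  affine curve over the whole x-line and over its nonzero points.\<close>

definition over :: "'k set \<Rightarrow> 'k pt set" where
  "over V = {P \<in> hermitian_curve q. snd (snd P) \<noteq> 0 \<and> xc P \<in> V}"

lemma affine_point: "(c, y, 1) \<in> over V \<longleftrightarrow> c \<in> V \<and> y \<in> fibre c"
  by (auto simp: over_def hermitian_curve_def fibre_def xc_def)

lemma yc_in_fibre:
  assumes "P \<in> over V"
  shows "xc P \<in> V" "yc P \<in> fibre (xc P)"
proof -
  obtain X Y Z where P: "P = (X, Y, Z)" by (cases P)
  from assms P have "Z \<noteq> 0" and eq: "Y ^ q * Z + Y * Z ^ q = X ^ (q + 1)"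
    by (auto simp: over_def hermitian_curve_def)
  have "(Y ^ q * Z + Y * Z ^ q) / Z ^ (q + 1) = X ^ (q + 1) / Z ^ (q + 1)" by (simp only: eq)
  thus "yc P \<in> fibre (xc P)"
    using \<open>Z \<noteq> 0\<close> by (simp add: P fibre_def xc_def yc_def power_divide add_divide_distrib)
  show "xc P \<in> V" using assms by (simp add: over_def)
qed

lemma U1_eq: "U1 q = over UNIV"
  using q_gt_1 by (auto simp: U1_def over_def hermitian_curve_def zero_power)

text \<open>On the affine curve x = 0 forces y^q + y = 0, so the points missing from
  \<open>U2 q\<close> are exactly the fibre over 0.\<close>

lemma U12_eq: "U12 q = over (- {0})"
proof -
  have "Y ^ q * Z + Y * Z ^ q = 0 \<longleftrightarrow> (Y / Z) ^ q + Y / Z = 0" if "Z \<noteq> 0" for Y Z :: 'k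
  proof -
    have "(Y ^ q * Z + Y * Z ^ q) / Z ^ (q + 1) = (Y / Z) ^ q + Y / Z"
      using that by (simp add: power_divide add_divide_distrib)
    thus ?thesis using that by (metis divide_eq_0_iff power_not_zero)
  qed
  thus ?thesis unfolding U1_eq
    using q_gt_1 by (auto simp: U2_def over_def hermitian_curve_def xc_def)
qed

text \<open>
  Translations \<open>y \<mapsto> y + a\<close> with \<open>a ^ q + a = 0\<close> permute each fibre simply transitively,
  so the product of the translates of \<open>H\<close> is a norm to \<open>k[x]\<close>.
\<close>

lemma norm_exists:
  obtains H' N where "\<And>P V. P \<in> over V \<Longrightarrow> ev (H * H') P = poly N (xc P)"
    "\<And>c. poly N c = (\<Prod>y\<in>fibre c. poly (poly H [:y:]) c)"
proof -
  define tr where "tr a = pcompose H [:[:a:], 1:]" for a :: 'k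
  have tr: "poly (poly (tr a) [:y:]) c = poly (poly H [:y + a:]) c" for a y c
    by (simp add: tr_def poly_pcompose add.commute)
  have prod: "(\<Prod>a\<in>fibre 0. poly (poly (tr a) [:y:]) c) = (\<Prod>z\<in>fibre c. poly (poly H [:z:]) c)"
    if "y \<in> fibre c" for c y
  proof -
    have "bij_betw (\<lambda>a. y + a) (fibre 0) (fibre c)"
      by (rule bij_betw_byWitness[of _ "\<lambda>z. z - y"])
        (use that q_gt_1 in \<open>auto simp: fibre_def frobenius_q_add frobenius_q_diff algebra_simps
            add_eq_0_iff\<close>)
    thus ?thesis unfolding tr by (subst prod.reindex_bij_betw[symmetric]) auto
  qed
  have zero: "0 \<in> fibre 0" using q_gt_1 by (auto simp: fibre_def)
  define H' where "H' = (\<Prod>a\<in>fibre 0 - {0}. tr a)"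
  have "tr 0 = H" by (simp add: tr_def pcompose_idR)
  hence HH': "H * H' = (\<Prod>a\<in>fibre 0. tr a)"
    unfolding H'_def using prod.remove[of "fibre 0" 0 tr] zero by simp
  \<comment> \<open>The product of all translates is constant on each fibre. In its reduced form the
    coefficients of positive powers of y therefore vanish at every c, which leaves a polynomial in
    x.\<close>
  obtain M where M: "degree M < q"
    "\<And>c y. y \<in> fibre c \<Longrightarrow> poly (poly M [:y:]) c = poly (poly (H * H') [:y:]) c"
    using normal_form_exists[of "H * H'"] by metis
  have Mprod: "poly (poly M [:y:]) c = (\<Prod>z\<in>fibre c. poly (poly H [:z:]) c)" if "y \<in> fibre c" for c y
    using M(2)[OF that] prod[OF that] by (simp add: HH' poly_prod)
  have co: "poly (coeff M b) c = (if b = 0 then \<Prod>z\<in>fibre c. poly (poly H [:z:]) c else 0)" for b c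
    using ev_fibre_const[of M c _ b] M(1) Mprod by blast
  have "coeff M b = 0" if "b \<noteq> 0" for b
    using poly_eq_0_if_infinite[OF infinite_UNIV_k, of "coeff M b"] co that by auto
  hence "M = [:coeff M 0:]"
    by (intro poly_eqI) (auto simp: coeff_pCons split: nat.splits)
  hence ev: "ev M P = poly (coeff M 0) (xc P)" for P by (metis ev_simps(7))
  show ?thesis
  proof
    show "poly (coeff M 0) c = (\<Prod>y\<in>fibre c. poly (poly H [:y:]) c)" for c
      using co[of 0 c] by simp
    show "ev (H * H') P = poly (coeff M 0) (xc P)" if "P \<in> over V" for P V
      using M(2)[OF yc_in_fibre(2)[OF that]] ev[of P] by (simp add: ev_def)
  qed
qed

text \<open>Every point of the fibre over c comes with its own denominator. Weighted by Lagrange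
  factors, each vanishing at all fibre points but one, they add up to a single denominator that is
  nonzero on the whole fibre; its norm is a denominator in k[x] that is nonzero at c.\<close>

lemma local_denominator:
  assumes f: "f \<in> regular (over V)" and c: "c \<in> V"
  obtains N G where "poly N c \<noteq> 0" "\<And>P. P \<in> over V \<Longrightarrow> poly N (xc P) * f P = ev G P"
proof -
  have "\<exists>H G. poly (poly H [:y:]) c \<noteq> 0 \<and> (\<forall>P\<in>over V. ev H P * f P = ev G P)" if y: "y
      \<in> fibre c" for y
  proof -
    have "(c, y, 1) \<in> over V" using c y by (simp add: affine_point)
    then obtain m h g where hg: "h \<in> forms m" "g \<in> forms m" "h (c, y, 1) \<noteq> 0"
      "\<And>Q. Q \<in> over V \<Longrightarrow> f Q * h Q = g Q" using f by (auto elim: regularE)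
    obtain H where H: "\<And>X Y Z. Z \<noteq> 0 \<Longrightarrow> h (X, Y, Z) = Z ^ m * ev H (X, Y, Z)"
      using forms_dehomogenize[OF hg(1)] by metis
    obtain G where G: "\<And>X Y Z. Z \<noteq> 0 \<Longrightarrow> g (X, Y, Z) = Z ^ m * ev G (X, Y, Z)"
      using forms_dehomogenize[OF hg(2)] by metis
    have "poly (poly H [:y:]) c \<noteq> 0" using H[of 1 c y] hg(3) by (simp add: ev_def xc_def yc_def)
    moreover have "ev H P * f P = ev G P" if "P \<in> over V" for P
    proof -
      obtain X Y Z where P: "P = (X, Y, Z)" by (cases P)
      hence "Z \<noteq> 0" using that by (auto simp: over_def)
      thus ?thesis using hg(4)[OF that] H[of Z X Y] G[of Z X Y] P by (simp add: mult.commute)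
    qed
    ultimately show ?thesis by blast
  qed
  then obtain H G where H: "\<And>y. y \<in> fibre c \<Longrightarrow> poly (poly (H y) [:y:]) c \<noteq> 0"
    "\<And>y P. y \<in> fibre c \<Longrightarrow> P \<in> over V \<Longrightarrow> ev (H y) P * f P = ev (G y) P" by metis
  define L where "L y = (\<Prod>z\<in>fibre c - {y}. [:- [:z:], 1:])" for y :: 'k
  have L: "poly (poly (L y) [:z:]) c = (\<Prod>w\<in>fibre c - {y}. z - w)" for y z
    by (simp add: L_def poly_prod)
  define K where "K = (\<Sum>y\<in>fibre c. L y * H y)"
  have K: "poly (poly K [:y:]) c \<noteq> 0" if "y \<in> fibre c" for y
  proof -
    have "poly (poly K [:y:]) c = (\<Sum>z\<in>fibre c. (\<Prod>w\<in>fibre c - {z}. y - w) * poly (poly (H z) [:y:])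
        c)"
      by (simp add: K_def poly_sum L)
    also have "\<dots> = (\<Sum>z\<in>fibre c. if z = y then (\<Prod>w\<in>fibre c - {z}. y - w) * poly (poly (H z) [:y:])
        c else 0)"
      using that by (intro sum.cong) auto
    also have "\<dots> \<noteq> 0" using that H(1) by auto
    finally show ?thesis .
  qed
  obtain K' N where KN: "\<And>P V. P \<in> over V \<Longrightarrow> ev (K * K') P = poly N (xc P)"
    "\<And>c. poly N c = (\<Prod>y\<in>fibre c. poly (poly K [:y:]) c)"
    using norm_exists[of K] by metis
  show ?thesis
  proof
    show "poly N c \<noteq> 0" using K by (simp add: KN(2))
    fix P assume P: "P \<in> over V"
    have "ev K P * f P = (\<Sum>y\<in>fibre c. ev (L y) P * (ev (H y) P * f P))"
      by (simp add: K_def sum_distrib_right mult.assoc)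
    also have "\<dots> = ev (\<Sum>y\<in>fibre c. L y * G y) P" using H(2) P by simp
    finally show "poly N (xc P) * f P = ev (K' * (\<Sum>y\<in>fibre c. L y * G y)) P"
      unfolding KN(1)[OF P, symmetric] by (simp add: mult.commute mult.left_commute)
  qed
qed

text \<open>
  A denominator in \<open>k[x]\<close> of minimal degree divides all the local denominators,
  so it has no roots in \<open>V\<close>.
\<close>

lemma regular_over_polynomial:
  assumes f: "f \<in> regular (over V)" and V: "V \<noteq> {}" "- {0} \<subseteq> V"
  obtains m G where "0 \<in> V \<longrightarrow> m = 0" "\<And>P. P \<in> over V \<Longrightarrow> xc P ^ m * f P = ev G P"
proof -
  define I where "I = {N. \<exists>G. \<forall>P\<in>over V. poly N (xc P) * f P = ev G P}"
  have locI: "\<exists>N\<in>I. poly N c \<noteq> 0" if c: "c \<in> V" for c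
  proof -
    obtain N G where "poly N c \<noteq> 0" "\<And>P. P \<in> over V \<Longrightarrow> poly N (xc P) * f P = ev G P"
      using local_denominator[OF f c] by metis
    thus ?thesis unfolding I_def by (intro bexI[of _ N] CollectI exI[of _ G] ballI)
  qed
  have "\<exists>N. N \<in> I \<and> N \<noteq> 0"
  proof -
    obtain c where "c \<in> V" using V by auto
    then obtain N where "N \<in> I" "poly N c \<noteq> 0"
      using locI by blast
    thus ?thesis by (intro exI[of _ N]) auto
  qed
  then obtain N where N: "N \<in> I" "N \<noteq> 0" "\<And>M. M \<in> I \<Longrightarrow> M \<noteq> 0 \<Longrightarrow> degree N \<le> degree M"
    using exists_least_iff[of "\<lambda>d. \<exists>N\<in>I. N \<noteq> 0 \<and> degree N = d"]
    by (metis linorder_not_less)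
  obtain G where G: "\<And>P. P \<in> over V \<Longrightarrow> poly N (xc P) * f P = ev G P"
    using N(1) unfolding I_def by blast
  have dvd: "N dvd M" if M: "M \<in> I" for M
  proof -
    obtain F where F: "\<And>P. P \<in> over V \<Longrightarrow> poly M (xc P) * f P = ev F P"
      using M unfolding I_def by blast
    have "M mod N \<in> I" unfolding I_def
    proof (intro CollectI exI ballI)
      fix P assume P: "P \<in> over V"
      have "poly (M mod N) (xc P) = poly M (xc P) - poly (M div N) (xc P) * poly N (xc P)"
        by (metis minus_div_mult_eq_mod poly_diff poly_mult)
      thus "poly (M mod N) (xc P) * f P = ev (F - smult (M div N) G) P"
        using F[OF P, symmetric] G[OF P, symmetric]
          by (simp only: ev_simps) (simp only: algebra_simps)
    qed
    hence "M mod N = 0" using N degree_mod_less[of N M] by force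
    thus ?thesis by auto
  qed
  have nz: "poly N c \<noteq> 0" if c: "c \<in> V" for c
  proof -
    obtain M where "M \<in> I" "poly M c \<noteq> 0"
      using locI[OF c] by blast
    thus ?thesis using dvd by (metis dvd_trans poly_eq_0_iff_dvd)
  qed
  \<comment> \<open>After the power of x is split off, a root of the remaining factor would be
    nonzero, hence in V, where \<open>N\<close> has no root. So this factor is constant.\<close>
  obtain N' where N': "N = [:- 0, 1:] ^ order 0 N * N'" "\<not> [:- 0, 1:] dvd N'"
    using order_decomp[OF N(2), of 0] by blast
  have "degree N' = 0"
  proof (rule ccontr)
    assume "degree N' \<noteq> 0"
    then obtain c where c: "poly N' c = 0" using alg_closed_imp_poly_has_root by blast
    hence "c \<noteq> 0" using N'(2) by (metis poly_eq_0_iff_dvd)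
    with V have "c \<in> V" by auto
    moreover have "poly N c = 0" by (subst N'(1)) (simp add: c)
    ultimately show False using nz by blast
  qed
  then obtain d where d: "N' = [:d:]" by (metis degree_0_id of_nat_0 degree_eq_zeroE)
  hence "d \<noteq> 0" using N(2) N'(1) by auto
  show ?thesis
  proof
    show "0 \<in> V \<longrightarrow> order 0 N = 0" using nz[of 0] by (auto simp: order_0I)
    fix P assume P: "P \<in> over V"
    have "poly N (xc P) = xc P ^ order 0 N * d" by (subst N'(1)) (simp add: d poly_power)
    thus "xc P ^ order 0 N * f P = ev (smult [:inverse d:] G) P"
      using G[OF P, symmetric] \<open>d \<noteq> 0\<close> by simp
  qed
qed

end

lemmas fun_simps = plus_fun_apply times_fun_apply minus_apply uminus_apply zero_fun_apply
  one_fun_apply sc_apply sum_fun_apply power_fun_apply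

text \<open>\<open>U12 q\<close> abbreviates an intersection, which must not be taken apart by automation.\<close>

declare fun_simps [simp del] Int_iff [simp del] IntE [rule del] IntI [rule del]

context hermitian begin

section \<open>Monomials, the weight basis and expansions at infinity\<close>

text \<open>Set to 0 outside \<open>U12 q\<close> so as to lie in the ring \<open>A\<close> below;
  the unit of that ring is \<open>mon 0 0\<close>, not the constant function 1.\<close>

definition mon :: "int \<Rightarrow> nat \<Rightarrow> 'k rfun" where
  "mon a b = (\<lambda>P. if P \<in> U12 q then xc P powi a * yc P ^ b else 0)"

abbreviation A :: "'k rfun set" where "A \<equiv> regular (U12 q)"

lemma U12_coords:
  fixes P :: "'k pt"
  assumes "P \<in> U12 q"
  shows "xc P \<noteq> 0" "yc P ^ q = xc P ^ (q + 1) - yc P" "yc P \<noteq> 0" "fst P \<noteq> 0" "snd (snd P) \<noteq> 0"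
proof -
  have "xc P \<in> - {0}" "yc P \<in> fibre (xc P)" using assms yc_in_fibre[of P "- {0}"]
    by (simp_all add: U12_eq)
  thus 1: "xc P \<noteq> 0" and 2: "yc P ^ q = xc P ^ (q + 1) - yc P" by (auto simp: fibre_def eq_diff_eq)
  show "yc P \<noteq> 0"
  proof
    assume "yc P = 0"
    with 1 2 show False using q_gt_1 by (simp add: zero_power)
  qed
  show "snd (snd P) \<noteq> 0" using assms by (simp add: U12_eq over_def)
  show "fst P \<noteq> 0" using 1 by (auto simp: xc_def split: prod.splits)
qed

lemma affine_U12: "(c, y, 1) \<in> U12 q \<longleftrightarrow> c \<noteq> 0 \<and> y \<in> fibre c"
  by (simp add: U12_eq affine_point del: Int_iff)

lemma affine_coords [simp]: "xc (c, y, 1) = c" "yc (c, y, 1) = y"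
  by (simp_all add: xc_def yc_def)

lemma mon_mult: "mon a b * mon a' b' = mon (a + a') (b + b')"
  using U12_coords by (auto simp: mon_def fun_eq_iff power_int_add power_add fun_simps)

lemma mon_power: "m > 0 \<Longrightarrow> mon a b ^ m = mon (int m * a) (m * b)"
  by (auto simp: mon_def fun_eq_iff power_mult_distrib power_int_power' mult.commute fun_simps
      simp flip: power_mult)

lemma mon_add_q: "mon a (b + q) = mon (a + int q + 1) b - mon a (b + 1)"
proof
  fix P
  show "mon a (b + q) P = (mon (a + int q + 1) b - mon a (b + 1)) P"
  proof (cases "P \<in> U12 q")
    case True
    have "xc P powi (a + int q + 1) = xc P powi a * xc P ^ (q + 1)"
      using U12_coords(1)[OF True] by (simp add: power_int_add)
    moreover have "yc P ^ (b + q) = yc P ^ b * (xc P ^ (q + 1) - yc P)"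
      by (simp only: power_add U12_coords(2)[OF True])
    ultimately have "xc P powi a * yc P ^ (b + q)
        = xc P powi (a + int q + 1) * yc P ^ b - xc P powi a * yc P ^ (b + 1)"
      by (simp add: right_diff_distrib mult_ac)
    thus ?thesis using True by (simp add: mon_def fun_simps)
  qed (simp add: mon_def fun_simps)
qed

lemma mon_regular: "mon a b \<in> A"
proof (rule regularI)
  fix P :: "'k pt" assume P: "P \<in> U12 q"
  \<comment> \<open>\<open>nat\<close> truncates at 0, so one pair of forms covers positive and
    negative exponents a.\<close>
  define g :: "'k rfun" where "g = pmon (nat a) b (nat (- a))"
  define h :: "'k rfun" where "h = pmon (nat (- a)) 0 (nat a + b)"
  have "h P \<noteq> 0" using U12_coords[OF P] by (auto simp: h_def pmon_def split: prod.splits)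
  moreover have "mon a b Q * h Q = g Q" if "Q \<in> U12 q" for Q
  proof -
    obtain X Y Z where Q: "Q = (X, Y, Z)" by (cases Q)
    with U12_coords[OF that] have nz: "X \<noteq> 0" "Z \<noteq> 0" by auto
    show ?thesis
    proof (cases "a \<ge> 0")
      case True
      then obtain k where "a = int k" by (metis nonneg_int_cases)
      thus ?thesis using nz that
        by (simp add: mon_def Q g_def h_def pmon_def xc_def yc_def power_divide power_add)
    next
      case False
      then obtain k where "a = - int k" by (metis nle_le nonpos_int_cases)
      thus ?thesis using nz that
        by (simp add: mon_def Q g_def h_def pmon_def xc_def yc_def power_divide power_add
            power_int_minus)
    qed
  qed
  moreover have "h \<in> forms (nat a + nat (- a) + b)" "g \<in> forms (nat a + nat (- a) + b)"
    by (auto simp: h_def g_def intro!: pmon_in_forms)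
  ultimately show "\<exists>m. \<exists>h\<in>forms m. \<exists>g\<in>forms m. h P \<noteq> 0 \<and> (\<forall>Q\<in>U12 q. mon a b Q * h Q = g Q)"
    by blast
qed (simp only: mon_def if_False)

text \<open>
  \<open>e m\<close> is the monomial with pole order \<open>m\<close> at infinity: \<open>x\<close> and \<open>y\<close> have pole orders
  \<open>q\<close> and \<open>q + 1\<close>, and \<open>m\<close> determines the exponent of \<open>y\<close> in \<open>{0..<q}\<close>.
\<close>

definition y_exp :: "int \<Rightarrow> nat" where "y_exp m = nat (m mod int q)"
definition x_exp :: "int \<Rightarrow> int" where "x_exp m = (m - int (q + 1) * (m mod int q)) div int q"
definition e :: "int \<Rightarrow> 'k rfun" where "e m = mon (x_exp m) (y_exp m)"

lemma y_exp_less: "y_exp m < q"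
  using q_gt_1 by (simp add: y_exp_def nat_less_iff)

lemma weight_x_exp_y_exp: "int q * x_exp m + int (q + 1) * int (y_exp m) = m"
proof -
  have "m - int (q + 1) * (m mod int q) = int q * (m div int q - m mod int q)"
    by (simp add: algebra_simps minus_mod_eq_mult_div)
  hence "int q * x_exp m = m - int (q + 1) * (m mod int q)"
    using q_gt_1 by (simp add: x_exp_def)
  thus ?thesis using q_gt_1 by (simp add: y_exp_def)
qed

lemma y_exp_weight: "y_exp (int q * a + int (q + 1) * int b) = b mod q"
proof -
  have "(int q * a + int (q + 1) * int b) mod int q = (int b + int q * (a + int b)) mod int q"
    by (simp add: algebra_simps)
  also have "\<dots> = int (b mod q)" by (simp add: zmod_int)
  finally show ?thesis by (simp add: y_exp_def)
qed

lemma x_exp_weight: "x_exp (int q * a + int (q + 1) * int b) = a + int (q + 1) * int (b div q)"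
proof -
  let ?w = "int q * a + int (q + 1) * int b"
  have "int q * x_exp ?w + int (q + 1) * int (b mod q) = ?w"
    using weight_x_exp_y_exp[of ?w] unfolding y_exp_weight .
  also have "\<dots> = int q * a + int (q + 1) * int (b mod q) + int (q + 1) * (int q * int (b div q))"
    by (metis (no_types, lifting) add.assoc distrib_left mod_mult_div_eq of_nat_add of_nat_mult)
  finally have "int q * x_exp ?w = int q * (a + int (q + 1) * int (b div q))"
    by (simp add: algebra_simps)
  thus ?thesis using q_gt_1 by simp
qed

lemma e_weight: "b < q \<Longrightarrow> e (int q * a + int (q + 1) * int b) = mon a b"
  by (simp only: e_def x_exp_weight y_exp_weight) simp

text \<open>For b at least q, the curve equation turns y^b into x^(q+1) y^(b-q), of the same pole
  order, minus y^(b-q+1), of smaller pole order. No step lowers the exponent of x; this bound is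
  recorded because it later recognises polynomials in x and y.\<close>

lemma mon_expand:
  "mon a b - e (int q * a + int (q + 1) * int b)
     \<in> vs.span (e ` {m. m < int q * a + int (q + 1) * int b \<and> x_exp m \<ge> a})"
proof (induction b arbitrary: a rule: less_induct)
  case (less b)
  let ?w = "\<lambda>a b. int q * a + int (q + 1) * int b"
  let ?S = "{m. m < ?w a b \<and> x_exp m \<ge> a}"
  show ?case
  proof (cases "b < q")
    case True
    thus ?thesis by (simp only: e_weight diff_self vs.span_zero)
  next
    case False
    define c where "c = b - q"
    have b: "b = c + q" using False by (simp add: c_def)
    have w1: "?w (a + int q + 1) c = ?w a b" by (simp add: b algebra_simps)
    have "int (q + 1) * int (c + 1) < int (q + 1) * int b"
      using q_gt_1 by (intro mult_strict_left_mono) (auto simp: b)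
    hence w2: "?w a (c + 1) < ?w a b" by simp
    have "mon (a + int q + 1) c - e (?w a b)
        \<in> vs.span (e ` {m. m < ?w a b \<and> x_exp m \<ge> a + int q + 1})"
      using less.IH[of c "a + int q + 1"] q_gt_1 unfolding w1 by (simp add: b)
    hence 1: "mon (a + int q + 1) c - e (?w a b) \<in> vs.span (e ` ?S)"
      by (rule subsetD[OF vs.span_mono, rotated]) auto
    have "mon a (c + 1) - e (?w a (c + 1)) \<in> vs.span (e ` {m. m < ?w a (c + 1) \<and> x_exp m \<ge> a})"
      using q_gt_1 by (intro less.IH) (simp add: b)
    hence 2: "mon a (c + 1) - e (?w a (c + 1)) \<in> vs.span (e ` ?S)"
      by (rule subsetD[OF vs.span_mono[OF image_mono[OF Collect_mono]], rotated])
        (meson w2 order.strict_trans)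
    have "e (?w a (c + 1)) \<in> vs.span (e ` ?S)"
      using w2 by (intro vs.span_base imageI CollectI conjI) (simp_all only: x_exp_weight, simp)
    with 2 have 3: "mon a (c + 1) \<in> vs.span (e ` ?S)"
      using vs.span_add by fastforce
    have "mon a b - e (?w a b) = (mon (a + int q + 1) c - e (?w a b)) - mon a (c + 1)"
      unfolding b mon_add_q by (simp add: fun_eq_iff fun_simps)
    thus ?thesis using vs.span_diff[OF 1 3] by (simp only:)
  qed
qed

text \<open>Multiplication by a large power of x turns a relation into a polynomial of degree below
  q in y that vanishes on every fibre over c \<noteq> 0, hence into the zero polynomial. Different
  indices occupy different monomials of it.\<close>

lemma e_comb_eq_0:
  assumes S: "finite S" "(\<Sum>m\<in>S. sc (d m) (e m)) = 0" and k: "k \<in> S"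
  shows "d k = 0"
proof -
  define M where "M = (\<Sum>m\<in>S. \<bar>x_exp m\<bar>)"
  have M: "x_exp m + M \<ge> 0" if "m \<in> S" for m
  proof -
    have "\<bar>x_exp m\<bar> \<le> M" unfolding M_def using S(1) that by (intro member_le_sum) auto
    thus ?thesis by linarith
  qed
  define F where "F = (\<Sum>m\<in>S. monom (monom (d m) (nat (x_exp m + M))) (y_exp m))"
  have "coeff F i = 0" if "i \<ge> q" for i
  proof -
    have "y_exp m \<noteq> i" for m using y_exp_less[of m] that by simp
    thus ?thesis by (simp add: F_def coeff_sum)
  qed
  hence "degree F < q" using q_gt_1
    by (metis degree_0 leading_coeff_0_iff linorder_not_le zero_less_one order.strict_trans)
  moreover have "infinite (- {0 :: 'k})" using infinite_UNIV_k by simp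
  moreover have "poly (poly F [:y:]) c = 0" if "c \<in> - {0}" "y \<in> fibre c" for c y
  proof -
    have P: "(c, y, 1) \<in> U12 q" using that by (simp add: affine_U12)
    have "poly (poly F [:y:]) c = (\<Sum>m\<in>S. d m * (c powi (x_exp m + M) * y ^ y_exp m))"
      by (simp add: F_def poly_sum poly_monom mult.assoc)
        (intro sum.cong refl arg_cong2[where f = "(*)"], simp add: M power_int_nonneg_exp)
    also have "\<dots> = c powi M * (\<Sum>m\<in>S. sc (d m) (e m)) (c, y, 1)"
      using that P by (simp add: sum_distrib_left e_def mon_def power_int_add mult_ac fun_simps)
    also have "\<dots> = 0" by (simp only: S(2) zero_fun_apply mult_zero_right)
    finally show ?thesis .
  qed
  ultimately have F0: "F = 0" by (rule normal_form_eq_0)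
  have "m = k" if "m \<in> S" "y_exp m = y_exp k" "nat (x_exp m + M) = nat (x_exp k + M)" for m
  proof -
    have "x_exp m + M = x_exp k + M" using that(3) M[OF that(1)] M[OF k]
      by (simp only: eq_nat_nat_iff)
    thus ?thesis using weight_x_exp_y_exp[of m] weight_x_exp_y_exp[of k] that(2) by simp
  qed
  hence "coeff (coeff F (y_exp k)) (nat (x_exp k + M)) = (\<Sum>m\<in>S. if m = k then d m else 0)"
    unfolding F_def by (simp add: coeff_sum) (intro sum.cong, auto)
  also have "\<dots> = d k" using S(1) k by simp
  finally show ?thesis using F0 by simp
qed

lemma inj_e: "inj e"
proof (rule injI, rule ccontr)
  fix m k assume eq: "e m = e k" and neq: "m \<noteq> k"
  have "(\<Sum>i\<in>{m, k}. sc (if i = m then 1 else - 1) (e i)) = 0"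
    using neq eq by (simp add: fun_eq_iff fun_simps)
  from e_comb_eq_0[OF _ this, of m] show False by simp
qed

lemma independent_e: "vs.independent (range e)"
  unfolding vs.independent_explicit_module
proof (intro allI impI)
  fix T u v assume T: "finite T" "T \<subseteq> range e" "(\<Sum>v\<in>T. sc (u v) v) = 0" "v \<in> T"
  obtain S where S: "finite S" "T = e ` S" using T(1,2) by (metis finite_subset_image)
  hence "(\<Sum>m\<in>S. sc (u (e m)) (e m)) = 0"
    using T(3) by (simp add: sum.reindex inj_on_subset[OF inj_e])
  thus "u v = 0" using e_comb_eq_0[OF S(1), of "\<lambda>m. u (e m)"] T(4) S(2) by auto
qed

section \<open>Coefficients in the weight basis and pole order at infinity\<close>

definition e_coeff :: "'k rfun \<Rightarrow> int \<Rightarrow> 'k" where "e_coeff f m = vs.representation (range e) f (e m)"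

lemma span_eD: "f \<in> vs.span (e ` S) \<Longrightarrow> f \<in> vs.span (range e)"
  using vs.span_mono[of "e ` S" "range e"] by auto

lemma e_coeff_linear:
  assumes "f \<in> vs.span (range e)" "g \<in> vs.span (range e)"
  shows "e_coeff (f + g) m = e_coeff f m + e_coeff g m"
      "e_coeff (f - g) m = e_coeff f m - e_coeff g m" "e_coeff (sc c f) m = c * e_coeff f m"
  using assms independent_e
  by (simp_all add: e_coeff_def vs.representation_add vs.representation_diff
      vs.representation_scale)

lemma e_coeff_e: "e_coeff (e m) k = (if m = k then 1 else 0)"
  using inj_e by (auto simp: e_coeff_def vs.representation_basis[OF independent_e] dest: injD)

lemma e_coeff_zero [simp]: "e_coeff 0 m = 0"
  by (simp add: e_coeff_def vs.representation_zero)

lemma e_coeff_outside: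
  assumes "f \<in> vs.span (e ` S)" "m \<notin> S"
  shows "e_coeff f m = 0"
proof -
  have "vs.subspace {f \<in> vs.span (range e). e_coeff f m = 0}"
    by (rule vs.subspaceI) (auto simp: vs.span_zero vs.span_add vs.span_scale e_coeff_linear)
  hence "vs.span (e ` S) \<subseteq> {f \<in> vs.span (range e). e_coeff f m = 0}"
    using assms(2) by (intro vs.span_minimal) (auto simp: e_coeff_e vs.span_base)
  with assms(1) show ?thesis by blast
qed

lemma e_coeff_expand:
  assumes "f \<in> vs.span (range e)"
  shows "finite {m. e_coeff f m \<noteq> 0}" "f = (\<Sum>m | e_coeff f m \<noteq> 0. sc (e_coeff f m) (e m))"
proof -
  let ?R = "vs.representation (range e) f"
  have eq: "{b. ?R b \<noteq> 0} = e ` {m. e_coeff f m \<noteq> 0}"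
    using vs.representation_ne_zero[of "range e" f] by (auto simp: e_coeff_def)
  show "finite {m. e_coeff f m \<noteq> 0}"
    using vs.finite_representation[of "range e" f] inj_on_subset[OF inj_e]
    unfolding eq by (simp add: finite_image_iff)
  have "f = (\<Sum>b | ?R b \<noteq> 0. sc (?R b) b)"
    using vs.sum_nonzero_representation_eq[OF independent_e assms] by simp
  also have "\<dots> = (\<Sum>m | e_coeff f m \<noteq> 0. sc (e_coeff f m) (e m))"
    unfolding eq by (subst sum.reindex) (auto simp: inj_on_subset[OF inj_e] e_coeff_def)
  finally show "f = (\<Sum>m | e_coeff f m \<noteq> 0. sc (e_coeff f m) (e m))" .
qed

lemma span_eI:
  assumes "f \<in> vs.span (range e)" "\<And>m. m \<notin> S \<Longrightarrow> e_coeff f m = 0"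
  shows "f \<in> vs.span (e ` S)"
  by (subst e_coeff_expand(2)[OF assms(1)], intro vs.span_sum vs.span_scale vs.span_base)
    (use assms(2) in auto)

lemma mon_expand_span: "mon a b \<in> vs.span (e ` {m. m \<le> int q * a + int (q + 1) * int b
    \<and> x_exp m \<ge> a})"
proof -
  let ?w = "int q * a + int (q + 1) * int b"
  have "mon a b - e ?w \<in> vs.span (e ` {m. m \<le> ?w \<and> x_exp m \<ge> a})"
    using mon_expand[of a b] by (rule subsetD[OF vs.span_mono, rotated]) auto
  moreover have "e ?w \<in> vs.span (e ` {m. m \<le> ?w \<and> x_exp m \<ge> a})"
    by (intro vs.span_base imageI CollectI conjI) (simp_all only: x_exp_weight, simp)
  ultimately show ?thesis using vs.span_add by fastforce
qed

lemma e_coeff_mon_weight: "e_coeff (mon a b) (int q * a + int (q + 1) * int b) = 1"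
proof -
  let ?w = "int q * a + int (q + 1) * int b"
  have "e_coeff (mon a b - e ?w) ?w = 0" using mon_expand[of a b] by (rule e_coeff_outside) simp
  thus ?thesis
    using span_eD[OF mon_expand_span[of a b]] by (simp add: e_coeff_linear vs.span_base e_coeff_e)
qed

text \<open>The functions with a pole of order at most w at infinity, expressed without a
  valuation.\<close>

definition deg_le :: "int \<Rightarrow> 'k rfun set" where "deg_le w = vs.span (e ` {..w})"

lemma mon_deg_le: "int q * a + int (q + 1) * int b \<le> w \<Longrightarrow> mon a b \<in> deg_le w"
  unfolding deg_le_def using mon_expand_span[of a b]
    by (rule subsetD[OF vs.span_mono, rotated]) auto

lemma deg_le_leading:
  assumes "f \<in> deg_le w"
  shows "f - sc (e_coeff f w) (e w) \<in> deg_le (w - 1)"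
  unfolding deg_le_def
proof (rule span_eI)
  have f: "f \<in> vs.span (range e)" using assms span_eD unfolding deg_le_def by blast
  thus "f - sc (e_coeff f w) (e w) \<in> vs.span (range e)"
    by (intro vs.span_diff vs.span_scale vs.span_base[OF rangeI])
  fix m assume "m \<notin> {..w - 1}"
  hence m: "m = w \<or> m > w" by auto
  have "e_coeff f m = 0" if "m > w"
    using e_coeff_outside[OF assms[unfolded deg_le_def], of m] that by simp
  thus "e_coeff (f - sc (e_coeff f w) (e w)) m = 0"
    using f m by (auto simp: e_coeff_linear e_coeff_e vs.span_scale vs.span_base)
qed

lemma deg_le_mult:
  assumes "f \<in> deg_le v" "g \<in> deg_le w"
  shows "f * g \<in> deg_le (v + w)"
  using assms unfolding deg_le_def
proof (rule span_mult)
  fix a b assume "a \<in> e ` {..v}" "b \<in> e ` {..w}"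
  then obtain k m where km: "a = e k" "b = e m" "k \<le> v" "m \<le> w" by auto
  have "int q * (x_exp k + x_exp m) + int (q + 1) * int (y_exp k + y_exp m) = k + m"
    using weight_x_exp_y_exp[of k] weight_x_exp_y_exp[of m] by (simp add: algebra_simps)
  thus "a * b \<in> vs.span (e ` {..v + w})"
    unfolding km(1,2) e_def mon_mult deg_le_def[symmetric]
    using km(3,4) by (intro mon_deg_le) simp
qed

text \<open>Leading coefficients multiply, as they would for a valuation: \<open>e v * e w\<close>
  is a monomial of weight v + w with leading coefficient 1, and the products with the remainders
  have smaller order.\<close>

lemma e_coeff_mult:
  assumes "f \<in> deg_le v" "g \<in> deg_le w"
  shows "e_coeff (f * g) (v + w) = e_coeff f v * e_coeff g w"
proof -
  have low: "e_coeff h (v + w) = 0" if "h \<in> deg_le (v + w - 1)" for h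
    using that e_coeff_outside unfolding deg_le_def by force
  have sp: "h \<in> vs.span (range e)" if "h \<in> deg_le m" for h m
    using that span_eD unfolding deg_le_def by blast
  define f' where "f' = f - sc (e_coeff f v) (e v)"
  define g' where "g' = g - sc (e_coeff g w) (e w)"
  have f': "f' \<in> deg_le (v - 1)" and g': "g' \<in> deg_le (w - 1)"
    using assms by (auto simp: f'_def g'_def deg_le_leading)
  have ev: "e v \<in> deg_le v" by (simp add: deg_le_def vs.span_base)
  have wt: "int q * (x_exp v + x_exp w) + int (q + 1) * int (y_exp v + y_exp w) = v + w"
    using weight_x_exp_y_exp[of v] weight_x_exp_y_exp[of w] by (simp add: algebra_simps)
  have ee: "e v * e w = mon (x_exp v + x_exp w) (y_exp v + y_exp w)" by (simp add: e_def mon_mult)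
  have 1: "e_coeff (e v * e w) (v + w) = 1" using e_coeff_mon_weight[of "x_exp v + x_exp w"
      "y_exp v + y_exp w"] ee wt by simp
  have 11: "e v * e w \<in> deg_le (v + w)" using wt by (simp add: ee mon_deg_le)
  have 2: "e v * g' \<in> deg_le (v + w - 1)" using deg_le_mult[OF ev g'] by (simp add: algebra_simps)
  have 3: "f' * g \<in> deg_le (v + w - 1)" using deg_le_mult[OF f' assms(2)]
    by (simp add: algebra_simps)
  have "f * g = sc (e_coeff f v * e_coeff g w) (e v * e w) + sc (e_coeff f v) (e v * g') + f' * g"
    by (simp add: fun_eq_iff f'_def g'_def fun_simps algebra_simps)
  hence "e_coeff (f * g) (v + w)
      = e_coeff (sc (e_coeff f v * e_coeff g w) (e v * e w) + sc (e_coeff f v) (e v * g')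
          + f' * g) (v + w)" by simp
  also have "\<dots> = e_coeff f v * e_coeff g w"
    using 1 sp[OF 11] sp[OF 2] sp[OF 3] low[OF 2] low[OF 3]
    by (simp add: e_coeff_linear vs.span_add vs.span_scale)
  finally show ?thesis .
qed


section \<open>Regular functions on \<open>U1 q\<close>, \<open>U2 q\<close> and
  \<open>U12 q\<close> in terms of monomials\<close>

lemma mon_outside: "P \<notin> U12 q \<Longrightarrow> mon a b P = 0"
  by (simp add: mon_def)

lemma subset_span_mult:
  assumes "f \<in> vs.span S" "\<And>a. a \<in> S \<Longrightarrow> mon c d * a \<in> vs.span R"
  shows "mon c d * f \<in> vs.span R"
  by (rule span_mult[of _ "{mon c d}" _ S]) (use assms in \<open>auto simp: vs.span_base\<close>)

text \<open>The restrictions to \<open>U12 q\<close> of polynomials in x and y, thus of the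
  functions regular on \<open>U1 q\<close>.\<close>

definition poly_part :: "'k rfun set" where "poly_part = vs.span (e ` {m. x_exp m \<ge> 0})"

lemma mon_poly_part: "a \<ge> 0 \<Longrightarrow> mon a b \<in> poly_part"
  unfolding poly_part_def using mon_expand_span[of a b]
    by (rule subsetD[OF vs.span_mono, rotated]) auto

lemma mon_mult_poly_part: "f \<in> poly_part \<Longrightarrow> a \<ge> 0 \<Longrightarrow> mon a b * f \<in> poly_part"
  unfolding poly_part_def
proof (erule subset_span_mult)
  fix f assume a: "a \<ge> 0" and "f \<in> e ` {m. x_exp m \<ge> 0}"
  then obtain k where k: "f = e k" "x_exp k \<ge> 0" by auto
  show "mon a b * f \<in> vs.span (e ` {m. x_exp m \<ge> 0})"
    unfolding k(1) e_def mon_mult using mon_poly_part[of "a + x_exp k" "b + y_exp k"] a k(2)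
    by (simp add: poly_part_def e_def[abs_def])
qed

lemma ev_poly_part: "(\<lambda>P. if P \<in> U12 q then ev G P else 0) \<in> poly_part"
proof (induction G)
  case 0
  have "(\<lambda>P. if P \<in> U12 q then ev 0 P else 0) = (0 :: 'k rfun)" by (simp add: fun_eq_iff fun_simps)
  thus ?case by (simp only: poly_part_def vs.span_zero)
next
  case (pCons r G)
  have r: "(\<lambda>P. if P \<in> U12 q then poly r (xc P) else 0) \<in> poly_part"
  proof (induction r)
    case 0
    have "(\<lambda>P. if P \<in> U12 q then poly 0 (xc P) else 0) = (0 :: 'k rfun)"
      by (simp add: fun_eq_iff fun_simps)
    thus ?case by (simp only: poly_part_def vs.span_zero)
  next
    case (pCons c r)
    have "(\<lambda>P. if P \<in> U12 q then poly (pCons c r) (xc P) else 0)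
        = sc c (mon 0 0) + mon 1 0 * (\<lambda>P. if P \<in> U12 q then poly r (xc P) else 0)"
      by (simp add: fun_eq_iff fun_simps mon_def)
    moreover have "\<dots> \<in> poly_part"
      using mon_mult_poly_part[OF pCons.IH, of 1 0] mon_poly_part[of 0 0]
      unfolding poly_part_def by (intro vs.span_add vs.span_scale) auto
    ultimately show ?case by (simp only:)
  qed
  have "(\<lambda>P. if P \<in> U12 q then ev (pCons r G) P else 0)
      = (\<lambda>P. if P \<in> U12 q then poly r (xc P) else 0)
          + mon 0 1 * (\<lambda>P. if P \<in> U12 q then ev G P else 0)"
    by (simp add: fun_eq_iff fun_simps mon_def)
  moreover have "\<dots> \<in> poly_part"
    using mon_mult_poly_part[OF pCons.IH, of 0 1] r
    unfolding poly_part_def by (intro vs.span_add) auto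
  ultimately show ?case by (simp only:)
qed

lemma A_eq_span: "A = vs.span (range e)"
proof
  show "vs.span (range e) \<subseteq> A"
    by (intro vs.span_minimal subspace_regular) (auto simp: e_def mon_regular)
  show "A \<subseteq> vs.span (range e)"
  proof
    fix f assume f: "f \<in> A"
    have "1 \<in> - {0 :: 'k}" by simp
    hence "- {0 :: 'k} \<noteq> {}" by blast
    then obtain m G where G: "\<And>P. P \<in> over (- {0}) \<Longrightarrow> xc P ^ m * f P = ev G P"
      using regular_over_polynomial[OF f[unfolded U12_eq]] by blast
    have "f = mon (- int m) 0 * (\<lambda>P. if P \<in> U12 q then ev G P else 0)"
    proof
      fix P
      show "f P = (mon (- int m) 0 * (\<lambda>P. if P \<in> U12 q then ev G P else 0)) P"
      proof (cases "P \<in> U12 q")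
        case True
        thus ?thesis using G[of P] U12_coords(1)[OF True]
          by (simp add: U12_eq[symmetric] mon_def fun_simps power_int_minus field_simps)
      qed (use f regular_outside in \<open>simp add: fun_simps\<close>)
    qed
    moreover have "mon (- int m) 0 * (\<lambda>P. if P \<in> U12 q then ev G P else 0) \<in> vs.span (range e)"
    proof (rule subset_span_mult[OF ev_poly_part[unfolded poly_part_def]])
      fix a assume "a \<in> e ` {m. x_exp m \<ge> 0}"
      then obtain k where "a = e k" by auto
      thus "mon (- int m) 0 * a \<in> vs.span (range e)"
        using span_eD[OF mon_expand_span] by (simp only: e_def mon_mult)
    qed
    ultimately show "f \<in> vs.span (range e)" by (simp only:)
  qed
qed

lemma res12_A: "f \<in> A \<Longrightarrow> res12 q f = f"
  unfolding res12_def by (rule ext) (metis regular_outside)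

text \<open>Over the whole x-line the set V contains 0, so \<open>regular_over_polynomial\<close>
  allows no power of x as denominator.\<close>

lemma regular_U1_poly_part:
  assumes "f \<in> regular (U1 q)"
  shows "res12 q f \<in> poly_part"
proof -
  obtain G where G: "\<And>P. P \<in> over UNIV \<Longrightarrow> f P = ev G P"
    using regular_over_polynomial[of f UNIV] assms unfolding U1_eq
    by (metis (no_types, lifting) UNIV_I empty_iff mult_1 power_0 subset_UNIV)
  have "P \<in> over UNIV" if "P \<in> U12 q" for P :: "'k pt" using that unfolding U1_eq
    by (simp add: Int_iff)
  hence "res12 q f = (\<lambda>P. if P \<in> U12 q then ev G P else 0)"
    using G by (auto simp: res12_def)
  thus ?thesis using ev_poly_part by (simp only:)
qed

lemma regular_res12:
  assumes "f \<in> regular (U1 q) \<or> f \<in> regular (U2 q)"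
  shows "res12 q f \<in> A"
  using assms regular_restrict[of f _ "U12 q"] unfolding res12_def by (auto simp: Int_iff)

text \<open>Divided by Z^m, the monomial X^i Y^j Z^k of degree m becomes x^i y^j, of pole order m (q
  + 1) - i - (q + 1) k. Only Y^m attains the maximum, so the coefficient there is the value of the
  form at [0 : 1 : 0].\<close>

lemma forms_at_infinity:
  assumes "h \<in> forms m"
  shows "(\<lambda>P. if P \<in> U12 q then h P / snd (snd P) ^ m else 0) \<in> deg_le (int (m * (q + 1))) \<and>
    e_coeff (\<lambda>P. if P \<in> U12 q then h P / snd (snd P) ^ m else 0) (int (m * (q + 1))) = h (0, 1, 0)"
proof -
  define W where "W = int (m * (q + 1))"
  define dh where "dh h = (\<lambda>P. if P \<in> U12 q then h P / snd (snd P) ^ m else 0)" for h :: "'k rfun"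
  have sp: "f \<in> vs.span (range e)" if "f \<in> deg_le W" for f
    using that span_eD unfolding deg_le_def by blast
  have dh_add: "dh (f + g) = dh f + dh g" and dh_sc: "dh (sc c f) = sc c (dh f)"
    and dh_zero: "dh 0 = 0" for f g c
    by (simp_all add: dh_def fun_eq_iff fun_simps add_divide_distrib)
  let ?S = "{h. dh h \<in> deg_le W \<and> e_coeff (dh h) W = h (0, 1, 0)}"
  have "vs.subspace ?S"
  proof (rule vs.subspaceI)
    show "0 \<in> ?S" by (simp add: dh_zero deg_le_def vs.span_zero fun_simps)
    show "x + y \<in> ?S" if "x \<in> ?S" "y \<in> ?S" for x y
      using that sp
        by (simp add: dh_add e_coeff_linear fun_simps) (simp add: deg_le_def vs.span_add)
    show "sc c x \<in> ?S" if "x \<in> ?S" for c x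
      using that sp[of "dh x"] e_coeff_linear(3)[of "dh x" "dh x" c W]
      by (simp add: dh_sc fun_simps) (simp add: deg_le_def vs.span_scale)
  qed
  moreover have "pmon i j k \<in> ?S" if "i + j + k = m" for i j k
  proof -
    have dh: "dh (pmon i j k) = mon (int i) j"
    proof
      fix P
      show "dh (pmon i j k) P = mon (int i) j P"
        using U12_coords(5)[of P] that[symmetric]
        by (cases P) (auto simp: dh_def mon_def pmon_def xc_def yc_def power_divide power_add)
    qed
    have wW: "int q * int i + int (q + 1) * int j + int i + int (q + 1) * int k = W"
      by (simp add: W_def that[symmetric] algebra_simps)
    have le: "int q * int i + int (q + 1) * int j \<le> W" unfolding wW[symmetric] by simp
    have "e_coeff (mon (int i) j) W = pmon i j k (0, 1, 0)"
    proof (cases "i = 0 \<and> k = 0")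
      case True
      thus ?thesis using e_coeff_mon_weight[of "int i" j] wW by (simp add: pmon_def)
    next
      case False
      hence "0 < int i + int (q + 1) * int k" using q_gt_1
        by (auto simp: add_nonneg_pos add_pos_nonneg)
      hence "int q * int i + int (q + 1) * int j < W" unfolding wW[symmetric] by simp
      hence "e_coeff (mon (int i) j) W = 0" by (intro e_coeff_outside[OF mon_expand_span]) auto
      thus ?thesis using False by (auto simp: pmon_def zero_power)
    qed
    thus ?thesis using mon_deg_le[OF le] by (simp add: dh)
  qed
  ultimately have "forms m \<subseteq> ?S"
    unfolding forms_def by (intro vs.span_minimal) auto
  with assms show ?thesis unfolding dh_def W_def by blast
qed

lemma infinity_U2: "(0, 1, 0) \<in> (U2 q :: 'k pt set)"
  using q_gt_1 by (auto simp: U2_def hermitian_curve_def)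

text \<open>If the leading order w were positive, multiplication by a denominator that is nonzero at
  infinity would give a nonzero coefficient at w + W, beyond the pole order W allowed for the
  numerator.\<close>

lemma regular_U2_deg_le:
  assumes f: "f \<in> regular (U2 q)"
  shows "res12 q f \<in> deg_le 0"
proof (rule ccontr)
  define \<phi> where "\<phi> = res12 q f"
  assume "res12 q f \<notin> deg_le 0"
  have \<phi>: "\<phi> \<in> vs.span (range e)" using regular_res12[of f] f by (simp add: \<phi>_def A_eq_span)
  hence "\<exists>m. m \<notin> {..0} \<and> e_coeff \<phi> m \<noteq> 0"
    using span_eI[of \<phi> "{..0}"] \<open>res12 q f \<notin> deg_le 0\<close> by (auto simp: \<phi>_def deg_le_def)
  define S where "S = {m. e_coeff \<phi> m \<noteq> 0}"
  have fin: "finite S" unfolding S_def by (rule e_coeff_expand(1)[OF \<phi>])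
  obtain m0 where m0: "m0 > 0" "m0 \<in> S"
    using \<open>\<exists>m. m \<notin> {..0} \<and> e_coeff \<phi> m \<noteq> 0\<close> unfolding S_def
      by (metis atMost_iff mem_Collect_eq not_le)
  define w where "w = Max S"
  have w: "w \<in> S" "w > 0"
    using m0 Max_in[OF fin] Max_ge[OF fin m0(2)] unfolding w_def by (blast, linarith)
  have "\<phi> \<in> deg_le w" unfolding deg_le_def
    by (rule span_eI[OF \<phi>]) (use Max_ge[OF fin] in \<open>auto simp: w_def S_def\<close>)
  obtain m h g where hg: "h \<in> forms m" "g \<in> forms m" "h (0, 1, 0) \<noteq> 0"
    "\<And>Q. Q \<in> U2 q \<Longrightarrow> f Q * h Q = g Q" using regularE[OF f infinity_U2] by metis
  define dh where "dh h = (\<lambda>P. if P \<in> U12 q then h P / snd (snd P) ^ m else 0)" for h :: "'k rfun"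
  define W where "W = int (m * (q + 1))"
  note 1 = forms_at_infinity[OF hg(1), folded dh_def W_def]
  note 2 = forms_at_infinity[OF hg(2), folded dh_def W_def]
  have "\<phi> * dh h = dh g"
  proof
    fix P show "(\<phi> * dh h) P = dh g P"
      using hg(4)[of P] by (simp add: \<phi>_def dh_def res12_def fun_simps Int_iff)
  qed
  hence "e_coeff (dh g) (w + W) = e_coeff \<phi> w * h (0, 1, 0)"
    using e_coeff_mult[OF \<open>\<phi> \<in> deg_le w\<close> conjunct1[OF 1]] 1 by simp
  moreover have "e_coeff (dh g) (w + W) = 0"
    using conjunct1[OF 2] w(2) unfolding deg_le_def by (intro e_coeff_outside) auto
  ultimately show False using w(1) hg(3) by (simp add: S_def)
qed

lemma mon_from_U1:
  assumes "a \<ge> 0"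
  obtains \<kappa> where "\<kappa> \<in> regular (U1 q)" "res12 q \<kappa> = mon a b"
proof -
  define \<kappa> where "\<kappa> = (\<lambda>P :: 'k pt. if P \<in> U1 q then xc P powi a * yc P ^ b else 0)"
  obtain k where k: "a = int k" using assms by (metis nonneg_int_cases)
  have "\<kappa> \<in> regular (U1 q)"
  proof (rule regularI)
    fix P :: "'k pt" assume "P \<in> U1 q"
    have "pmon 0 0 (k + b) P \<noteq> 0" using \<open>P \<in> U1 q\<close>
      by (auto simp: U1_eq over_def pmon_def split: prod.splits)
    moreover have "\<kappa> Q * pmon 0 0 (k + b) Q = pmon k b 0 Q" if "Q \<in> U1 q" for Q
    proof -
      obtain X Y Z where Q: "Q = (X, Y, Z)" by (cases Q)
      have "Z \<noteq> 0" using that Q by (auto simp: U1_eq over_def)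
      thus ?thesis using that by (simp add: \<kappa>_def Q pmon_def k xc_def yc_def power_divide power_add)
    qed
    moreover have "pmon 0 0 (k + b) \<in> forms (k + b)" "pmon k b 0 \<in> forms (k + b)"
      by (simp_all add: pmon_in_forms)
    ultimately show "\<exists>m. \<exists>h\<in>forms m. \<exists>g\<in>forms m. h P \<noteq> 0 \<and> (\<forall>Q\<in>U1 q. \<kappa> Q * h Q = g Q)" by blast
  qed (simp add: \<kappa>_def)
  moreover have "res12 q \<kappa> = mon a b"
    by (auto simp: res12_def mon_def \<kappa>_def fun_eq_iff Int_iff)
  ultimately show ?thesis by (rule that)
qed

text \<open>
  At infinity use \<open>u = x / y\<close> and \<open>z = 1 / y\<close>, where \<open>z + z ^ q = u ^ (q + 1)\<close>; hence
  \<open>1 / u ^ (q + 1) = 1 / (z * (1 + z ^ (q - 1)))\<close> and \<open>1 + z ^ (q - 1)\<close> does not vanish on \<open>U2\<close>.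
\<close>

lemma mon_from_U2:
  assumes le: "(q + 1) * b \<le> q * d"
  obtains \<kappa> where "\<kappa> \<in> regular (U2 q)" "res12 q \<kappa> = mon (- int d) b"
proof -
  have "b \<le> d"
  proof (rule ccontr)
    assume "\<not> b \<le> d"
    hence "q * d \<le> q * b" by (intro mult_left_mono) auto
    with le have "b = 0" unfolding distrib_right by linarith
    with \<open>\<not> b \<le> d\<close> show False by simp
  qed
  \<comment> \<open>r is d / (q + 1) rounded up. With u and z as above, x^-d y^b = u^-d z^(d-b) =
    u^s z^t / (1 + z^(q-1))^r, and the hypothesis (no pole at infinity) makes t nonnegative.\<close>
  define r where "r = (d + q) div (q + 1)"
  define s where "s = (q + 1) * r - d"
  have "d + q < (q + 1) * r + (q + 1)"
    unfolding r_def using dividend_less_times_div[of "q + 1" "d + q"] by (simp add: algebra_simps)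
  hence s: "s + d = (q + 1) * r" by (simp add: s_def)
  have "(q + 1) * r \<le> d + q" unfolding r_def by (rule times_div_less_eq_dividend)
  also have "\<dots> < (q + 1) * (d - b + 1)"
  proof -
    have "(q + 1) * (d - b + 1) + (q + 1) * b = (q + 1) * d + (q + 1)"
      using \<open>b \<le> d\<close> by (simp only: distrib_left[symmetric]) simp
    thus ?thesis using le by simp
  qed
  finally have "r \<le> d - b" using mult_less_cancel1[of "q + 1" r "d - b + 1"] by simp
  define t where "t = d - b - r"
  have t: "t + b + r = d" using \<open>r \<le> d - b\<close> \<open>b \<le> d\<close> by (auto simp: t_def)
  have U2: "Y \<noteq> 0" "Y ^ (q - 1) + Z ^ (q - 1) \<noteq> 0" if "(X, Y, Z) \<in> U2 q" for X Y Z :: 'k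
  proof -
    have curve: "Y ^ q * Z + Y * Z ^ q = X ^ (q + 1)" "(X, Y, Z) \<noteq> (0, 0, 0)"
      using that by (auto simp: U2_def hermitian_curve_def)
    have boundary: "\<not> (X = 0 \<and> Z \<noteq> 0)"
    proof
      assume XZ: "X = 0 \<and> Z \<noteq> 0"
      hence "(Y ^ q * Z + Y * Z ^ q) / Z ^ (q + 1) = 0" using curve(1) by (simp add: zero_power)
      hence "(Y / Z) ^ q + Y / Z = 0" using XZ by (simp add: power_divide add_divide_distrib)
      hence "(X, Y, Z) \<in> {(0, c * y, c) | c y. c \<noteq> 0 \<and> y ^ q + y = 0}"
        using XZ by (auto intro!: exI[of _ Z] exI[of _ "Y / Z"])
      thus False using that by (simp add: U2_def)
    qed
    show Y: "Y \<noteq> 0"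
    proof
      assume "Y = 0"
      hence "X = 0" using curve(1) q_gt_1 by (simp add: zero_power)
      with boundary curve(2) \<open>Y = 0\<close> show False by auto
    qed
    show "Y ^ (q - 1) + Z ^ (q - 1) \<noteq> 0"
    proof
      assume 0: "Y ^ (q - 1) + Z ^ (q - 1) = 0"
      have "Y ^ q * Z + Y * Z ^ q = Y * Z * (Y ^ (q - 1) + Z ^ (q - 1))"
        using q_gt_1 by (cases q) (auto simp: algebra_simps)
      hence "X = 0" using curve(1) 0 by auto
      moreover have "Z \<noteq> 0" using 0 Y q_gt_1 by (auto simp: zero_power)
      ultimately show False using boundary by simp
    qed
  qed
  define D where "D = (\<lambda>P :: 'k pt. fst (snd P) ^ (q - 1) + snd (snd P) ^ (q - 1))"
  define \<kappa> where "\<kappa> = (\<lambda>P :: 'k pt. if P \<in> U2 q then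
      fst P ^ s * snd (snd P) ^ t * fst (snd P) ^ (r * (q - 1)) /
          (D P ^ r * fst (snd P) ^ (s + t)) else 0)"
  have D: "D = pmon 0 (q - 1) 0 + pmon 0 0 (q - 1)"
    by (auto simp: D_def pmon_def fun_eq_iff fun_simps)
  have "\<kappa> \<in> regular (U2 q)"
  proof (rule regularI)
    fix P :: "'k pt" assume P: "P \<in> U2 q"
    define h where "h = D ^ r * pmon 0 (s + t) 0"
    have h: "h (X, Y, Z) = D (X, Y, Z) ^ r * Y ^ (s + t)" for X Y Z
      by (simp add: h_def fun_simps pmon_def)
    have "h P \<noteq> 0" using P U2 by (cases P) (auto simp: h D_def)
    moreover have "\<kappa> Q * h Q = pmon s (r * (q - 1)) t Q" if "Q \<in> U2 q" for Q
    proof -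
      obtain X Y Z where Q: "Q = (X, Y, Z)" by (cases Q)
      have "Y \<noteq> 0" "D Q \<noteq> 0" using U2[of X Y Z] that by (auto simp: Q D_def)
      thus ?thesis using that by (simp add: \<kappa>_def Q h pmon_def mult_ac)
    qed
    moreover have "D \<in> forms (q - 1)" unfolding D by (intro forms_add pmon_in_forms) auto
    hence "h \<in> forms (r * (q - 1) + (s + t))" unfolding h_def
      by (intro forms_mult forms_power pmon_in_forms) auto
    moreover have "pmon s (r * (q - 1)) t \<in> forms (r * (q - 1) + (s + t))"
      by (simp add: pmon_in_forms)
    ultimately show "\<exists>m. \<exists>h\<in>forms m. \<exists>g\<in>forms m. h P \<noteq> 0 \<and> (\<forall>Q\<in>U2 q. \<kappa> Q * h Q = g Q)" by blast
  qed (simp add: \<kappa>_def)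
  moreover have "res12 q \<kappa> = mon (- int d) b"
  proof
    fix P :: "'k pt"
    show "res12 q \<kappa> P = mon (- int d) b P"
    proof (cases "P \<in> U12 q")
      case True
      obtain X Y Z where P: "P = (X, Y, Z)" by (cases P)
      note c = U12_coords[OF True]
      define x y where "x = xc P" and "y = yc P"
      have XZ: "X = x * Z" "Y = y * Z" "Z \<noteq> 0" using c(4,5)
        by (auto simp: P xc_def yc_def x_def y_def)
      have xy: "x \<noteq> 0" "y \<noteq> 0" "y ^ q = x ^ (q + 1) - y" using c by (auto simp: x_def y_def)
      have "y * (y ^ (q - 1) + 1) = x ^ (q + 1)"
        using xy(3) q_gt_1 by (cases q) (auto simp: algebra_simps)
      hence D1: "y ^ (q - 1) + 1 = x ^ (q + 1) / y" using xy(2) by (simp add: field_simps)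
      have "D P = (y ^ (q - 1) + 1) * Z ^ (q - 1)"
        by (simp add: D_def P XZ power_mult_distrib algebra_simps)
      define w where "w = x ^ (q + 1) / y"
      hence DP: "D P = w * Z ^ (q - 1)" using \<open>D P = _\<close> by (simp only: D1)
      have "P \<in> U2 q" using True by (simp add: Int_iff)
      hence "\<kappa> P = (x * Z) ^ s * Z ^ t * (y * Z) ^ (r * (q - 1)) /
          ((w * Z ^ (q - 1)) ^ r * (y * Z) ^ (s + t))"
        unfolding \<kappa>_def DP[symmetric] by (simp add: P XZ)
      also have "\<dots> = x ^ s * y ^ (r * (q - 1)) / (w ^ r * y ^ (s + t))"
      proof -
        have "(Z ^ (q - 1)) ^ r = Z ^ (r * (q - 1))" by (simp add: mult.commute flip: power_mult)
        thus ?thesis using XZ(3) by (simp add: power_mult_distrib power_add)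
      qed
      also have "\<dots> = x ^ s * y ^ (r * q) / (x ^ (s + d) * y ^ (s + t))"
      proof -
        have "r * q = r * (q - 1) + r" using q_gt_1 by (cases q) auto
        hence "y ^ (r * q) = y ^ (r * (q - 1)) * y ^ r" by (simp only: power_add)
        moreover have "w ^ r = x ^ (s + d) / y ^ r" unfolding s w_def power_divide power_mult ..
        ultimately show ?thesis by simp
      qed
      also have "r * q = b + (s + t)" using s t by (simp add: algebra_simps)
      also have "x ^ s * y ^ (b + (s + t)) / (x ^ (s + d) * y ^ (s + t)) = y ^ b / x ^ d"
        using xy by (simp add: power_add)
      finally show ?thesis using True
        by (simp add: res12_def mon_def x_def y_def power_int_minus divide_inverse)
    qed (simp add: res12_def mon_outside)
  qed
  ultimately show ?thesis by (rule that)
qed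

end

lemma sc_mult_left: "sc c f * g = sc c (f * g)" and sc_mult_right: "f * sc c g = sc c (f * g)"
  by (simp_all add: fun_eq_iff fun_simps)

lemmas sc_alg = sc_mult_left sc_mult_right vs.scale_right_distrib vs.scale_left_distrib
  vs.scale_right_diff_distrib vs.scale_left_diff_distrib

context hermitian begin

section \<open>The derivation \<open>d/dx\<close> and differentials\<close>

lemma A_span_mon: "A = vs.span {mon a b | a b. True}"
proof
  show "A \<subseteq> vs.span {mon a b | a b. True}"
    unfolding A_eq_span by (rule vs.span_mono) (auto simp: e_def)
  show "vs.span {mon a b | a b. True} \<subseteq> A"
    by (intro vs.span_minimal subspace_regular) (auto simp: mon_regular)
qed

lemma span_induct_mem:
  assumes "f \<in> vs.span S" "S \<noteq> {}" "\<And>a. a \<in> S \<Longrightarrow> Q a"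
    and "\<And>f g. f \<in> vs.span S \<Longrightarrow> g \<in> vs.span S \<Longrightarrow> Q f \<Longrightarrow> Q g \<Longrightarrow> Q (f + g)"
    and "\<And>c f. f \<in> vs.span S \<Longrightarrow> Q f \<Longrightarrow> Q (sc c f)"
  shows "Q f"
proof -
  obtain a where "a \<in> S" using assms(2) by auto
  hence zero: "Q 0" using assms(3)[of a] assms(5)[of a 0] by (simp add: vs.span_base)
  have "vs.subspace {f \<in> vs.span S. Q f}"
    by (rule vs.subspaceI) (auto simp: vs.span_zero vs.span_add vs.span_scale zero assms(4,5))
  hence "vs.span S \<subseteq> {f \<in> vs.span S. Q f}"
    using assms(3) by (intro vs.span_minimal) (auto simp: vs.span_base)
  with assms(1) show ?thesis by blast
qed

lemma A_induct [consumes 1, case_names mon add scale]: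
  assumes "f \<in> A" "\<And>a b. Q (mon a b)"
    and "\<And>f g. f \<in> A \<Longrightarrow> g \<in> A \<Longrightarrow> Q f \<Longrightarrow> Q g \<Longrightarrow> Q (f + g)"
    and "\<And>c f. f \<in> A \<Longrightarrow> Q f \<Longrightarrow> Q (sc c f)"
  shows "Q f"
proof (rule span_induct_mem)
  show "f \<in> vs.span {mon a b | a b. True}" using assms(1) by (simp only: A_span_mon)
qed (use assms(2-) in \<open>simp_all only: A_span_mon[symmetric], blast+\<close>)

lemma A_unit: "f \<in> A \<Longrightarrow> mon 0 0 * f = f"
  using regular_outside[of f "U12 q"] by (auto simp: fun_eq_iff fun_simps mon_def)

lemma A_power_mult: "f \<in> A \<Longrightarrow> g \<in> A \<Longrightarrow> f ^ k * g \<in> A"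
  by (induction k) (auto simp: mult.assoc regular_mult)

text \<open>The derivative of x^a y^b with respect to x. Differentiating the curve equation in
  characteristic p gives dy/dx = x^q.\<close>

definition dmon :: "int \<Rightarrow> nat \<Rightarrow> 'k rfun" where
  "dmon a b = sc (of_int a) (mon (a - 1) b) + sc (of_nat b) (mon (a + int q) (b - 1))"

definition D0 :: "'k rfun \<Rightarrow> 'k rfun" where
  "D0 = vp.construct (range e) (\<lambda>v. dmon (x_exp (inv e v)) (y_exp (inv e v)))"

lemma linear_D0: "Vector_Spaces.linear sc sc D0"
  unfolding D0_def by (rule vp.linear_construct[OF independent_e])

lemma D0_add: "D0 (f + g) = D0 f + D0 g" and D0_sc: "D0 (sc c f) = sc c (D0 f)"
  and D0_diff: "D0 (f - g) = D0 f - D0 g" and D0_zero [simp]: "D0 0 = 0"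
  using linear_D0 by (simp_all add: vp.linear_add vp.linear_scale vp.linear_diff vp.linear_0)

lemma D0_e: "D0 (e m) = dmon (x_exp m) (y_exp m)"
  unfolding D0_def using vp.construct_basis[OF independent_e, of "e m"] inj_e by simp

text \<open>The formula respects the relation y^q = x^(q+1) - y. Hence \<open>D0\<close>, prescribed
  only for y-exponents below q, obeys it for all monomials.\<close>

lemma dmon_eq: "dmon a (b + q) = dmon (a + int q + 1) b - dmon a (b + 1)"
proof -
  have "sc (of_nat b) (mon (a + int q) (b + q - 1))
      = sc (of_nat b) (mon (a + int q + int q + 1) (b - 1)) - sc (of_nat b) (mon (a + int q) b)"
  proof (cases b)
    case (Suc c)
    have "mon (a + int q) (c + q) = mon (a + int q + int q + 1) c - mon (a + int q) (c + 1)"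
      by (rule mon_add_q)
    thus ?thesis by (simp add: Suc vs.scale_right_diff_distrib)
  qed (simp add: fun_eq_iff fun_simps)
  moreover have "mon (a - 1) (b + q) = mon (a + int q) b - mon (a - 1) (b + 1)"
    using mon_add_q[of "a - 1" b] by (simp add: algebra_simps)
  moreover have "dmon a (b + q) = sc (of_int a) (mon (a - 1) (b + q))
      + sc (of_nat b) (mon (a + int q) (b + q - 1))"
    by (simp add: dmon_def)
  moreover have "dmon (a + int q + 1) b
      = sc (of_int a + 1) (mon (a + int q) b) + sc (of_nat b) (mon (a + int q + int q + 1) (b - 1))"
    by (simp add: dmon_def add_ac)
  moreover have "dmon a (b + 1) = sc (of_int a) (mon (a - 1) (b + 1))
      + sc (of_nat b + 1) (mon (a + int q) b)"
    by (simp add: dmon_def add_ac)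
  ultimately show ?thesis by (simp only: sc_alg) simp
qed

lemma D0_mon: "D0 (mon a b) = dmon a b"
proof (induction b arbitrary: a rule: less_induct)
  case (less b)
  show ?case
  proof (cases "b < q")
    case True
    define m where "m = int q * a + int (q + 1) * int b"
    have "e m = mon a b" unfolding m_def using True by (rule e_weight)
    moreover have "x_exp m = a" "y_exp m = b" using True
      by (simp_all only: m_def x_exp_weight y_exp_weight) simp_all
    ultimately show ?thesis using D0_e[of m] by simp
  next
    case False
    define c where "c = b - q"
    have b: "b = c + q" using False by (simp add: c_def)
    show ?thesis unfolding b mon_add_q dmon_eq D0_diff
      using less.IH[of c] less.IH[of "c + 1"] q_gt_1
      by (simp add: b)
  qed
qed

lemma dmon_mult: "dmon (a + a') (b + b') = mon a b * dmon a' b' + mon a' b' * dmon a b"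
proof -
  have 1: "sc (of_nat b') (mon (a + a' + int q) (b + b' - 1))
      = sc (of_nat b') (mon a b * mon (a' + int q) (b' - 1))"
    by (cases b') (simp_all add: mon_mult add.assoc fun_eq_iff fun_simps)
  have 2: "sc (of_nat b) (mon (a + a' + int q) (b + b' - 1))
      = sc (of_nat b) (mon a' b' * mon (a + int q) (b - 1))"
    by (cases b) (simp_all add: mon_mult add_ac fun_eq_iff fun_simps)
  have 3: "mon a b * mon (a' - 1) b' = mon (a + a' - 1) (b + b')"
      "mon a' b' * mon (a - 1) b = mon (a + a' - 1) (b + b')"
    by (simp_all add: mon_mult algebra_simps)
  have "dmon (a + a') (b + b') = sc (of_int a') (mon a b * mon (a' - 1) b')
      + sc (of_int a) (mon a' b' * mon (a - 1) b)
     + sc (of_nat b') (mon (a + a' + int q) (b + b' - 1))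
         + sc (of_nat b) (mon (a + a' + int q) (b + b' - 1))"
    unfolding dmon_def 3 by (simp add: fun_eq_iff fun_simps algebra_simps)
  thus ?thesis unfolding 1 2 by (simp add: dmon_def fun_eq_iff fun_simps algebra_simps)
qed

lemma D0_in_A: "f \<in> A \<Longrightarrow> D0 f \<in> A"
  by (induction rule: A_induct)
    (auto simp: D0_mon dmon_def D0_add D0_sc intro!: regular_add regular_sc mon_regular)

lemma D0_mult: "f \<in> A \<Longrightarrow> g \<in> A \<Longrightarrow> D0 (f * g) = f * D0 g + g * D0 f"
proof (induction arbitrary: g rule: A_induct)
  case (mon a b)
  from mon(1) show ?case
  proof (induction rule: A_induct)
    case (mon a' b')
    show ?case by (simp only: mon_mult D0_mon dmon_mult)
  next
    case (add f g)
    thus ?case by (simp add: D0_add algebra_simps)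
  next
    case (scale c f)
    thus ?case by (simp add: D0_sc sc_alg)
  qed
next
  case (add f g h)
  show ?case
    by (simp only: D0_add distrib_right distrib_left add.IH(1)[OF add.prems]
        add.IH(2)[OF add.prems] add_ac)
next
  case (scale c f g)
  thus ?case by (simp add: D0_sc sc_alg)
qed

lemma D0_derivation: "D0 \<in> derivations q"
  by (simp add: derivations_def D0_in_A D0_add D0_sc D0_mult)

lemma fx_eq: "fx q = mon 1 0" and fy_eq: "fy q = mon 0 1"
  by (auto simp: fx_def fy_def res12_def mon_def xc_def yc_def fun_eq_iff)

section \<open>All derivations are multiples of d/dx; differentials as multiples of dx\<close>

lemma derivation_power:
  assumes D: "D \<in> derivations q" and f: "f \<in> A"
  shows "D (f ^ Suc k) = sc (of_nat (Suc k)) (f ^ k * D f)"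
proof (induction k)
  case 0
  show ?case by simp
next
  case (Suc k)
  have "D (f ^ Suc (Suc k)) = f * D (f ^ Suc k) + f ^ Suc k * D f"
    using D f regular_power[OF f, of "Suc k"] by (simp add: derivations_def)
  also have "\<dots> = sc (of_nat (Suc k)) (f ^ Suc k * D f) + sc 1 (f ^ Suc k * D f)"
    unfolding Suc by (simp add: sc_mult_right mult.assoc del: of_nat_Suc)
  also have "\<dots> = sc (of_nat (Suc k) + 1) (f ^ Suc k * D f)" by (simp only: vs.scale_left_distrib)
  finally show ?case by (simp add: add.commute)
qed

lemma derivation_p_power:
  assumes D: "D \<in> derivations q" and f: "f \<in> A"
  shows "D (f ^ p) = 0"
proof -
  obtain k where k: "p = Suc k" using p_gt_1 by (cases p) auto
  have "(of_nat (Suc k) :: 'k) = 0" using of_nat_p k by simp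
  thus ?thesis unfolding k using derivation_power[OF assms, of k] by (simp only: vs.scale_zero_left)
qed

text \<open>A derivation is determined by its value at x: the value at 1/x follows from the product
  rule, and the value at y from y = x^(q+1) - y^q, because p-th powers are killed.\<close>

lemma derivation_eq:
  assumes D: "D \<in> derivations q" and f: "f \<in> A"
  shows "D f = D0 f * D (fx q)"
proof -
  define E where "E = {f \<in> A. D f = D0 f * D (fx q)}"
  have Dm: "D (f * g) = f * D g + g * D f" and Dadd: "D (f + g) = D f + D g" and
      Dsc: "D (sc c f) = sc c (D f)"
    and DA: "D f \<in> A" if "f \<in> A" "g \<in> A" for f g c
    using D that by (simp_all add: derivations_def)
  have E_mult: "f * g \<in> E" if "f \<in> E" "g \<in> E" for f g
    using that by (auto simp: E_def Dm D0_mult regular_mult algebra_simps)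
  have D1: "D (mon 0 0) = 0"
  proof -
    have "D (mon 0 0 * mon 0 0) = mon 0 0 * D (mon 0 0) + mon 0 0 * D (mon 0 0)"
      by (rule Dm) (rule mon_regular)+
    thus ?thesis using DA[OF mon_regular mon_regular, of 0 0] by (simp add: mon_mult A_unit)
  qed
  have E1: "mon 0 0 \<in> E" by (simp add: E_def mon_regular D1 D0_mon dmon_def)
  have Ex: "mon 1 0 \<in> E"
    using A_unit[OF DA[OF mon_regular mon_regular], of 1 0]
      by (simp add: E_def mon_regular D0_mon dmon_def fx_eq)
  have Exi: "mon (- 1) 0 \<in> E"
  proof -
    have "mon (- 1) 0 * (mon 1 0 * D (mon (- 1) 0) + mon (- 1) 0 * D (mon 1 0))
        = mon (- 1) 0 * D (mon 1 0 * mon (- 1) 0)"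
      by (simp add: Dm mon_regular)
    also have "\<dots> = 0" by (simp add: mon_mult D1)
    finally have "mon 0 0 * D (mon (- 1) 0) + mon (- 2) 0 * D (mon 1 0) = 0"
      by (simp add: distrib_left mult.assoc[symmetric] mon_mult)
    hence "D (mon (- 1) 0) = - (mon (- 2) 0 * D (mon 1 0))"
      using A_unit[OF DA[OF mon_regular mon_regular], of "- 1" 0] by (simp add: eq_neg_iff_add_eq_0)
    thus ?thesis by (simp add: E_def mon_regular D0_mon dmon_def fx_eq sc_alg)
  qed
  have Ey: "mon 0 1 \<in> E"
  proof -
    have "q = p ^ (n - 1) * p" using n_pos q_def by (cases n) auto
    moreover have "mon 0 1 ^ p ^ (n - 1) \<in> A" using p_gt_1 by (intro regular_power mon_regular) simp
    ultimately have "D (mon 0 1 ^ q) = 0" using derivation_p_power[OF D] by (metis power_mult)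
    moreover have yq: "mon 0 1 ^ q = mon (int q + 1) 0 - mon 0 1"
      using mon_add_q[of 0 0] mon_power[of q 0 1] q_gt_1 by simp
    moreover have "D (mon (int q + 1) 0) = sc (of_nat (Suc q)) (mon (int q) 0 * D (mon 1 0))"
      using derivation_power[OF D mon_regular, of 1 0 q] mon_power[of "Suc q" 1 0]
          mon_power[of q 1 0] q_gt_1
      by (simp add: add.commute)
    moreover have "D (mon (int q + 1) 0 - mon 0 1) + D (mon 0 1) = D (mon (int q + 1) 0)"
    proof -
      have "mon (int q + 1) 0 - mon 0 1 \<in> A"
        by (intro vs.subspace_diff subspace_regular mon_regular)
      from Dadd[OF this mon_regular, of 0 1] show ?thesis by simp
    qed
    ultimately have "D (mon 0 1) = mon (int q) 0 * D (mon 1 0)" by simp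
    thus ?thesis by (simp add: E_def mon_regular D0_mon dmon_def fx_eq)
  qed
  have mon_pos: "mon (int a) 0 \<in> E" "mon (- int a) 0 \<in> E" "mon 0 a \<in> E" for a
  proof (induction a)
    case (Suc a)
    { case 1 show ?case using E_mult[OF Suc.IH(1) Ex] by (simp add: mon_mult add.commute) }
    { case 2 show ?case using E_mult[OF Suc.IH(2) Exi] by (simp add: mon_mult algebra_simps) }
    { case 3 show ?case using E_mult[OF Suc.IH(3) Ey] by (simp add: mon_mult) }
  qed (simp_all add: E1)
  have mon: "mon a b \<in> E" for a b
  proof -
    have "mon a 0 \<in> E" using mon_pos(1,2) by (metis int_cases2)
    from E_mult[OF this mon_pos(3)[of b]] show ?thesis by (simp add: mon_mult)
  qed
  from f have "f \<in> E"
  proof (induction rule: A_induct)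
    case (add f g)
    thus ?case by (auto simp: E_def Dadd D0_add regular_add algebra_simps)
  next
    case (scale c f)
    thus ?case using Dsc[of f f c] by (auto simp: E_def D0_sc regular_sc sc_alg)
  qed (rule mon)
  thus ?thesis by (simp add: E_def)
qed

abbreviation dx :: "'k dform" where "dx \<equiv> dd q (fx q)"

lemma dd_eq: "f \<in> A \<Longrightarrow> dd q f = fmul (D0 f) dx"
  by (auto simp: dd_def fmul_def fun_eq_iff derivation_eq fun_simps)

text \<open>Evaluation at \<open>D0\<close> recovers the coefficient of dx, so the coefficient of a
  form is unique in \<open>A\<close>.\<close>

lemma fmul_dx_D0: "g \<in> A \<Longrightarrow> fmul g dx D0 = g"
  by (simp add: fmul_def dd_def D0_derivation fx_eq D0_mon dmon_def)
    (simp add: mult.commute[of g] A_unit)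

lemma fmul_cong:
  assumes "\<And>P. P \<in> U12 q \<Longrightarrow> f P = g P"
  shows "fmul f dx = fmul g dx"
proof
  fix D :: "'k rfun \<Rightarrow> 'k rfun"
  have "D (fx q) P = 0" if "D \<in> derivations q" "P \<notin> U12 q" for P :: "'k pt"
  proof -
    have "D (fx q) \<in> A" using that(1) mon_regular[of 1 0] by (simp add: derivations_def fx_eq)
    thus ?thesis using that(2) by (rule regular_outside)
  qed
  thus "fmul f dx D = fmul g dx D"
    using assms by (simp add: fmul_def dd_def fun_eq_iff[where f = "_ * _"] fun_simps) metis
qed

lemma fmul_simps:
  "fmul (f + g) \<omega> = fmul f \<omega> + fmul g \<omega>" "fmul (f - g) \<omega> = fmul f \<omega> - fmul g \<omega>"
  "fmul f (fmul g \<omega>) = fmul (f * g) \<omega>" "fmul 0 \<omega> = 0" "fmul f 0 = 0"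
  by (simp_all add: fmul_def fun_eq_iff fun_simps algebra_simps)

lemma fmul_sum: "fmul (\<Sum>i\<in>I. f i) \<omega> = (\<Sum>i\<in>I. fmul (f i) \<omega>)"
  by (induction I rule: infinite_finite_induct) (simp_all add: fmul_simps)

lemma Omega_eq: "Omega q (U12 q) = {fmul g dx | g. g \<in> A}"
proof
  show "Omega q (U12 q) \<subseteq> {fmul g dx | g. g \<in> A}"
  proof
    fix \<omega> :: "'k dform" assume "\<omega> \<in> Omega q (U12 q)"
    then obtain m :: nat and f g where fg: "\<forall>i<m. f i \<in> A \<and> g i \<in> A"
      "\<omega> = (\<Sum>i<m. fmul (res12 q (f i)) (dd q (res12 q (g i))))" unfolding Omega_def by auto
    have "\<omega> = (\<Sum>i<m. fmul (f i * D0 (g i)) dx)"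
      unfolding fg(2) using fg(1) by (intro sum.cong) (auto simp: res12_A dd_eq fmul_simps)
    also have "\<dots> = fmul (\<Sum>i<m. f i * D0 (g i)) dx" by (simp only: fmul_sum)
    finally show "\<omega> \<in> {fmul g dx | g. g \<in> A}"
      using fg(1) by (auto intro!: vs.subspace_sum[OF subspace_regular] regular_mult D0_in_A)
  qed
  show "{fmul g dx | g. g \<in> A} \<subseteq> Omega q (U12 q)"
  proof clarify
    fix g assume "g \<in> A"
    thus "fmul g dx \<in> Omega q (U12 q)" unfolding Omega_def
      by (intro CollectI exI[of _ 1] exI[of _ "\<lambda>_. g"] exI[of _ "\<lambda>_. fx q"])
        (simp add: res12_A fx_eq mon_regular)
  qed
qed

section \<open>The Cartier operator\<close>

definition p_root :: "'k \<Rightarrow> 'k" where "p_root = inv (\<lambda>c. c ^ p)"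

lemma bij_frobenius: "bij (\<lambda>c :: 'k. c ^ p)"
proof (rule bijI)
  show "inj (\<lambda>c :: 'k. c ^ p)" by (rule injI) (rule frobenius_inj)
  show "surj (\<lambda>c :: 'k. c ^ p)"
    unfolding surj_def
  proof
    fix y :: 'k
    obtain c where "c ^ p = y" using nth_root_exists[of p y] p_gt_1 by auto
    thus "\<exists>c. y = c ^ p" by blast
  qed
qed

lemma p_root_power [simp]: "p_root c ^ p = c"
  unfolding p_root_def using surj_f_inv_f[OF bij_is_surj[OF bij_frobenius], of c] .

lemma power_p_root [simp]: "p_root (c ^ p) = c"
  by (rule frobenius_inj) (rule p_root_power)

lemma p_root_mult: "p_root (a * b) = p_root a * p_root b"
  by (rule frobenius_inj) (simp add: power_mult_distrib)

lemma p_root_add: "p_root (a + b) = p_root a + p_root b"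
  by (rule frobenius_inj) (simp add: frobenius_add)

lemma p_root_0 [simp]: "p_root 0 = 0"
  by (rule frobenius_inj) (use p_gt_1 in simp)

lemma fact_nonzero: "k < p \<Longrightarrow> (of_nat (fact k) :: 'k) \<noteq> 0"
  using prime_dvd_fact_iff[OF prime_p, of k] char_k of_nat_eq_0_iff_char_dvd[of "fact k", where
      ?'a = 'k]
  by auto

lemma of_nat_nonzero: "0 < k \<Longrightarrow> k < p \<Longrightarrow> (of_nat k :: 'k) \<noteq> 0"
  using char_k of_nat_eq_0_iff_char_dvd[of k, where ?'a = 'k] by (auto dest: dvd_imp_le)

text \<open>The p-th root is taken pointwise; that the result is again regular is
  \<open>cartier_coeff_in_A\<close>.\<close>

definition cartier_coeff :: "'k rfun \<Rightarrow> 'k rfun" where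
  "cartier_coeff g = (\<lambda>P. p_root ((D0 ^^ (p - 1)) g P / of_nat (fact (p - 1))))"

lemma D0_pow_linear:
  "(D0 ^^ k) (f + g) = (D0 ^^ k) f + (D0 ^^ k) g" "(D0 ^^ k) (sc c f) = sc c ((D0 ^^ k) f)"
      "(D0 ^^ k) 0 = 0"
  by (induction k arbitrary: f g) (simp_all add: D0_add D0_sc)

lemma D0_pow_sum: "(D0 ^^ k) (\<Sum>i\<in>I. f i) = (\<Sum>i\<in>I. (D0 ^^ k) (f i))"
  by (induction I rule: infinite_finite_induct) (simp_all add: D0_pow_linear)

lemma D0_pow_in_A: "f \<in> A \<Longrightarrow> (D0 ^^ k) f \<in> A"
  by (induction k) (auto simp: D0_in_A)

abbreviation pmonos :: "'k rfun set" where
  "pmonos \<equiv> {mon (int i + int p * a) (p * b) | i a b. i < p}"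

text \<open>The relation y = x^(q+1) - y^q trades factors y for powers of x and of y^q until every
  exponent of y is divisible by p. On the resulting monomials x^i (x^a y^b)^p the derivation
  \<open>D0\<close> acts on x^i alone.\<close>

lemma A_pmonos: "A = vs.span pmonos"
proof
  have "mon a b \<in> vs.span pmonos" for a b
  proof (induction b arbitrary: a)
    case 0
    have "mon a 0 = mon (int (nat (a mod int p)) + int p * (a div int p)) (p * 0)"
      using p_gt_1 by simp
    moreover have "nat (a mod int p) < p" using p_gt_1 by (simp add: nat_less_iff)
    ultimately show ?case by (intro vs.span_base CollectI) blast
  next
    case (Suc b)
    have eq: "mon a (Suc b) = mon (a + int q + 1) b - mon 0 q * mon a b"
      using mon_add_q[of a b] by (simp add: mon_mult add.commute)
    have "mon 0 q * mon a b \<in> vs.span pmonos"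
    proof (rule subset_span_mult[OF Suc.IH])
      fix f assume "f \<in> pmonos"
      then obtain i a b where f: "f = mon (int i + int p * a) (p * b)" "i < p" by auto
      obtain r where r: "q = p * r" using n_pos q_def by (cases n) auto
      have "q + p * b = p * (r + b)" using r by (simp add: distrib_left)
      hence "mon 0 q * f = mon (int i + int p * a) (p * (r + b))"
        unfolding f(1) mon_mult by simp
      thus "mon 0 q * f \<in> vs.span pmonos" using f(2) by (intro vs.span_base CollectI) blast
    qed
    thus ?case unfolding eq by (intro vs.span_diff Suc.IH)
  qed
  thus "A \<subseteq> vs.span pmonos" unfolding A_span_mon by (intro vs.span_minimal) auto
  show "vs.span pmonos \<subseteq> A" by (intro vs.span_minimal subspace_regular) (auto simp: mon_regular)
qed

lemma A_p_induct [consumes 1, case_names mon add scale]: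
  assumes "f \<in> A" "\<And>i a b. i < p \<Longrightarrow> Q (mon (int i + int p * a) (p * b))"
    and "\<And>f g. f \<in> A \<Longrightarrow> g \<in> A \<Longrightarrow> Q f \<Longrightarrow> Q g \<Longrightarrow> Q (f + g)"
    and "\<And>c f. f \<in> A \<Longrightarrow> Q f \<Longrightarrow> Q (sc c f)"
  shows "Q f"
proof (rule span_induct_mem)
  show "f \<in> vs.span pmonos" using assms(1) by (simp only: A_pmonos)
  have "mon (int 0 + int p * 0) (p * 0) \<in> pmonos"
    using p_gt_1 by (intro CollectI exI[of _ 0] conjI refl) simp
  thus "pmonos \<noteq> {}" by blast
qed (use assms(2-) in \<open>simp_all only: A_pmonos[symmetric], blast+\<close>)

lemma D0_p_mon: "D0 (mon (int i + int p * a) (p * b))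
    = sc (of_nat i) (mon (int i - 1 + int p * a) (p * b))"
  by (simp add: D0_mon dmon_def algebra_simps)

lemma D0_pow_mon: "(D0 ^^ i) (mon (int i + int p * a) (p * b))
    = sc (of_nat (fact i)) (mon (int p * a) (p * b))"
proof (induction i)
  case (Suc i)
  have "(D0 ^^ Suc i) (mon (int (Suc i) + int p * a) (p * b))
      = sc (of_nat (Suc i)) ((D0 ^^ i) (mon (int i + int p * a) (p * b)))"
    by (simp only: funpow_Suc_right o_apply D0_p_mon D0_pow_linear) simp
  thus ?case by (simp only: Suc vs.scale_scale fact_Suc of_nat_mult of_nat_id)
qed simp

lemma D0_pow_mon_0: "i < k \<Longrightarrow> (D0 ^^ k) (mon (int i + int p * a) (p * b)) = 0"
proof -
  assume "i < k"
  then obtain j where k: "k = j + Suc i" by (metis less_imp_Suc_add add_Suc_right add.commute)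
  have "(D0 ^^ Suc i) (mon (int i + int p * a) (p * b)) = 0"
    using D0_p_mon[of 0 a b] by (simp add: D0_pow_mon D0_sc)
  thus ?thesis by (simp only: k funpow_add o_apply D0_pow_linear)
qed

lemma cartier_coeff_add: "cartier_coeff (f + g) = cartier_coeff f + cartier_coeff g"
  by (simp add: cartier_coeff_def D0_pow_linear fun_eq_iff fun_simps add_divide_distrib p_root_add)

lemma cartier_coeff_sc: "cartier_coeff (sc c f) = sc (p_root c) (cartier_coeff f)"
  by (simp add: cartier_coeff_def D0_pow_linear fun_eq_iff fun_simps p_root_mult flip:
      times_divide_eq_right)

lemma cartier_coeff_mon:
  assumes "i < p"
  shows "cartier_coeff (mon (int i + int p * a) (p * b)) = (if i = p - 1 then mon a b else 0)"
proof (cases "i = p - 1")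
  case True
  have "cartier_coeff (mon (int i + int p * a) (p * b)) = (\<lambda>P. p_root (mon (int p * a) (p * b) P))"
    unfolding cartier_coeff_def True D0_pow_mon using fact_nonzero[of "p - 1"] p_gt_1
      by (simp add: fun_simps)
  also have "\<dots> = (\<lambda>P. p_root (mon a b P ^ p))"
    using mon_power[of p a b] p_gt_1 by (metis power_fun_apply zero_less_one order.strict_trans)
  finally show ?thesis using True by simp
next
  case False
  hence "i < p - 1" using assms by auto
  thus ?thesis by (simp add: cartier_coeff_def D0_pow_mon_0 fun_eq_iff fun_simps)
qed

lemma cartier_coeff_in_A: "f \<in> A \<Longrightarrow> cartier_coeff f \<in> A"
  by (induction rule: A_p_induct) (auto simp: cartier_coeff_add cartier_coeff_sc cartier_coeff_mon
      mon_regular regular_zero intro!: regular_add regular_sc)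

lemma D0_pow_p: "f \<in> A \<Longrightarrow> (D0 ^^ p) f = 0"
  by (induction rule: A_p_induct) (simp_all only: D0_pow_mon_0 D0_pow_linear vs.scale_zero_right
      add_0)

lemma D0_pow_pred_D0: "f \<in> A \<Longrightarrow> (D0 ^^ (p - 1)) (D0 f) = 0"
  using D0_pow_p[of f] p_gt_1 by (cases p) (auto simp: funpow_swap1)

lemma cartier_coeff_D0: "f \<in> A \<Longrightarrow> cartier_coeff (D0 f) = 0"
  by (simp only: cartier_coeff_def D0_pow_pred_D0) (simp add: fun_eq_iff fun_simps)

lemma cartier_coeff_p_mult:
  assumes f: "f \<in> A" and g: "g \<in> A"
  shows "cartier_coeff (f ^ p * g) = f * cartier_coeff g"
proof -
  have fp: "f ^ p \<in> A" using regular_power[OF f] p_gt_1 by auto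
  have "(D0 ^^ k) (f ^ p * g) = f ^ p * (D0 ^^ k) g" for k
  proof (induction k)
    case (Suc k)
    show ?case using D0_mult[OF fp D0_pow_in_A[OF g]] derivation_p_power[OF D0_derivation f]
      by (simp add: Suc)
  qed simp
  thus ?thesis
    by (simp add: cartier_coeff_def fun_eq_iff fun_simps p_root_mult flip: times_divide_eq_right)
qed

text \<open>Modulo \<open>u\<close>, only the term in which every factor \<open>u\<close> is differentiated once survives.\<close>

lemma D0_pow_power_mult:
  assumes u: "u \<in> A"
  shows "v \<in> A \<Longrightarrow> \<exists>w\<in>A. (D0 ^^ k) (u ^ k * v) = sc (of_nat (fact k)) (D0 u ^ k * v) + u * w"
proof (induction k arbitrary: v)
  case 0
  show ?case by (rule bexI[of _ 0]) (simp_all add: regular_zero)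
next
  case (Suc k)
  define v' where "v' = sc (of_nat (Suc k)) (D0 u * v) + u * D0 v"
  have v': "v' \<in> A" using u Suc.prems
    by (auto simp: v'_def intro!: regular_add regular_sc regular_mult D0_in_A)
  have "D0 (u ^ Suc k * v) = u ^ k * v'"
  proof -
    have "u ^ Suc k \<in> A" by (rule regular_power[OF u]) simp
    hence "D0 (u ^ Suc k * v) = u ^ Suc k * D0 v + v * D0 (u ^ Suc k)" using D0_mult Suc.prems
      by blast
    thus ?thesis unfolding derivation_power[OF D0_derivation u] v'_def
      by (simp add: sc_alg algebra_simps)
  qed
  moreover obtain w where w: "w \<in> A"
      "(D0 ^^ k) (u ^ k * v') = sc (of_nat (fact k)) (D0 u ^ k * v') + u * w"
    using Suc.IH[OF v'] by auto
  ultimately have "(D0 ^^ Suc k) (u ^ Suc k * v) = sc (of_nat (fact k)) (D0 u ^ k * v') + u * w"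
    by (simp only: funpow_Suc_right o_apply)
  also have "\<dots> = sc (of_nat (fact (Suc k))) (D0 u ^ Suc k * v)
      + u * (w + sc (of_nat (fact k)) (D0 u ^ k * D0 v))"
    by (simp add: v'_def sc_alg algebra_simps)
  finally show ?case
    using w(1) u Suc.prems by (intro bexI[of _ "w + sc (of_nat (fact k)) (D0 u ^ k * D0 v)"])
      (auto intro!: regular_add regular_sc A_power_mult D0_in_A)
qed

text \<open>
  Expand \<open>f\<close> around its value at a point: all terms but the last one of the binomial
  expansion of \<open>f ^ (p - 1) * df\<close> are exact.
\<close>

lemma cartier_coeff_power_pred:
  assumes f: "f \<in> A"
  shows "cartier_coeff (f ^ (p - 1) * D0 f) = D0 f"
proof
  fix P
  show "cartier_coeff (f ^ (p - 1) * D0 f) P = D0 f P"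
  proof (cases "P \<in> U12 q")
    case False
    have "cartier_coeff (f ^ (p - 1) * D0 f) \<in> A" "D0 f \<in> A"
      using f by (auto intro!: cartier_coeff_in_A A_power_mult D0_in_A)
    thus ?thesis using False by (simp add: regular_outside)
  next
    case True
    define c where "c = f P"
    define u where "u = f - sc c (mon 0 0)"
    have u: "u \<in> A" unfolding u_def using f
      by (intro vs.subspace_diff subspace_regular regular_sc mon_regular)
    have uP: "u P = 0" using True by (simp add: u_def c_def mon_def fun_simps)
    have Du: "D0 u = D0 f" by (simp add: u_def D0_diff D0_sc D0_mon dmon_def)
    let ?t = "\<lambda>i. sc (of_nat (p - 1 choose i) * c ^ (p - 1 - i)) (u ^ i * D0 u)"
    have exp: "f ^ (p - 1) * D0 f = (\<Sum>i\<le>p - 1. ?t i)"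
    proof
      fix Q
      show "(f ^ (p - 1) * D0 f) Q = (\<Sum>i\<le>p - 1. ?t i) Q"
      proof (cases "Q \<in> U12 q")
        case True
        hence "f Q = u Q + c" by (simp add: u_def mon_def fun_simps)
        thus ?thesis
          by (simp add: fun_simps Du binomial_ring sum_distrib_left sum_distrib_right mult_ac)
      next
        case False
        hence "D0 f Q = 0" using regular_outside[OF D0_in_A[OF f]] by blast
        thus ?thesis by (simp add: fun_simps Du)
      qed
    qed
    have "(D0 ^^ (p - 1)) (?t i) = 0" if "i < p - 1" for i
    proof -
      have "(of_nat (Suc i) :: 'k) \<noteq> 0" using that by (intro of_nat_nonzero) auto
      hence "u ^ i * D0 u = sc (1 / of_nat (Suc i)) (D0 (u ^ Suc i))"
        unfolding derivation_power[OF D0_derivation u] by (simp del: of_nat_Suc)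
      moreover have "(D0 ^^ (p - 1)) (D0 (u ^ Suc i)) = 0"
        using D0_pow_pred_D0[OF regular_power[OF u, of "Suc i"]] by simp
      ultimately show ?thesis by (simp only: D0_pow_linear vs.scale_zero_right)
    qed
    hence "(D0 ^^ (p - 1)) (f ^ (p - 1) * D0 f)
        = (\<Sum>i\<le>p - 1. if i = p - 1 then (D0 ^^ (p - 1)) (?t i) else 0)"
      unfolding exp D0_pow_sum by (intro sum.cong) auto
    also have "\<dots> = (D0 ^^ (p - 1)) (u ^ (p - 1) * D0 u)" by (simp add: D0_pow_linear)
    finally obtain w where
        "(D0 ^^ (p - 1)) (f ^ (p - 1) * D0 f) = sc (of_nat (fact (p - 1))) (D0 u ^ (p - 1) * D0 u)
            + u * w"
      using D0_pow_power_mult[OF u D0_in_A[OF u], of "p - 1"] by auto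
    \<comment> \<open>At P the multiple of u vanishes. The p - 1 differentiated factors and the
      original \<open>D0 f\<close> form the p-th power whose root is taken.\<close>
    hence "(D0 ^^ (p - 1)) (f ^ (p - 1) * D0 f) P = of_nat (fact (p - 1)) * (D0 f P) ^ p"
      using uP p_gt_1 by (cases p) (simp_all add: fun_simps Du)
    thus ?thesis using fact_nonzero[of "p - 1"] p_gt_1 by (simp add: cartier_coeff_def)
  qed
qed

definition cartier_op :: "'k dform \<Rightarrow> 'k dform" where
  "cartier_op \<omega> = (if \<omega> \<in> Omega q (U12 q) then fmul (cartier_coeff (\<omega> D0)) dx else 0)"

lemma cartier_op_fmul: "g \<in> A \<Longrightarrow> cartier_op (fmul g dx) = fmul (cartier_coeff g) dx"
  by (auto simp: cartier_op_def Omega_eq fmul_dx_D0)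

lemma cartier_op_is_cartier: "is_cartier p q cartier_op"
  unfolding is_cartier_def
proof (intro conjI ballI allI impI)
  fix \<omega> :: "'k dform" assume "\<omega> \<in> Omega q (U12 q)"
  then obtain g where g: "g \<in> A" "\<omega> = fmul g dx" by (auto simp: Omega_eq)
  show "cartier_op \<omega> \<in> Omega q (U12 q)" using g cartier_coeff_in_A
    by (auto simp: cartier_op_fmul) (auto simp: Omega_eq)
  {
    fix \<eta> :: "'k dform" assume "\<eta> \<in> Omega q (U12 q)"
    then obtain h where h: "h \<in> A" "\<eta> = fmul h dx" by (auto simp: Omega_eq)
    show "cartier_op (\<omega> + \<eta>) = cartier_op \<omega> + cartier_op \<eta>"
      using g h regular_add[OF g(1) h(1)]
        by (simp add: cartier_op_fmul cartier_coeff_add fmul_simps flip: fmul_simps(1))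
  }
  fix f assume f: "f \<in> A"
  show "cartier_op (fmul (f ^ p) \<omega>) = fmul f (cartier_op \<omega>)"
    using g f A_power_mult[OF f g(1)] by (simp add: fmul_simps cartier_op_fmul cartier_coeff_p_mult)
next
  fix f assume f: "f \<in> A"
  show "cartier_op (dd q f) = 0" using f
    by (simp add: dd_eq cartier_op_fmul D0_in_A cartier_coeff_D0 fmul_simps)
  show "cartier_op (fmul (f ^ (p - 1)) (dd q f)) = dd q f"
    using f
      by (simp only: dd_eq fmul_simps cartier_op_fmul D0_in_A A_power_mult cartier_coeff_power_pred)
next
  fix \<omega> :: "'k dform" assume "\<omega> \<notin> Omega q (U12 q)"
  thus "cartier_op \<omega> = 0" by (simp add: cartier_op_def)
qed

text \<open>On x^i (x^a y^b)^p dx the p-th power can be pulled out, leaving x^i dx. This is exact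
  for i < p - 1 and is covered by the last characterising identity for i = p - 1.\<close>

lemma cartier_unique:
  assumes C: "is_cartier p q C"
  shows "C = cartier_op"
proof
  fix \<omega>
  have add: "C (\<omega> + \<eta>) = C \<omega> + C \<eta>" if "\<omega> \<in> Omega q (U12 q)" "\<eta> \<in> Omega q (U12 q)" for \<omega> \<eta>
    using C that by (simp add: is_cartier_def)
  have pow: "C (fmul (f ^ p) \<omega>) = fmul f (C \<omega>)" if "f \<in> A" "\<omega> \<in> Omega q (U12 q)" for f \<omega>
    using C that by (simp add: is_cartier_def)
  have exact: "C (dd q f) = 0" "C (fmul (f ^ (p - 1)) (dd q f)) = dd q f" if "f \<in> A" for f
    using C that by (simp_all add: is_cartier_def)
  have Om: "fmul g dx \<in> Omega q (U12 q)" if "g \<in> A" for g using that by (auto simp: Omega_eq)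
  have main: "C (fmul g dx) = fmul (cartier_coeff g) dx" if "g \<in> A" for g
    using that
  proof (induction rule: A_p_induct)
    case (mon i a b)
    have "mon (int i + int p * a) (p * b) = mon a b ^ p * mon (int i) 0"
      using p_gt_1 by (simp add: mon_power mon_mult add.commute)
    hence *: "C (fmul (mon (int i + int p * a) (p * b)) dx)
        = fmul (mon a b) (C (fmul (mon (int i) 0) dx))"
      using pow[OF mon_regular[of a b] Om[OF mon_regular[of "int i" 0]]] by (simp add: fmul_simps)
    show ?case
    proof (cases "i = p - 1")
      case True
      have "mon (int i) 0 = mon 1 0 ^ (p - 1)" using p_gt_1 by (simp add: True mon_power)
      hence "C (fmul (mon (int i) 0) dx) = dx"
        using exact(2)[OF mon_regular[of 1 0]] by (simp add: fx_eq)
      thus ?thesis unfolding * cartier_coeff_mon[OF mon(1)] using True by simp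
    next
      case False
      hence "(of_nat (Suc i) :: 'k) \<noteq> 0" using mon(1) by (intro of_nat_nonzero) auto
      hence "D0 (sc (1 / of_nat (Suc i)) (mon (int (Suc i)) 0)) = mon (int i) 0"
        by (simp add: D0_sc D0_mon dmon_def del: of_nat_Suc) simp
      hence "fmul (mon (int i) 0) dx = dd q (sc (1 / of_nat (Suc i)) (mon (int (Suc i)) 0))"
        using dd_eq[OF regular_sc[OF mon_regular]] by simp
      hence "C (fmul (mon (int i) 0) dx) = 0" using exact(1)[OF regular_sc[OF mon_regular]] by simp
      thus ?thesis unfolding * using False mon(1) by (simp add: cartier_coeff_mon fmul_simps)
    qed
  next
    case (add f g)
    thus ?case by (simp add: fmul_simps cartier_coeff_add \<open>\<And>\<omega> \<eta>. _ \<Longrightarrow> _ \<Longrightarrow> C (\<omega> + \<eta>) = _\<close> Om)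
  next
    case (scale c f)
    \<comment> \<open>A scalar is the p-th power of a constant function in \<open>A\<close>, so
      compatibility with p-th powers yields compatibility with scalars.\<close>
    have pm: "sc (p_root c) (mon 0 0) ^ p * f = sc c f"
    proof -
      have "sc (p_root c) (mon 0 0) ^ p = sc c (mon 0 0)"
        by (rule ext) (use p_gt_1 in \<open>simp add: fun_simps mon_def power_mult_distrib\<close>)
      thus ?thesis by (simp only: sc_mult_left A_unit[OF scale(1)])
    qed
    have "C (fmul (sc c f) dx) = fmul (sc (p_root c) (mon 0 0)) (C (fmul f dx))"
      using pow[OF regular_sc[OF mon_regular] Om[OF scale(1)], of "p_root c" 0 0]
        by (simp add: fmul_simps pm)
    also have "\<dots> = fmul (sc (p_root c) (cartier_coeff f)) dx"
      unfolding scale(2) fmul_simps(3) by (rule fmul_cong) (simp add: fun_simps mon_def)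
    finally show ?case by (simp add: cartier_coeff_sc)
  qed
  show "C \<omega> = cartier_op \<omega>"
  proof (cases "\<omega> \<in> Omega q (U12 q)")
    case True
    then obtain g where "g \<in> A" "\<omega> = fmul g dx" by (auto simp: Omega_eq)
    thus ?thesis using main by (simp add: cartier_op_fmul)
  next
    case False
    thus ?thesis using C by (simp add: is_cartier_def cartier_op_def)
  qed
qed

lemma cartier_fmul: "g \<in> A \<Longrightarrow> cartier p q (fmul g dx) = fmul (cartier_coeff g) dx"
proof -
  have "cartier p q = cartier_op"
    unfolding cartier_def
      by (rule the_equality) (auto simp: cartier_op_is_cartier intro: cartier_unique)
  thus "g \<in> A \<Longrightarrow> ?thesis" by (simp add: cartier_op_fmul)
qed


section \<open>Cohomology classes and semilinear maps\<close>

definition cscale :: "'k \<Rightarrow> 'k cochain \<Rightarrow> 'k cochain" where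
  "cscale c = (\<lambda>(\<phi>, \<eta>1, \<eta>2). (sc c \<phi>, (\<lambda>D. sc c (\<eta>1 D)), (\<lambda>D. sc c (\<eta>2 D))))"

lemma cscale_add: "cscale c (z + w) = cscale c z + cscale c w"
  and cscale_add_left: "cscale (c + d) z = cscale c z + cscale d z"
  and cscale_scale: "cscale c (cscale d z) = cscale (c * d) z"
  and cscale_1 [simp]: "cscale 1 z = z"
  and cscale_0 [simp]: "cscale 0 z = 0"
  and cscale_zero [simp]: "cscale c 0 = 0"
  by (cases z; cases w; simp add: cscale_def zero_prod_def fun_eq_iff fun_simps algebra_simps)+

lemma cscale_sum: "cscale c (\<Sum>i\<in>I. z i) = (\<Sum>i\<in>I. cscale c (z i))"
  by (induction I rule: infinite_finite_induct) (simp_all add: cscale_add)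

lemma cscale_minus: "cscale (- c) z = - cscale c z"
proof -
  have "cscale (- c) z + cscale c z = cscale (- c + c) z" by (simp only: cscale_add_left)
  thus ?thesis by (simp add: eq_neg_iff_add_eq_0)
qed

lemma cscale_diff: "cscale c (z - w) = cscale c z - cscale c w"
  using cscale_add[of c "z - w" w] by (simp add: eq_diff_eq)

lemma cscale_diff_left: "cscale (c - d) z = cscale c z - cscale d z"
  using cscale_add_left[of c "- d" z] by (simp add: cscale_minus)

abbreviation boundary :: "'k rfun \<Rightarrow> 'k rfun \<Rightarrow> 'k cochain" where
  "boundary f g \<equiv> (f - g, dd q f, dd q g)"

definition res_U1 :: "'k rfun set" where "res_U1 = res12 q ` regular (U1 q)"
definition res_U2 :: "'k rfun set" where "res_U2 = res12 q ` regular (U2 q)"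

abbreviation E :: "'k cochain set" where "E \<equiv> dR_exact q"

lemma E_eq: "E = {boundary f g | f g. f \<in> res_U1 \<and> g \<in> res_U2}"
  unfolding dR_exact_def res_U1_def res_U2_def by blast

lemma res12_linear: "res12 q (f + g) = res12 q f + res12 q g" "res12 q (sc c f) = sc c (res12 q f)"
  "res12 q 0 = (0 :: 'k rfun)" "m > 0 \<Longrightarrow> res12 q (f ^ m) = res12 q f ^ m" for f g :: "'k rfun"
  by (simp_all add: res12_def fun_eq_iff fun_simps)

lemma subspace_res_U1: "vs.subspace res_U1" and subspace_res_U2: "vs.subspace res_U2"
proof -
  have "vs.subspace (res12 q ` regular U)" for U :: "'k pt set"
  proof (rule vs.subspaceI)
    show "0 \<in> res12 q ` regular U"
      by (rule image_eqI[of _ _ 0]) (simp_all add: res12_linear regular_zero)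
    show "x + y \<in> res12 q ` regular U" if "x \<in> res12 q ` regular U"
        "y \<in> res12 q ` regular U" for x y
      using that by (auto simp: regular_add simp flip: res12_linear)
    show "sc c x \<in> res12 q ` regular U" if "x \<in> res12 q ` regular U" for c x
      using that by (auto simp: regular_sc simp flip: res12_linear)
  qed
  thus "vs.subspace res_U1" "vs.subspace res_U2" unfolding res_U1_def res_U2_def by blast+
qed

lemma R_subset_A: "f \<in> res_U1 \<Longrightarrow> f \<in> A" "f \<in> res_U2 \<Longrightarrow> f \<in> A"
  unfolding res_U1_def res_U2_def using regular_res12 by auto

lemma R_power: "f \<in> res_U1 \<Longrightarrow> m > 0 \<Longrightarrow> f ^ m \<in> res_U1" "f \<in> res_U2 \<Longrightarrow> m > 0 \<Longrightarrow> f ^ m \<in> res_U2"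
  unfolding res_U1_def res_U2_def by (auto simp: regular_power simp flip: res12_linear)

lemma dd_add: "f \<in> A \<Longrightarrow> g \<in> A \<Longrightarrow> dd q (f + g) = dd q f + dd q g"
  by (simp add: dd_eq regular_add D0_add fmul_simps)

lemma dd_sc: "f \<in> A \<Longrightarrow> dd q (sc c f) = (\<lambda>D. sc c (dd q f D))"
  by (simp add: dd_eq regular_sc D0_sc) (simp add: fmul_def sc_alg)

lemma dd_0 [simp]: "dd q (0 :: 'k rfun) = 0"
  using dd_eq[OF regular_zero] by (simp add: fmul_simps)

lemma zero_in_E: "0 \<in> E"
  unfolding E_eq using vs.subspace_0[OF subspace_res_U1] vs.subspace_0[OF subspace_res_U2]
  by (intro CollectI exI[of _ 0]) (simp add: zero_prod_def)

lemma E_add: "z \<in> E \<Longrightarrow> w \<in> E \<Longrightarrow> z + w \<in> E"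
proof -
  assume "z \<in> E" "w \<in> E"
  then obtain f g f' g' where *: "z = boundary f g" "w = boundary f' g'" "f \<in> res_U1"
      "f' \<in> res_U1" "g \<in> res_U2" "g' \<in> res_U2"
    unfolding E_eq by blast
  have "z + w = boundary (f + f') (g + g')" using * by (simp add: dd_add R_subset_A)
  moreover have "f + f' \<in> res_U1" "g + g' \<in> res_U2"
    using * by (simp_all add: vs.subspace_add subspace_res_U1 subspace_res_U2)
  ultimately show ?thesis unfolding E_eq by blast
qed

lemma E_cscale: "z \<in> E \<Longrightarrow> cscale c z \<in> E"
proof -
  assume "z \<in> E"
  then obtain f g where *: "z = boundary f g" "f \<in> res_U1" "g \<in> res_U2" unfolding E_eq by blast
  have "cscale c z = boundary (sc c f) (sc c g)"
    using * by (simp add: cscale_def dd_sc R_subset_A vs.scale_right_diff_distrib)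
  moreover have "sc c f \<in> res_U1" "sc c g \<in> res_U2"
    using * by (simp_all add: vs.subspace_scale subspace_res_U1 subspace_res_U2)
  ultimately show ?thesis unfolding E_eq by blast
qed

lemma E_uminus: "z \<in> E \<Longrightarrow> - z \<in> E"
  using E_cscale[of z "- 1"] by (simp add: cscale_minus)

lemma E_diff: "z \<in> E \<Longrightarrow> w \<in> E \<Longrightarrow> z - w \<in> E"
  using E_add[of z "- w"] E_uminus by simp

lemma E_sum: "(\<And>i. i \<in> I \<Longrightarrow> z i \<in> E) \<Longrightarrow> (\<Sum>i\<in>I. z i) \<in> E"
  by (induction I rule: infinite_finite_induct) (auto simp: zero_in_E E_add)

abbreviation cl :: "'k cochain \<Rightarrow> 'k cochain set" where "cl \<equiv> dR_class q"

lemma cl_eq: "cl z = {z + w | w. w \<in> E}"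
  by (auto simp: dR_class_def elt_set_plus_def)

lemma cl_eq_iff: "cl z = cl w \<longleftrightarrow> z - w \<in> E"
proof
  assume "cl z = cl w"
  moreover have "z \<in> cl z" unfolding cl_eq using zero_in_E by (intro CollectI exI[of _ 0]) simp
  ultimately obtain v where "z = w + v" "v \<in> E" unfolding cl_eq by auto
  thus "z - w \<in> E" by simp
next
  assume *: "z - w \<in> E"
  show "cl z = cl w"
  proof (intro set_eqI iffI)
    fix x assume "x \<in> cl z"
    then obtain v where "x = z + v" "v \<in> E" unfolding cl_eq by auto
    hence "x = w + ((z - w) + v)" "(z - w) + v \<in> E" using E_add[OF *] by simp_all
    thus "x \<in> cl w" unfolding cl_eq by blast
  next
    fix x assume "x \<in> cl w"
    then obtain v where "x = w + v" "v \<in> E" unfolding cl_eq by auto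
    hence "x = z + (v - (z - w))" "v - (z - w) \<in> E" using E_diff[OF _ *] by simp_all
    thus "x \<in> cl z" unfolding cl_eq by blast
  qed
qed

lemma cl_0: "cl 0 = E"
  by (simp add: cl_eq)

lemma cl_add: "cl z + cl w = cl (z + w)"
proof (intro set_eqI iffI)
  fix x assume "x \<in> cl z + cl w"
  then obtain u v where "x = (z + u) + (w + v)" "u \<in> E" "v \<in> E"
    unfolding cl_eq by (auto elim!: set_plus_elim)
  hence "x = (z + w) + (u + v)" "u + v \<in> E" by (simp_all add: E_add algebra_simps)
  thus "x \<in> cl (z + w)" unfolding cl_eq by blast
next
  fix x assume "x \<in> cl (z + w)"
  then obtain v where v: "x = z + w + v" "v \<in> E" unfolding cl_eq by auto
  have "z + 0 \<in> cl z" "w + v \<in> cl w" unfolding cl_eq using v zero_in_E by blast+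
  from set_plus_intro[OF this] show "x \<in> cl z + cl w" using v by (simp add: add.assoc)
qed

text \<open>Additivity is asked only for sums of z with exact cochains, so the lemma covers maps
  that are additive just on part of the cochains, as Verschiebung is.\<close>

lemma induced_cl:
  assumes "\<And>w. w \<in> E \<Longrightarrow> L (z + w) = L z + L w" "\<And>w. w \<in> E \<Longrightarrow> L w \<in> E"
  shows "induced q L (cl z) = cl (L z)"
proof (intro set_eqI iffI)
  fix x assume "x \<in> induced q L (cl z)"
  then obtain w v where "w \<in> E" "v \<in> E" "x = L (z + w) + v"
    unfolding induced_def cl_eq by (auto elim!: set_plus_elim)
  hence "x = L z + (L w + v)" "L w + v \<in> E" using assms E_add by (simp_all add: add.assoc)
  thus "x \<in> cl (L z)" unfolding cl_eq by blast
next
  fix x assume "x \<in> cl (L z)"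
  then obtain v where v: "x = L z + v" "v \<in> E" unfolding cl_eq by auto
  have "z + 0 \<in> cl z" unfolding cl_eq using zero_in_E by blast
  hence "L z \<in> L ` cl z" by simp
  from set_plus_intro[OF this v(2)] show "x \<in> induced q L (cl z)" unfolding induced_def v(1) .
qed

lemma class_scale_cl: "class_scale q c (cl z) = cl (cscale c z)"
  unfolding class_scale_def cscale_def[symmetric]
    by (rule induced_cl) (auto simp: cscale_add E_cscale)

section \<open>Spans of classes and semilinear maps between them\<close>

definition comb :: "'i set \<Rightarrow> ('i \<Rightarrow> 'k cochain) \<Rightarrow> ('i \<Rightarrow> 'k) \<Rightarrow> 'k cochain" where
  "comb I z c = (\<Sum>i\<in>I. cscale (c i) (z i))"

lemma comb_add: "comb I z c + comb I z d = comb I z (\<lambda>i. c i + d i)"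
  by (simp add: comb_def sum.distrib cscale_add_left)

lemma comb_diff: "comb I z c - comb I z d = comb I z (\<lambda>i. c i - d i)"
  by (simp add: comb_def sum_subtractf cscale_diff_left)

lemma cscale_comb: "cscale a (comb I z c) = comb I z (\<lambda>i. a * c i)"
  by (simp add: comb_def cscale_sum cscale_scale)

lemma class_span_eq:
  assumes I: "finite I"
  shows "class_span q ((\<lambda>i. cl (z i)) ` I) = {cl (comb I z c) | c. True}"
proof
  show "class_span q ((\<lambda>i. cl (z i)) ` I) \<subseteq> {cl (comb I z c) | c. True}"
  proof
    fix K assume "K \<in> class_span q ((\<lambda>i. cl (z i)) ` I)"
    thus "K \<in> {cl (comb I z c) | c. True}"
    proof induction
      case span_zero
      have "comb I z (\<lambda>_. 0) = 0" by (simp add: comb_def)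
      thus ?case by (intro CollectI exI[of _ "\<lambda>_. 0"]) (simp add: cl_0)
    next
      case (span_base K)
      then obtain i where i: "i \<in> I" "K = cl (z i)" by auto
      have "comb I z (\<lambda>k. if k = i then 1 else 0) = (\<Sum>k\<in>I. if k = i then z k else 0)"
        unfolding comb_def by (intro sum.cong) auto
      also have "\<dots> = z i" using I i(1) by simp
      finally show ?case using i(2) by (intro CollectI exI[of _ "\<lambda>k. if k = i then 1 else 0"]) simp
    next
      case (span_add K L)
      thus ?case by (auto simp: cl_add comb_add)
    next
      case (span_scale K a)
      thus ?case by (auto simp: class_scale_cl cscale_comb)
    qed
  qed
  have "cl (comb J z c) \<in> class_span q ((\<lambda>i. cl (z i)) ` I)" if "J \<subseteq> I" for J c
    using finite_subset[OF that I] that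
  proof (induction J)
    case empty
    show ?case by (simp add: comb_def cl_0 class_span.span_zero)
  next
    case (insert i J)
    have "comb (insert i J) z c = cscale (c i) (z i) + comb J z c"
      using insert by (simp add: comb_def)
    hence "cl (comb (insert i J) z c) = class_scale q (c i) (cl (z i)) + cl (comb J z c)"
      by (simp add: cl_add class_scale_cl)
    moreover have "cl (z i) \<in> class_span q ((\<lambda>i. cl (z i)) ` I)"
        "cl (comb J z c) \<in> class_span q ((\<lambda>i. cl (z i)) ` I)"
      using insert by (simp_all add: class_span.span_base)
    ultimately show ?case by (simp only: class_span.span_add class_span.span_scale)
  qed
  thus "{cl (comb I z c) | c. True} \<subseteq> class_span q ((\<lambda>i. cl (z i)) ` I)" by blast
qed

text \<open>The domain M accounts for the Cartier operator, which is characterised on regular forms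
  and set to 0 elsewhere; for Frobenius M is everything.\<close>

definition semilinear_on :: "'k cochain set \<Rightarrow> ('k \<Rightarrow> 'k) \<Rightarrow> ('k cochain \<Rightarrow> 'k cochain) \<Rightarrow> bool" where
  "semilinear_on M \<sigma> L \<longleftrightarrow> E \<subseteq> M \<and> (\<forall>z\<in>M. \<forall>w\<in>M. z + w \<in> M \<and> L (z + w) = L z + L w) \<and>
    (\<forall>c. \<forall>z\<in>M. cscale c z \<in> M \<and> L (cscale c z) = cscale (\<sigma> c) (L z)) \<and> (\<forall>z\<in>E. L z \<in> E)"

lemma semilinear_onD:
  assumes "semilinear_on M \<sigma> L"
  shows "z \<in> E \<Longrightarrow> z \<in> M" "z \<in> M \<Longrightarrow> w \<in> M \<Longrightarrow> z + w \<in> M" "z \<in> M \<Longrightarrow> w \<in> M \<Longrightarrow> L (z + w) = L z + L w"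
    "z \<in> M \<Longrightarrow> cscale c z \<in> M" "z \<in> M \<Longrightarrow> L (cscale c z) = cscale (\<sigma> c) (L z)" "z \<in> E \<Longrightarrow> L z \<in> E"
  using assms unfolding semilinear_on_def by blast+

lemma semilinear_on_cl: "semilinear_on M \<sigma> L \<Longrightarrow> z \<in> M \<Longrightarrow> induced q L (cl z) = cl (L z)"
  by (rule induced_cl) (simp_all add: semilinear_onD)

lemma semilinear_on_comb:
  assumes L: "semilinear_on M \<sigma> L" and I: "finite I" "\<And>i. i \<in> I \<Longrightarrow> z i \<in> M"
  shows "comb I z c \<in> M \<and> L (comb I z c) = comb I (\<lambda>i. L (z i)) (\<lambda>i. \<sigma> (c i))"
  using I
proof (induction I)
  case empty
  have "0 \<in> M" using semilinear_onD(1)[OF L] zero_in_E by blast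
  moreover from this have "L 0 = 0" using semilinear_onD(3)[OF L, of 0 0] by simp
  ultimately show ?case by (simp add: comb_def)
next
  case (insert i I)
  thus ?case by (simp add: comb_def semilinear_onD[OF L])
qed

lemma induced_kernel:
  assumes L: "semilinear_on M \<sigma> L" and I: "finite I" "\<And>i. i \<in> I \<Longrightarrow> z i \<in> M"
    and ker: "\<And>i. i \<in> I \<Longrightarrow> L (z i) \<in> E"
  shows "induced q L ` class_span q ((\<lambda>i. cl (z i)) ` I) = {cl 0}"
proof -
  have "induced q L (cl (comb I z c)) = cl 0" for c
  proof -
    note m = semilinear_on_comb[OF L I, where c = c]
    have "comb I (\<lambda>i. L (z i)) (\<lambda>i. \<sigma> (c i)) \<in> E"
      unfolding comb_def using ker by (intro E_sum E_cscale)
    thus ?thesis using semilinear_on_cl[OF L conjunct1[OF m]] m by (simp add: cl_eq_iff)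
  qed
  thus ?thesis unfolding class_span_eq[OF I(1)] by blast
qed

text \<open>Up to exact cochains L has a monomial matrix: a bijection of index sets with nonzero
  scalars u. \<open>T\<close> transports coefficients. Independence of the target classes gives
  injectivity; preimages are found by dividing by u and inverting \<sigma>.\<close>

lemma induced_semilinear_iso:
  assumes L: "semilinear_on M \<sigma> L" and I: "finite I" "\<And>i. i \<in> I \<Longrightarrow> z i \<in> M"
    and \<sigma>: "bij \<sigma>" and \<pi>: "bij_betw \<pi> I J"
    and u: "\<And>i. i \<in> I \<Longrightarrow> u i \<noteq> 0" "\<And>i. i \<in> I \<Longrightarrow> L (z i) - cscale (u i) (w (\<pi> i)) \<in> E"
    and indep: "\<And>d j. comb J w d \<in> E \<Longrightarrow> j \<in> J \<Longrightarrow> d j = 0"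
  shows "semilinear_iso q \<sigma> (induced q L) (class_span q ((\<lambda>i. cl (z i)) ` I))
      (class_span q ((\<lambda>j. cl (w j)) ` J))"
proof -
  have J: "finite J" using \<pi> I(1) by (simp add: bij_betw_finite)
  define \<rho> where "\<rho> = inv_into I \<pi>"
  have \<rho>: "\<rho> (\<pi> i) = i" if "i \<in> I" for i
    using \<pi> that unfolding \<rho>_def by (simp add: bij_betw_def)
  define T where "T c = (\<lambda>j. \<sigma> (c (\<rho> j)) * u (\<rho> j))" for c
  have T: "T c (\<pi> i) = \<sigma> (c i) * u i" if "i \<in> I" for c i using \<rho>[OF that] by (simp add: T_def)
  note m = semilinear_on_comb[OF L I]
  have img: "induced q L (cl (comb I z c)) = cl (comb J w (T c))" for c
  proof -
    have "comb J w (T c) = (\<Sum>i\<in>I. cscale (\<sigma> (c i) * u i) (w (\<pi> i)))"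
      unfolding comb_def using sum.reindex_bij_betw[OF \<pi>, of "\<lambda>j. cscale (T c j) (w j)"] T by simp
    hence "comb I (\<lambda>i. L (z i)) (\<lambda>i. \<sigma> (c i)) - comb J w (T c)
        = (\<Sum>i\<in>I. cscale (\<sigma> (c i)) (L (z i) - cscale (u i) (w (\<pi> i))))"
      by (simp add: comb_def sum_subtractf cscale_diff cscale_scale)
    also have "\<dots> \<in> E" using u(2) by (intro E_sum E_cscale)
    finally show ?thesis using semilinear_on_cl[OF L conjunct1[OF m]] m by (simp add: cl_eq_iff)
  qed
  show ?thesis
    unfolding semilinear_iso_def class_span_eq[OF I(1)] class_span_eq[OF J]
  proof (intro conjI ballI allI)
    show "bij_betw (induced q L) {cl (comb I z c) | c. True} {cl (comb J w d) | d. True}"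
      unfolding bij_betw_def
    proof
      show "inj_on (induced q L) {cl (comb I z c) | c. True}"
      proof (rule inj_onI, clarify)
        fix c c' assume "induced q L (cl (comb I z c)) = induced q L (cl (comb I z c'))"
        hence "comb J w (\<lambda>j. T c j - T c' j) \<in> E" by (simp add: img cl_eq_iff comb_diff)
        hence eq: "T c j - T c' j = 0" if "j \<in> J" for j using indep that by blast
        have "c i = c' i" if "i \<in> I" for i
        proof -
          have "\<pi> i \<in> J" using \<pi> that by (auto simp: bij_betw_def)
          hence "\<sigma> (c i) = \<sigma> (c' i)" using eq[of "\<pi> i"] T[OF that] u(1)[OF that] by simp
          thus ?thesis using \<sigma> by (simp add: bij_def inj_eq)
        qed
        hence "comb I z c = comb I z c'" by (simp add: comb_def)
        thus "cl (comb I z c) = cl (comb I z c')" by simp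
      qed
      have "\<exists>c. comb J w (T c) = comb J w d" for d
      proof
        show "comb J w (T (\<lambda>i. inv \<sigma> (d (\<pi> i) / u i))) = comb J w d"
          unfolding comb_def
        proof (rule sum.cong)
          fix j assume "j \<in> J"
          then obtain i where i: "i \<in> I" "j = \<pi> i" using \<pi> by (auto simp: bij_betw_def)
          thus "cscale (T (\<lambda>i. inv \<sigma> (d (\<pi> i) / u i)) j) (w j) = cscale (d j) (w j)"
            using T[OF i(1)] u(1)[OF i(1)] \<sigma> by (simp add: bij_is_surj surj_f_inv_f)
        qed simp
      qed
      thus "induced q L ` {cl (comb I z c) | c. True} = {cl (comb J w d) | d. True}"
        by (auto simp: img image_iff) (metis img)
    qed
    fix K assume "K \<in> {cl (comb I z c) | c. True}"
    then obtain c where K: "K = cl (comb I z c)" by auto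
    {
      fix K' assume "K' \<in> {cl (comb I z c) | c. True}"
      then obtain c' where K': "K' = cl (comb I z c')" by auto
      show "induced q L (K + K') = induced q L K + induced q L K'"
        using m[where c = c] m[where c = c'] unfolding K K' cl_add
        by (simp only: semilinear_on_cl[OF L] semilinear_onD[OF L] cl_add)
    }
    fix a
    show "induced q L (class_scale q a K) = class_scale q (\<sigma> a) (induced q L K)"
      using m[where c = c] unfolding K class_scale_cl
      by (simp only: semilinear_on_cl[OF L] semilinear_onD[OF L] class_scale_cl)
  qed
qed

definition Frob_cochain :: "'k cochain \<Rightarrow> 'k cochain" where
  "Frob_cochain = (\<lambda>(\<phi>, \<eta>1, \<eta>2). (\<phi> ^ p, 0, 0))"

definition Ver_cochain :: "'k cochain \<Rightarrow> 'k cochain" where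
  "Ver_cochain = (\<lambda>(\<phi>, \<eta>1, \<eta>2). (0, cartier p q \<eta>1, cartier p q \<eta>2))"

lemma Frob_eq: "Frob p q = induced q Frob_cochain" and Ver_eq: "Ver p q = induced q Ver_cochain"
  by (simp_all add: Frob_def Ver_def Frob_cochain_def Ver_cochain_def)

lemma rfun_frobenius_add: "(f + g) ^ p = f ^ p + g ^ p" for f g :: "'k rfun"
  by (simp add: fun_eq_iff fun_simps frobenius_add)

lemma rfun_frobenius_diff: "(f - g) ^ p = f ^ p - g ^ p" for f g :: "'k rfun"
  using rfun_frobenius_add[of "f - g" g] by (simp add: eq_diff_eq)

lemma dd_p_power: "f \<in> A \<Longrightarrow> dd q (f ^ p) = 0"
  using derivation_p_power by (auto simp: dd_def fun_eq_iff zero_fun_def)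

text \<open>An exact cochain goes to the boundary of the p-th powers, because their differentials
  vanish.\<close>

lemma semilinear_Frob_cochain: "semilinear_on UNIV (\<lambda>c. c ^ p) Frob_cochain"
  unfolding semilinear_on_def
proof (intro conjI ballI allI)
  fix z w :: "'k cochain" and c :: 'k
  show "Frob_cochain (z + w) = Frob_cochain z + Frob_cochain w"
    by (cases z; cases w) (simp add: Frob_cochain_def rfun_frobenius_add)
  have "sc c f ^ p = sc (c ^ p) (f ^ p)" for f
    by (simp add: fun_eq_iff fun_simps power_mult_distrib)
  moreover have "(\<lambda>D. sc c' (0 D)) = (0 :: 'k dform)" for c'
    by (simp add: fun_eq_iff fun_simps)
  ultimately show "Frob_cochain (cscale c z) = cscale (c ^ p) (Frob_cochain z)"
    by (cases z) (simp add: Frob_cochain_def cscale_def)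
next
  fix z assume "z \<in> E"
  then obtain f g where *: "z = boundary f g" "f \<in> res_U1" "g \<in> res_U2" unfolding E_eq by blast
  have "Frob_cochain z = boundary (f ^ p) (g ^ p)"
    using * by (simp add: Frob_cochain_def rfun_frobenius_diff dd_p_power R_subset_A)
  moreover have "f ^ p \<in> res_U1" "g ^ p \<in> res_U2" using * R_power p_gt_1 by auto
  ultimately show "Frob_cochain z \<in> E" unfolding E_eq by blast
qed auto

definition Omega_cochains :: "'k cochain set" where
  "Omega_cochains = {(\<phi>, fmul g dx, fmul h dx) | \<phi> g h. g \<in> A \<and> h \<in> A}"

lemma cscale_fmul: "cscale c (\<phi>, fmul g dx, fmul h dx)
    = (sc c \<phi>, fmul (sc c g) dx, fmul (sc c h) dx)"
  by (simp add: cscale_def) (simp add: fmul_def fun_eq_iff fun_simps)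

lemma Ver_cochain_fmul: "g \<in> A \<Longrightarrow> h \<in> A \<Longrightarrow> Ver_cochain (\<phi>, fmul g dx, fmul h dx)
    = (0, fmul (cartier_coeff g) dx, fmul (cartier_coeff h) dx)"
  by (simp add: Ver_cochain_def cartier_fmul)

text \<open>Exact cochains even go to 0, since the Cartier operator kills exact forms.\<close>

lemma semilinear_Ver_cochain: "semilinear_on Omega_cochains p_root Ver_cochain"
  unfolding semilinear_on_def
proof (intro conjI ballI allI subsetI)
  fix z assume "z \<in> E"
  then obtain f g where *: "z = boundary f g" "f \<in> res_U1" "g \<in> res_U2" unfolding E_eq by blast
  hence z: "z = (f - g, fmul (D0 f) dx, fmul (D0 g) dx)" by (simp add: dd_eq R_subset_A)
  have A: "D0 f \<in> A" "D0 g \<in> A" using * by (simp_all add: D0_in_A R_subset_A)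
  with z show "z \<in> Omega_cochains" unfolding Omega_cochains_def by blast
  have "Ver_cochain z = 0" unfolding z Ver_cochain_fmul[OF A] using *
    by (simp add: cartier_coeff_D0 R_subset_A fmul_simps zero_prod_def)
  thus "Ver_cochain z \<in> E" using zero_in_E by simp
next
  fix z assume "z \<in> Omega_cochains"
  then obtain \<phi> g h where z: "z = (\<phi>, fmul g dx, fmul h dx)" "g \<in> A" "h \<in> A"
    unfolding Omega_cochains_def by blast
  fix c
  show "cscale c z \<in> Omega_cochains" unfolding z(1) cscale_fmul Omega_cochains_def using z
    by (auto intro!: exI regular_sc)
  show "Ver_cochain (cscale c z) = cscale (p_root c) (Ver_cochain z)"
    using z by (simp add: cscale_fmul Ver_cochain_fmul regular_sc cartier_coeff_sc)
next
  fix z w assume "z \<in> Omega_cochains" "w \<in> Omega_cochains"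
  then obtain \<phi> g h \<psi> g' h' where *: "z = (\<phi>, fmul g dx, fmul h dx)" "g \<in> A" "h \<in> A"
     "w = (\<psi>, fmul g' dx, fmul h' dx)" "g' \<in> A" "h' \<in> A" unfolding Omega_cochains_def by blast
  have zw: "z + w = (\<phi> + \<psi>, fmul (g + g') dx, fmul (h + h') dx)" by (simp add: * fmul_simps)
  thus "z + w \<in> Omega_cochains" unfolding Omega_cochains_def using * by (auto intro!: regular_add)
  show "Ver_cochain (z + w) = Ver_cochain z + Ver_cochain w"
    unfolding zw Ver_cochain_fmul[OF regular_add[OF *(2,5)] regular_add[OF *(3,6)]]
    using * by (simp add: Ver_cochain_fmul cartier_coeff_add fmul_simps(1))
qed

end

section \<open>Residues modulo powers of p and the weighted bit sum\<close>

lemma low_part_eq: "p > 0 \<Longrightarrow> low_part p h m = m mod p ^ h"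
proof (induction h)
  case (Suc h)
  have "m mod (p ^ h * p) = p ^ h * (m div p ^ h mod p) + m mod p ^ h" by (rule mod_mult2_eq)
  thus ?case using Suc by (simp add: low_part_def digit_def mult.commute)
qed (simp add: low_part_def)

lemma bval_le_1: "bval p i j h \<le> 1"
  by (simp add: bval_def)

text \<open>The part of T that depends on the bits before the last one. All its weights are even, so
  forms get odd indices and the f even ones.\<close>

definition S_index :: "nat \<Rightarrow> nat \<Rightarrow> nat \<times> nat \<Rightarrow> nat" where
  "S_index p n a = (\<Sum>h<n - 1. 2 ^ (n - 1 - h) * bval p (fst a) (snd a) h)"

lemma T_index_omega: "T_index n (omega_vec p n i j) = S_index p n (i, j) + 1"
  by (simp add: T_index_def omega_vec_def S_index_def)

lemma T_index_f: "T_index n (f_vec p n i j) = 2 ^ n - S_index p n (i, j)"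
  by (simp add: T_index_def f_vec_def S_index_def)

lemma sum_pow2: "(\<Sum>h<m. 2 ^ (m - h)) = (2 ^ (m + 1) - 2 :: nat)"
proof -
  have "(\<Sum>h<m. 2 ^ (m - h)) + 2 = (2 ^ (m + 1) :: nat)"
  proof (induction m)
    case (Suc m)
    have "(\<Sum>h<Suc m. 2 ^ (Suc m - h)) = (2 ^ Suc m + (\<Sum>h<m. 2 ^ (m - h)) :: nat)"
      by (subst sum.lessThan_Suc_shift) simp
    thus ?case using Suc by simp
  qed simp
  thus ?thesis by simp
qed

text \<open>Complementing x to q' - 1 complements its residue modulo every divisor P of q', and
  multiples of q' do not change this residue.\<close>

lemma div_mod_complement:
  assumes "(P :: nat) dvd q'" "x < q'"
  shows "(q' * k + (q' - 1 - x)) mod P = P - 1 - x mod P"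
proof -
  obtain s where s: "q' = P * s" using assms(1) by auto
  have P: "P > 0" using assms(2) s by (cases P) auto
  have "x div P < s" using assms(2) s by (simp add: less_mult_imp_div_less mult.commute)
  then obtain t where t: "s = x div P + Suc t" by (metis less_imp_Suc_add add_Suc_right)
  have "x mod P < P" using P by simp
  have "P * s = P * (x div P) + P * t + P" unfolding t by (simp add: algebra_simps)
  moreover have "x = P * (x div P) + x mod P" by simp
  ultimately have "q' - 1 - x = P * t + (P - 1 - x mod P)"
    using \<open>x mod P < P\<close> unfolding s by linarith
  hence "q' * k + (q' - 1 - x) = P * (s * k + t) + (P - 1 - x mod P)"
    unfolding s by (simp add: algebra_simps)
  thus ?thesis using P by simp
qed

context hermitian begin

section \<open>The index combinatorics\<close>

definition q' :: nat where "q' = p ^ (n - 1)"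

lemma q_eq: "q = p * q'"
  using n_pos unfolding q_def q'_def by (cases n) auto

lemma q'_pos: "q' > 0"
  using p_gt_1 by (simp add: q'_def)

text \<open>\<open>Delta q\<close> is split in two ways: by the sum of the lowest digits, where
  \<alpha> or \<beta> applies, and by the sum of the residues modulo q' = q/p, which characterises
  their images.\<close>

definition Dom1 :: "(nat \<times> nat) set" where
  "Dom1 = {(i, j). (i, j) \<in> Delta q \<and> p - 1 \<le> i mod p + j mod p}"
definition Dom2 :: "(nat \<times> nat) set" where
  "Dom2 = {(i, j). (i, j) \<in> Delta q \<and> i mod p + j mod p < p - 1}"
definition Im1 :: "(nat \<times> nat) set" where
  "Im1 = {(i, j). (i, j) \<in> Delta q \<and> i mod q' + j mod q' < q' - 1}"
definition Im2 :: "(nat \<times> nat) set" where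
  "Im2 = {(i, j). (i, j) \<in> Delta q \<and> q' - 1 \<le> i mod q' + j mod q'}"

text \<open>Both maps drop the lowest digit and put a new one on top. \<open>alpha\<close> gives the
  exponents of the Cartier image of x^i y^j dx. \<open>beta\<close> is the same formula at (q - 1 -
  i, q - 2 - j), the exponents in the first form attached to f.\<close>

definition alpha :: "nat \<times> nat \<Rightarrow> nat \<times> nat" where
  "alpha = (\<lambda>(i, j). (i div p + q' * (p - 1 - i mod p), j div p
      + q' * (i mod p + j mod p - (p - 1))))"
definition beta :: "nat \<times> nat \<Rightarrow> nat \<times> nat" where
  "beta = (\<lambda>(i, j). (q' * (i mod p) + (q' - 1 - i div p), q' * (p - 2 - i mod p - j mod p)
      + (q' - 1 - j div p)))"

definition alpha_inv :: "nat \<times> nat \<Rightarrow> nat \<times> nat" where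
  "alpha_inv = (\<lambda>(i, j). (p * (i mod q') + (p - 1 - i div q'), p * (j mod q')
      + (i div q' + j div q')))"
definition beta_inv :: "nat \<times> nat \<Rightarrow> nat \<times> nat" where
  "beta_inv = (\<lambda>(i, j). (p * (q' - 1 - i mod q') + i div q', p * (q' - 1 - j mod q')
      + (p - 2 - i div q' - j div q')))"

lemma Delta_iff: "(i, j) \<in> Delta q \<longleftrightarrow> i + j + 2 \<le> q"
  using q_gt_1 by (auto simp: Delta_def)

text \<open>This bound and the three that follow split i + j \<le> q - 2 into a condition on
  quotients. Where the sum of the remainders is large it uses up almost one more unit, which
  improves the bound by 1.\<close>

lemma Dom1_bound:
  assumes "(i, j) \<in> Dom1"
  shows "i div p + j div p + 2 \<le> q'"
proof -
  have 1: "i + j + 2 \<le> p * q'" "p - 1 \<le> i mod p + j mod p"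
    using assms unfolding q_eq[symmetric] by (auto simp: Dom1_def Delta_iff)
  have "p * (i div p) + i mod p = i" "p * (j div p) + j mod p = j" by simp_all
  hence "p * (i div p + j div p + 1) < p * q'" using 1 p_gt_1 unfolding distrib_left by linarith
  hence "i div p + j div p + 1 < q'" by (simp only: mult_less_cancel1)
  thus ?thesis by simp
qed

lemma Dom2_bound:
  assumes "(i, j) \<in> Dom2"
  shows "i div p + j div p + 1 \<le> q'"
proof -
  have 1: "i + j + 2 \<le> p * q'" using assms unfolding q_eq[symmetric]
    by (auto simp: Dom2_def Delta_iff)
  have "p * (i div p) + i mod p = i" "p * (j div p) + j mod p = j" by simp_all
  hence "p * (i div p + j div p) < p * q'" using 1 p_gt_1 unfolding distrib_left by linarith
  thus ?thesis by simp
qed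

lemma Im1_bound:
  assumes "(i, j) \<in> Im1"
  shows "i div q' + j div q' + 1 \<le> p"
proof -
  have 1: "i + j + 2 \<le> q' * p"
    using assms unfolding mult.commute[of q'] q_eq[symmetric] by (auto simp: Im1_def Delta_iff)
  have "q' * (i div q') + i mod q' = i" "q' * (j div q') + j mod q' = j" by simp_all
  hence "q' * (i div q' + j div q') < q' * p" using 1 unfolding distrib_left by linarith
  thus ?thesis by simp
qed

lemma Im2_bound:
  assumes "(i, j) \<in> Im2"
  shows "i div q' + j div q' + 2 \<le> p"
proof -
  have 1: "i + j + 2 \<le> q' * p" "q' - 1 \<le> i mod q' + j mod q'"
    using assms unfolding mult.commute[of q'] q_eq[symmetric] by (auto simp: Im2_def Delta_iff)
  have "q' * (i div q') + i mod q' = i" "q' * (j div q') + j mod q' = j" by simp_all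
  hence "q' * (i div q' + j div q' + 1) < q' * p" using 1 q'_pos unfolding distrib_left by linarith
  hence "i div q' + j div q' + 1 < p" by (simp only: mult_less_cancel1)
  thus ?thesis by simp
qed

lemma bij_alpha: "bij_betw alpha Dom1 Im1"
proof (rule bij_betw_byWitness[where f' = alpha_inv])
  show "\<forall>a\<in>Dom1. alpha_inv (alpha a) = a"
  proof clarify
    fix i j assume a: "(i, j) \<in> Dom1"
    have b: "i div p < q'" "j div p < q'" using Dom1_bound[OF a] by auto
    have m: "i mod p < p" "j mod p < p" using p_gt_1 by auto
    have c: "p - 1 \<le> i mod p + j mod p" using a by (auto simp: Dom1_def)
    have "p - 1 - (p - 1 - i mod p) = i mod p"
      "p - 1 - i mod p + (i mod p + j mod p - (p - 1)) = j mod p" using m c by linarith+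
    thus "alpha_inv (alpha (i, j)) = (i, j)"
      using b by (simp add: alpha_def alpha_inv_def)
  qed
  show "\<forall>a\<in>Im1. alpha (alpha_inv a) = a"
  proof clarify
    fix i j assume a: "(i, j) \<in> Im1"
    have b: "p - 1 - i div q' < p" "i div q' + j div q' < p" using Im1_bound[OF a] by auto
    have "p - 1 - (p - 1 - i div q') = i div q'"
        "p - 1 - i div q' + (i div q' + j div q') - (p - 1) = j div q'"
      using Im1_bound[OF a] by auto
    moreover have p0: "p \<noteq> 0" using p_gt_1 by auto
    ultimately show "alpha (alpha_inv (i, j)) = (i, j)"
      unfolding alpha_def alpha_inv_def prod.case
        using mod_mult_div_eq[of i q'] mod_mult_div_eq[of j q']
      by (simp only: mod_mult_self4 mod_less[OF b(1)] mod_less[OF b(2)]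
        div_mult_self4[OF p0] div_less[OF b(1)] div_less[OF b(2)] add_0_right)
  qed
  have "alpha (i, j) \<in> Im1" if a: "(i, j) \<in> Dom1" for i j
  proof -
    have b: "i div p + j div p + 2 \<le> q'" by (rule Dom1_bound[OF a])
    have m: "i mod p < p" "j mod p < p" using p_gt_1 by auto
    have c: "p - 1 \<le> i mod p + j mod p" using a by (auto simp: Dom1_def)
    \<comment> \<open>The two new top digits add up to j mod p, which keeps the pair inside
      \<open>Delta q\<close>.\<close>
    have "q' * (p - 1 - i mod p) + q' * (i mod p + j mod p - (p - 1)) = q' * (j mod p)"
      unfolding distrib_left[symmetric] using m c by (intro arg_cong[where f = "(*) q'"]) linarith
    moreover have "q' * (j mod p) \<le> q' * (p - 1)" using m by (intro mult_left_mono) auto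
    moreover have "q' * (p - 1) + q' = p * q'" using p_gt_1 by (cases p) auto
    ultimately have "alpha (i, j) \<in> Delta q"
      using b unfolding alpha_def prod.case Delta_iff unfolding q_eq by linarith
    thus ?thesis using b by (auto simp: Im1_def alpha_def)
  qed
  thus "alpha ` Dom1 \<subseteq> Im1" by auto
  have "alpha_inv (i, j) \<in> Dom1" if a: "(i, j) \<in> Im1" for i j
  proof -
    have b: "i div q' + j div q' + 1 \<le> p" by (rule Im1_bound[OF a])
    have c: "i mod q' + j mod q' + 2 \<le> q'" using a by (auto simp: Im1_def)
    have "p * (i mod q' + j mod q' + 2) \<le> p * q'" using c by (rule mult_le_mono2)
    hence "p * (i mod q') + p * (j mod q') + 2 * p \<le> p * q'" by (simp add: distrib_left)
    hence "alpha_inv (i, j) \<in> Delta q"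
      using b unfolding alpha_inv_def prod.case Delta_iff unfolding q_eq by linarith
    thus ?thesis
    proof -
      have "p - 1 - i div q' < p" "i div q' + j div q' < p" using b p_gt_1 by auto
      hence "(p * (i mod q') + (p - 1 - i div q')) mod p = p - 1 - i div q'"
        "(p * (j mod q') + (i div q' + j div q')) mod p = i div q' + j div q'"
        by (simp_all only: mod_mult_self4 mod_less)
      moreover have "p - 1 \<le> p - 1 - i div q' + (i div q' + j div q')" using b by linarith
      ultimately show ?thesis using \<open>_ \<in> Delta q\<close> unfolding Dom1_def alpha_inv_def by simp
    qed
  qed
  thus "alpha_inv ` Im1 \<subseteq> Dom1" by auto
qed

lemma bij_beta: "bij_betw beta Dom2 Im2"
proof (rule bij_betw_byWitness[where f' = beta_inv])
  show "\<forall>a\<in>Dom2. beta_inv (beta a) = a"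
  proof clarify
    fix i j assume a: "(i, j) \<in> Dom2"
    have b: "i div p < q'" "j div p < q'" using Dom2_bound[OF a] by auto
    have b': "q' - 1 - i div p < q'" "q' - 1 - j div p < q'" using q'_pos by auto
    have e: "q' - 1 - (q' - 1 - i div p) = i div p" "q' - 1 - (q' - 1 - j div p) = j div p"
      using b by auto
    have c: "i mod p + j mod p < p - 1" using a by (auto simp: Dom2_def)
    hence f: "p - 2 - i mod p - (p - 2 - i mod p - j mod p) = j mod p" by auto
    show "beta_inv (beta (i, j)) = (i, j)"
      unfolding beta_def beta_inv_def prod.case
        by (simp only: mod_mult_self4 mod_less[OF b'(1)] mod_less[OF b'(2)] e
        div_mult_self4[OF less_imp_neq[OF q'_pos, symmetric]] div_less[OF b'(1)]
            div_less[OF b'(2)] add_0_right f mult_div_mod_eq)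
  qed
  show "\<forall>a\<in>Im2. beta (beta_inv a) = a"
  proof clarify
    fix i j assume a: "(i, j) \<in> Im2"
    have b: "i div q' < p" "p - 2 - i div q' - j div q' < p" using Im2_bound[OF a] by auto
    have p0: "p \<noteq> 0" using p_gt_1 by auto
    have e: "q' - 1 - (q' - 1 - i mod q') = i mod q'" "q' - 1 - (q' - 1 - j mod q') = j mod q'"
      using mod_less_divisor[OF q'_pos, of i] mod_less_divisor[OF q'_pos, of j] by linarith+
    have f: "p - 2 - i div q' - (p - 2 - i div q' - j div q') = j div q'" using Im2_bound[OF a]
      by auto
    show "beta (beta_inv (i, j)) = (i, j)"
      unfolding beta_def beta_inv_def prod.case
        by (simp only: mod_mult_self4 mod_less[OF b(1)] mod_less[OF b(2)] e
        div_mult_self4[OF p0] div_less[OF b(1)] div_less[OF b(2)] add_0_right f mult_div_mod_eq)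
  qed
  have "beta (i, j) \<in> Im2" if a: "(i, j) \<in> Dom2" for i j
  proof -
    have b: "i div p + j div p + 1 \<le> q'" by (rule Dom2_bound[OF a])
    have c: "i mod p + j mod p + 2 \<le> p" using a by (auto simp: Dom2_def)
    have "i mod p + (p - 2 - i mod p - j mod p) + 2 \<le> p" using c by linarith
    from mult_le_mono2[OF this, of q']
    have "q' * (i mod p) + q' * (p - 2 - i mod p - j mod p) + 2 * q' \<le> p * q'"
      by (simp only: distrib_left mult.commute)
    moreover have "(q' - 1 - i div p) + (q' - 1 - j div p) + 2 \<le> 2 * q'" using b q'_pos by linarith
    ultimately have "beta (i, j) \<in> Delta q"
      unfolding beta_def prod.case Delta_iff unfolding q_eq by linarith
    moreover have "q' - 1 \<le> (q' - 1 - i div p) + (q' - 1 - j div p)" using b by linarith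
    ultimately show ?thesis using q'_pos by (auto simp: Im2_def beta_def)
  qed
  thus "beta ` Dom2 \<subseteq> Im2" by auto
  have "beta_inv (i, j) \<in> Dom2" if a: "(i, j) \<in> Im2" for i j
  proof -
    have b: "i div q' + j div q' + 2 \<le> p" by (rule Im2_bound[OF a])
    have c: "q' - 1 \<le> i mod q' + j mod q'" using a by (auto simp: Im2_def)
    have "q' - 1 - i mod q' + (q' - 1 - j mod q') + 1 \<le> q'"
      using c mod_less_divisor[OF q'_pos, of i] mod_less_divisor[OF q'_pos, of j] by linarith
    from mult_le_mono2[OF this, of p]
    have "p * (q' - 1 - i mod q') + p * (q' - 1 - j mod q') + p \<le> p * q'"
      by (simp add: distrib_left)
    hence "beta_inv (i, j) \<in> Delta q"
      using b unfolding beta_inv_def prod.case Delta_iff unfolding q_eq by linarith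
    thus ?thesis
    proof -
      have "i div q' < p" "p - 2 - i div q' - j div q' < p" using b by auto
      hence "(p * (q' - 1 - i mod q') + i div q') mod p = i div q'"
        "(p * (q' - 1 - j mod q') + (p - 2 - i div q' - j div q')) mod p
            = p - 2 - i div q' - j div q'"
        by (simp_all only: mod_mult_self4 mod_less)
      moreover have "i div q' + (p - 2 - i div q' - j div q') < p - 1" using b by linarith
      ultimately show ?thesis using \<open>_ \<in> Delta q\<close> unfolding Dom2_def beta_inv_def by simp
    qed
  qed
  thus "beta_inv ` Im2 \<subseteq> Dom2" by auto
qed

section \<open>How the bits change under the two bijections\<close>

lemma bval_eq: "bval p i j h = (if i mod p ^ (h + 1)
    + j mod p ^ (h + 1) < p ^ (h + 1) - 1 then 0 else 1)"
  using p_gt_1 by (simp add: bval_def low_part_eq)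

lemma bval_Suc:
  "bval p i j (h + 1) = (if p * (i div p mod p ^ (h + 1)) + p * (j div p mod p ^ (h + 1))
      + (i mod p + j mod p) < p * p ^ (h + 1) - 1 then 0 else 1)"
proof -
  have "k mod (p * p ^ (h + 1)) = p * (k div p mod p ^ (h + 1)) + k mod p" for k
    by (rule mod_mult2_eq)
  thus ?thesis by (simp add: bval_eq add_ac)
qed

text \<open>Dropping the lowest digit shifts the bits by one place. The comparison is unaffected
  because the sum of the dropped digits lies between p - 1 and 2p - 2.\<close>

lemma bval_alpha:
  assumes a: "(i, j) \<in> Dom1" and h: "h + 1 < n"
  shows "bval p (fst (alpha (i, j))) (snd (alpha (i, j))) h = bval p i j (h + 1)"
proof -
  define P where "P = p ^ (h + 1)"
  have P: "P > 0" using p_gt_1 by (simp add: P_def)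
  have "P dvd q'" unfolding P_def q'_def using h by (intro le_imp_power_dvd) auto
  then obtain s where s: "q' = P * s" by auto
  have mod: "(x + q' * k) mod P = x mod P" for x k unfolding s by (simp add: mult.assoc)
  define x y where "x = i div p mod P" and "y = j div p mod P"
  have c: "p - 1 \<le> i mod p + j mod p" "i mod p < p" "j mod p < p" using a p_gt_1
    by (auto simp: Dom1_def)
  have iff: "x + y < P - 1 \<longleftrightarrow> p * x + p * y + (i mod p + j mod p) < p * P - 1"
  proof
    assume "x + y < P - 1"
    hence "p * (x + y + 2) \<le> p * P" by (intro mult_le_mono2) auto
    hence "p * x + p * y + 2 * p \<le> p * P" by (simp add: distrib_left)
    thus "p * x + p * y + (i mod p + j mod p) < p * P - 1" using c by linarith
  next
    assume *: "p * x + p * y + (i mod p + j mod p) < p * P - 1"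
    show "x + y < P - 1"
    proof (rule ccontr)
      assume "\<not> x + y < P - 1"
      hence "p * P \<le> p * (x + y + 1)" by (intro mult_le_mono2) auto
      hence "p * P \<le> p * x + p * y + p" by (simp add: distrib_left)
      with * c(1) show False by linarith
    qed
  qed
  show ?thesis
    unfolding bval_Suc
      unfolding bval_eq P_def[symmetric]
          alpha_def prod.case fst_conv snd_conv mod x_def[symmetric] y_def[symmetric]
    by (simp only: iff)
qed

text \<open>Here the remaining digits are also complemented, which negates the bits; the sum of the
  dropped digits is at most p - 2, and this makes the two inequalities exactly
  complementary.\<close>

lemma bval_beta:
  assumes a: "(i, j) \<in> Dom2" and h: "h + 1 < n"
  shows "bval p (fst (beta (i, j))) (snd (beta (i, j))) h = 1 - bval p i j (h + 1)"
proof -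
  define P where "P = p ^ (h + 1)"
  have P: "P > 0" using p_gt_1 by (simp add: P_def)
  have Pr: "P dvd q'" unfolding P_def q'_def using h by (intro le_imp_power_dvd) auto
  have b: "i div p < q'" "j div p < q'" using Dom2_bound[OF a] by auto
  define x y where "x = i div p mod P" and "y = j div p mod P"
  have xy: "x < P" "y < P" using P by (auto simp: x_def y_def)
  have c: "i mod p + j mod p + 2 \<le> p" using a by (auto simp: Dom2_def)
  have iff: "(P - 1 - x) + (P - 1 - y) < P - 1 \<longleftrightarrow> \<not> p * x + p * y + (i mod p + j mod p) < p * P - 1"
  proof
    assume "(P - 1 - x) + (P - 1 - y) < P - 1"
    hence "p * P \<le> p * (x + y)" using xy by (intro mult_le_mono2) linarith
    thus "\<not> p * x + p * y + (i mod p + j mod p) < p * P - 1" by (simp add: distrib_left)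
  next
    assume *: "\<not> p * x + p * y + (i mod p + j mod p) < p * P - 1"
    show "(P - 1 - x) + (P - 1 - y) < P - 1"
    proof (rule ccontr)
      assume "\<not> (P - 1 - x) + (P - 1 - y) < P - 1"
      hence "p * (x + y + 1) \<le> p * P" using xy by (intro mult_le_mono2) linarith
      hence "p * x + p * y + p \<le> p * P" by (simp add: distrib_left)
      with * c show False by linarith
    qed
  qed
  show ?thesis
    unfolding bval_Suc unfolding bval_eq P_def[symmetric] beta_def prod.case fst_conv snd_conv
      div_mod_complement[OF Pr b(1)] div_mod_complement[OF Pr b(2)] x_def[symmetric]
          y_def[symmetric]
    by (simp only: iff) simp
qed

text \<open>The bit that the vectors overwrite in the last place would be 0. So doubling
  \<open>S_index\<close> is a pure shift of the bits, with bit 0 moving to weight 2^n.\<close>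

lemma bval_top: "(i, j) \<in> Delta q \<Longrightarrow> bval p i j (n - 1) = 0"
proof -
  assume "(i, j) \<in> Delta q"
  hence *: "i + j + 2 \<le> p ^ n" by (simp add: Delta_iff flip: q_def)
  have "n - 1 + 1 = n" using n_pos by simp
  thus ?thesis using * by (simp add: bval_eq)
qed

lemma bval_0: "(i, j) \<in> Dom1 \<Longrightarrow> bval p i j 0 = 1" "(i, j) \<in> Dom2 \<Longrightarrow> bval p i j 0 = 0"
  by (auto simp: bval_eq Dom1_def Dom2_def)

lemma double_S_index:
  assumes "(i, j) \<in> Delta q"
  shows "2 * S_index p n (i, j) = 2 ^ n * bval p i j 0
      + (\<Sum>h<n - 1. 2 ^ (n - 1 - h) * bval p i j (h + 1))"
proof -
  obtain m where m: "n = Suc m" using n_pos by (cases n) auto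
  have "(\<Sum>h<Suc m. 2 ^ (Suc m - h) * bval p i j h) = 2 ^ Suc m * bval p i j 0
      + (\<Sum>h<m. 2 ^ (m - h) * bval p i j (h + 1))"
    by (subst sum.lessThan_Suc_shift) simp
  moreover have "(\<Sum>h<Suc m. 2 ^ (Suc m - h) * bval p i j h)
      = (\<Sum>h<m. 2 * (2 ^ (m - h) * bval p i j h))"
  proof -
    have "bval p i j m = 0" using bval_top[OF assms] by (simp add: m)
    thus ?thesis by (simp add: Suc_diff_le mult.assoc)
  qed
  ultimately show ?thesis by (simp add: S_index_def m sum_distrib_left)
qed

text \<open>On \<open>Dom1\<close> bit 0 is 1, so the shift pushes out exactly 2^n.\<close>

lemma S_index_alpha: "a \<in> Dom1 \<Longrightarrow> S_index p n (alpha a) + 2 ^ n = 2 * S_index p n a"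
proof -
  assume a: "a \<in> Dom1"
  obtain i j where ij: "a = (i, j)" by (cases a)
  have "S_index p n (alpha a) = (\<Sum>h<n - 1. 2 ^ (n - 1 - h) * bval p i j (h + 1))"
    unfolding S_index_def ij using a ij by (intro sum.cong) (auto simp: bval_alpha)
  thus ?thesis using double_S_index[of i j] a bval_0(1)[of i j] ij by (auto simp: Dom1_def)
qed

text \<open>On \<open>Dom2\<close> bit 0 is 0 and the shifted bits are negated; the constant 2^n - 2
  is the sum of all weights.\<close>

lemma S_index_beta: "a \<in> Dom2 \<Longrightarrow> S_index p n (beta a) + 2 * S_index p n a + 2 = 2 ^ n"
proof -
  assume a: "a \<in> Dom2"
  obtain i j where ij: "a = (i, j)" by (cases a)
  have "S_index p n (beta a) = (\<Sum>h<n - 1. 2 ^ (n - 1 - h) * (1 - bval p i j (h + 1)))"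
    unfolding S_index_def ij using a ij by (intro sum.cong) (auto simp: bval_beta)
  moreover have "2 * S_index p n a = (\<Sum>h<n - 1. 2 ^ (n - 1 - h) * bval p i j (h + 1))"
    using double_S_index[of i j] a bval_0(2)[of i j] ij by (auto simp: Dom2_def)
  moreover have "(\<Sum>h<n - 1. 2 ^ (n - 1 - h) * (1 - bval p i j (h + 1)))
      + (\<Sum>h<n - 1. 2 ^ (n - 1 - h) * bval p i j (h + 1))
      = (\<Sum>h<n - 1. 2 ^ (n - 1 - h))"
    unfolding sum.distrib[symmetric] distrib_left[symmetric]
      by (intro sum.cong refl) (simp add: bval_def)
  moreover have "(2 :: nat) ^ n \<ge> 2" using n_pos by (cases n) auto
  ultimately show ?thesis using sum_pow2[of "n - 1"] n_pos by simp
qed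

lemma Dom_cases: "a \<in> Delta q \<longleftrightarrow> a \<in> Dom1 \<or> a \<in> Dom2"
  and Im_cases: "a \<in> Delta q \<longleftrightarrow> a \<in> Im1 \<or> a \<in> Im2"
  by (cases a; auto simp: Dom1_def Dom2_def Im1_def Im2_def)+

lemma even_S_index: "even (S_index p n a)"
  unfolding S_index_def by (intro dvd_sum) auto

lemma S_index_Dom1: "a \<in> Dom1 \<Longrightarrow> 2 ^ n \<le> 2 * S_index p n a"
  using S_index_alpha[of a] by linarith

lemma S_index_Dom2: "a \<in> Dom2 \<Longrightarrow> 2 * S_index p n a + 2 \<le> 2 ^ n"
  using S_index_beta[of a] by linarith

text \<open>An element of \<open>Im1\<close> is some \<alpha> b, and S(\<alpha> b) + 2^n is twice an
  even number. The next lemma gives the other residue modulo 4 for \<open>Im2\<close>, so S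
  separates the two images.\<close>

lemma S_index_Im1: "a \<in> Im1 \<Longrightarrow> 4 dvd S_index p n a + 2 ^ n"
proof -
  assume "a \<in> Im1"
  then obtain b where b: "b \<in> Dom1" "a = alpha b" using bij_alpha unfolding bij_betw_def by blast
  show ?thesis unfolding b(2) S_index_alpha[OF b(1)] using even_S_index[of b] by auto
qed

lemma S_index_Im2: "a \<in> Im2 \<Longrightarrow> 4 dvd S_index p n a + 2 ^ n + 2"
proof -
  assume "a \<in> Im2"
  then obtain b where b: "b \<in> Dom2" "a = beta b" using bij_beta unfolding bij_betw_def by blast
  obtain m where m: "n = Suc m" using n_pos by (cases n) auto
  obtain k where k: "S_index p n b = 2 * k" using even_S_index[of b] by auto
  have "S_index p n a + 2 ^ n + 2 + 4 * k = 4 * 2 ^ m"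
    using S_index_beta[OF b(1)] unfolding b(2) k by (simp add: m)
  thus ?thesis by (metis dvd_add_left_iff dvd_triv_left)
qed

lemma S_index_less: "a \<in> Delta q \<Longrightarrow> S_index p n a < 2 ^ n"
proof -
  have "S_index p n a \<le> (\<Sum>h<n - 1. 2 ^ (n - 1 - h))"
    unfolding S_index_def using bval_le_1 by (intro sum_mono) auto
  also have "\<dots> < 2 ^ n" using sum_pow2[of "n - 1"] n_pos by simp
  finally show ?thesis .
qed

end

text \<open>Subtracting from p q' - 1, all of whose digits are maximal, needs no borrow: quotient
  and remainder are complemented separately.\<close>

lemma complement_div_mod:
  fixes q' p :: nat
  assumes "x < p * q'"
  shows "p * q' - 1 - x = p * (q' - 1 - x div p) + (p - 1 - x mod p)" "x div p < q'"
proof -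
  have p: "p > 0" using assms by (cases p) auto
  have "x div p < q'" using assms by (simp add: less_mult_imp_div_less mult.commute)
  then obtain t where t: "q' = x div p + Suc t" by (metis less_imp_Suc_add add_Suc_right)
  have "x mod p < p" using p by simp
  moreover have "p * q' = p * (x div p) + p * t + p" by (subst t) (simp add: algebra_simps)
  moreover have "x = p * (x div p) + x mod p" by simp
  moreover have "q' - 1 - x div p = t" using t by simp
  ultimately show "p * q' - 1 - x = p * (q' - 1 - x div p) + (p - 1 - x mod p)" by (simp only:)
  show "x div p < q'" by fact
qed

lemma bij_betw_Collect:
  assumes "bij_betw f A B" "\<And>a. a \<in> A \<Longrightarrow> P a \<longleftrightarrow> Q (f a)"
  shows "bij_betw f {a \<in> A. P a} {b \<in> B. Q b}"
  using assms unfolding bij_betw_def inj_on_def by blast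

context hermitian begin

section \<open>The action of Verschiebung on the basis\<close>

definition omega_cochain :: "nat \<times> nat \<Rightarrow> 'k cochain" where
  "omega_cochain = (\<lambda>(i, j). (0, fmul (mon (int i) j) dx, fmul (mon (int i) j) dx))"

definition f_coeff1 :: "nat \<Rightarrow> nat \<Rightarrow> 'k rfun" where
  "f_coeff1 i j = sc (- of_nat (j + 1)) (mon (int q - int i - 1) (q - j - 2))"

definition f_coeff2 :: "nat \<Rightarrow> nat \<Rightarrow> 'k rfun" where
  "f_coeff2 i j = sc (of_nat (i + 1)) (mon (- int i - 2) (q - j - 1))"

definition f_cochain :: "nat \<times> nat \<Rightarrow> 'k cochain" where
  "f_cochain = (\<lambda>(i, j). (mon (- int (i + 1)) (q - 1 - j), fmul (f_coeff1 i j) dx,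
      fmul (f_coeff2 i j) dx))"

lemma f_coeff_in_A: "f_coeff1 i j \<in> A" "f_coeff2 i j \<in> A"
  by (simp_all add: f_coeff1_def f_coeff2_def regular_sc mon_regular)

lemma fx_apply: "P \<in> U12 q \<Longrightarrow> fx q P = xc P" and fy_apply: "P \<in> U12 q \<Longrightarrow> fy q P = yc P"
  for P :: "'k pt"
  by (simp_all add: fx_eq fy_eq mon_def)

lemma omega_class_eq: "omega_class q i j = cl (omega_cochain (i, j))"
proof -
  have "fmul (fx q ^ i * fy q ^ j) dx = fmul (mon (int i) j) dx"
    by (rule fmul_cong) (simp add: fun_simps fx_apply fy_apply mon_def)
  thus ?thesis by (simp add: omega_class_def omega_cochain_def Let_def)
qed

lemma f_class_eq:
  assumes "(i, j) \<in> Delta q"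
  shows "f_class q i j = cl (f_cochain (i, j))"
proof -
  have ij: "i + j + 2 \<le> q" using assms by (simp add: Delta_iff)
  have f: "f_fun q i j = mon (- int (i + 1)) (q - 1 - j)"
  proof
    fix P
    show "f_fun q i j P = mon (- int (i + 1)) (q - 1 - j) P"
    proof (cases "P \<in> U12 q")
      case True
      have "q - 1 = (q - 1 - j) + j" using ij by simp
      hence "yc P ^ (q - 1) = yc P ^ (q - 1 - j) * yc P ^ j" by (metis power_add)
      moreover have "xc P powi (- int (i + 1)) = inverse (xc P ^ (i + 1))"
        by (simp only: power_int_minus power_int_of_nat)
      ultimately show ?thesis using True U12_coords(1,3)[OF True]
        by (simp add: f_fun_def fx_apply fy_apply mon_def field_simps)
    qed (simp add: f_fun_def mon_outside fx_eq)
  qed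
  have e1: "f_eta1 q i j = fmul (f_coeff1 i j) dx"
    unfolding f_eta1_def
  proof (rule fmul_cong)
    fix P :: "'k pt" assume P: "P \<in> U12 q"
    have "int q - int i - 1 = int (q - i - 1)" using ij by auto
    hence "xc P powi (int q - int i - 1) = xc P ^ (q - i - 1)" by (simp only: power_int_of_nat)
    thus "- of_nat (j + 1) * fy q P ^ (q - j - 2) * fx q P ^ (q - i - 1) = f_coeff1 i j P"
      using P by (simp add: fx_apply fy_apply f_coeff1_def fun_simps mon_def)
  qed
  have e2: "f_eta2 q i j = fmul (f_coeff2 i j) dx"
    unfolding f_eta2_def
  proof (rule fmul_cong)
    fix P :: "'k pt" assume P: "P \<in> U12 q"
    have "- int i - 2 = - int (i + 2)" by simp
    hence "xc P powi (- int i - 2) = inverse (xc P ^ (i + 2))"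
      by (simp only: power_int_minus power_int_of_nat)
    thus "of_nat (i + 1) * fy q P ^ (q - j - 1) / fx q P ^ (i + 2) = f_coeff2 i j P"
      using P by (simp add: fx_apply fy_apply f_coeff2_def fun_simps mon_def divide_inverse)
  qed
  show ?thesis by (simp add: f_class_def f e1 e2 f_cochain_def)
qed

text \<open>This is the cocycle condition for the f; it rests on q - 1 - j = - (j + 1) in k.\<close>

lemma D0_f:
  assumes "(i, j) \<in> Delta q"
  shows "D0 (mon (- int (i + 1)) (q - 1 - j)) = f_coeff1 i j - f_coeff2 i j"
proof -
  have ij: "i + j + 2 \<le> q" using assms by (simp add: Delta_iff)
  have "(of_nat (q - 1 - j) :: 'k) + of_nat (j + 1) = of_nat q"
    using ij by (simp only: of_nat_add[symmetric]) simp
  hence c: "(of_nat (q - 1 - j) :: 'k) = - of_nat (j + 1)"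
    by (simp only: eq_neg_iff_add_eq_0 of_nat_q)
  have e: "- int (i + 1) - 1 = - int i - 2" "- int (i + 1) + int q = int q - int i - 1"
    "q - 1 - j - 1 = q - j - 2" "q - 1 - j = q - j - 1" by auto
  have i: "(of_int (- int (i + 1)) :: 'k) = - of_nat (i + 1)" by simp
  show ?thesis unfolding D0_mon dmon_def c i
    unfolding e f_coeff1_def f_coeff2_def vs.scale_minus_left by simp
qed

lemma p_root_eq_0_iff: "p_root c = 0 \<longleftrightarrow> c = 0"
proof
  assume "p_root c = 0"
  hence "p_root c ^ p = 0" using p_gt_1 by simp
  thus "c = 0" by simp
qed simp

definition low_coeff :: "nat \<Rightarrow> nat \<Rightarrow> 'k" where
    "low_coeff s l = of_nat (s choose l) * (- 1) ^ (s - l)"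

lemma of_nat_power_p: "(of_nat m :: 'k) ^ p = of_nat m"
  by (induction m) (use p_gt_1 in \<open>simp_all add: frobenius_add\<close>)

text \<open>The coefficient lies in the prime field, which Frobenius fixes.\<close>

lemma p_root_low_coeff: "p_root (low_coeff s l) = low_coeff s l"
proof -
  have "((- 1 :: 'k) ^ k) ^ p = (- 1) ^ k" for k
    by (simp add: power_mult[symmetric] mult.commute[of k]) (simp add: power_mult frobenius_minus)
  hence "low_coeff s l ^ p = low_coeff s l"
    by (simp add: low_coeff_def power_mult_distrib of_nat_power_p)
  thus ?thesis by (metis power_p_root)
qed

lemma binomial_nonzero:
  assumes "l \<le> s" "s < p"
  shows "(of_nat (s choose l) :: 'k) \<noteq> 0"
proof
  assume "(of_nat (s choose l) :: 'k) = 0"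
  moreover have "(of_nat (fact l * fact (s - l) * (s choose l)) :: 'k) = of_nat (fact s)"
    by (simp only: binomial_fact_lemma[OF assms(1)])
  ultimately show False using fact_nonzero[OF assms(2)] by simp
qed

lemma low_coeff_nonzero: "l \<le> s \<Longrightarrow> s < p \<Longrightarrow> low_coeff s l \<noteq> 0"
  by (simp add: low_coeff_def binomial_nonzero)

lemma cartier_coeff_zero [simp]: "cartier_coeff 0 = 0"
  by (simp add: cartier_coeff_def D0_pow_linear fun_eq_iff fun_simps)

lemma cartier_coeff_sum: "cartier_coeff (\<Sum>i\<in>I. f i) = (\<Sum>i\<in>I. cartier_coeff (f i))"
  by (induction I rule: infinite_finite_induct) (simp_all add: cartier_coeff_add)

lemma cartier_coeff_mon_p: "cartier_coeff (mon (int a) (p * b))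
    = (if a mod p = p - 1 then mon (int (a div p)) b else 0)"
proof -
  have "int a = int (a mod p) + int p * int (a div p)" by (simp flip: of_nat_mult of_nat_add)
  thus ?thesis using cartier_coeff_mon[of "a mod p" "int (a div p)" b] p_gt_1 by simp
qed

text \<open>\<open>y = x ^ (q + 1) - y ^ q\<close> makes all exponents of \<open>y\<close> divisible by \<open>p\<close>.\<close>

lemma mon_expand_p:
  "mon (int a) b = (\<Sum>l\<le>b mod p. sc (low_coeff (b mod p) l)
     (mon (int (a + (q + 1) * l)) (p * (b div p + q' * (b mod p - l)))))"
proof
  fix P
  show "mon (int a) b P = (\<Sum>l\<le>b mod p. sc (low_coeff (b mod p) l)
     (mon (int (a + (q + 1) * l)) (p * (b div p + q' * (b mod p - l))))) P"
  proof (cases "P \<in> U12 q")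
    case True
    define x y where "x = xc P" and "y = yc P"
    have y: "y = x ^ (q + 1) + - (y ^ q)" using U12_coords(2)[OF True] by (simp add: x_def y_def)
    \<comment> \<open>Only the b mod p leftover factors y are rewritten; the rest is already a p-th
      power.\<close>
    have "b = p * (b div p) + b mod p" by simp
    hence "y ^ b = y ^ (p * (b div p)) * y ^ (b mod p)" by (metis power_add)
    also have "y ^ (b mod p) = (x ^ (q + 1) + - (y ^ q)) ^ (b mod p)" using y by simp
    also have "\<dots> = (\<Sum>l\<le>b mod p. of_nat (b mod p choose l) * (x ^ (q + 1)) ^ l * (- (y ^ q)) ^
        (b mod p - l))"
      by (rule binomial_ring)
    finally have yb: "y ^ b = (\<Sum>l\<le>b mod p. y ^ (p * (b div p)) *
        (of_nat (b mod p choose l) * (x ^ (q + 1)) ^ l * (- (y ^ q)) ^ (b mod p - l)))"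
      by (simp only: sum_distrib_left)
    have t: "x ^ a * (y ^ (p * (b div p)) *
        (of_nat (b mod p choose l) * (x ^ (q + 1)) ^ l * (- (y ^ q)) ^ (b mod p - l)))
      = low_coeff (b mod p) l * (x ^ (a + (q + 1) * l) * y ^
          (p * (b div p + q' * (b mod p - l))))" for l
    proof -
      have "p * (b div p + q' * (b mod p - l)) = p * (b div p) + q * (b mod p - l)"
        unfolding q_eq by (simp add: algebra_simps)
      hence "y ^ (p * (b div p + q' * (b mod p - l)))
          = y ^ (p * (b div p)) * (y ^ q) ^ (b mod p - l)"
        by (simp only: power_add power_mult)
      moreover have "(- (y ^ q)) ^ (b mod p - l) = (- 1) ^ (b mod p - l) * (y ^ q) ^ (b mod p - l)"
        by (rule power_minus)
      moreover have "x ^ (a + (q + 1) * l) = x ^ a * (x ^ (q + 1)) ^ l"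
        by (simp only: power_add power_mult)
      ultimately show ?thesis by (simp only: low_coeff_def mult_ac)
    qed
    have "mon (int a) b P = x ^ a * y ^ b" using True by (simp add: mon_def x_def y_def)
    also have "\<dots> = (\<Sum>l\<le>b mod p. low_coeff (b mod p) l *
        (x ^ (a + (q + 1) * l) * y ^ (p * (b div p + q' * (b mod p - l)))))"
      unfolding yb sum_distrib_left by (intro sum.cong refl t)
    also have "\<dots> = (\<Sum>l\<le>b mod p. sc (low_coeff (b mod p) l)
        (mon (int (a + (q + 1) * l)) (p * (b div p + q' * (b mod p - l))))) P"
      using True by (simp only: fun_simps mon_def x_def y_def power_int_of_nat if_True)
    finally show ?thesis .
  qed (simp add: fun_simps mon_outside)
qed

text \<open>Since p divides q, the exponent of x in the l-th term of \<open>mon_expand_p\<close> is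
  a + l modulo p. The Cartier operator keeps only exponents congruent to p - 1, so l = p - 1 - a mod
  p is the single surviving index, present when it does not exceed b mod p.\<close>

lemma cartier_coeff_mon_nat:
  "cartier_coeff (mon (int a) b) = (if a mod p + b mod p < p - 1 then 0
     else sc (low_coeff (b mod p) (p - 1 - a mod p))
       (mon (int (a div p + q' * (p - 1 - a mod p))) (b div p
           + q' * (b mod p - (p - 1 - a mod p)))))"
proof -
  define k where "k = p - 1 - a mod p"
  have a: "a mod p < p" and b: "b mod p < p" using p_gt_1 by auto
  let ?m = "\<lambda>l. sc (low_coeff (b mod p) l)
      (mon (int (a div p + q' * l)) (b div p + q' * (b mod p - l)))"
  have t: "cartier_coeff (sc (low_coeff (b mod p) l)
      (mon (int (a + (q + 1) * l)) (p * (b div p + q' * (b mod p - l)))))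
      = (if l = k then ?m l else 0)" if "l \<le> b mod p" for l
  proof -
    have eq: "a + (q + 1) * l = (a mod p + l) + p * (a div p + q' * l)"
      unfolding q_eq by (simp add: algebra_simps)
    have "(a + (q + 1) * l) mod p = (a mod p + l) mod p" unfolding eq by simp
    moreover have "(a mod p + l) mod p = p - 1 \<longleftrightarrow> l = k"
    proof
      assume *: "(a mod p + l) mod p = p - 1"
      show "l = k"
      proof (cases "a mod p + l < p")
        case True
        thus ?thesis using * by (simp add: k_def)
      next
        \<comment> \<open>A wrap past p would need a mod p + l = 2p - 1, but both summands are at
          most p - 1.\<close>
        case False
        hence "(a mod p + l) mod p = (a mod p + l - p) mod p" by (intro le_mod_geq) simp
        also have "\<dots> = a mod p + l - p" using that a b by (intro mod_less) linarith
        finally have "(a mod p + l) mod p = a mod p + l - p" .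
        hence False using * that a b p_gt_1 by linarith
        thus ?thesis ..
      qed
    next
      assume "l = k"
      hence "a mod p + l = p - 1" using a by (simp add: k_def)
      thus "(a mod p + l) mod p = p - 1" using a by simp
    qed
    moreover have "(a + (q + 1) * k) div p = a div p + q' * k"
    proof -
      have "a + (q + 1) * k = (p - 1) + p * (a div p + q' * k)"
      proof -
        have "a mod p + k = p - 1" using a by (simp add: k_def)
        moreover have "a + (q + 1) * k = (a mod p + k) + p * (a div p + q' * k)"
          unfolding q_eq by (simp add: algebra_simps)
        ultimately show ?thesis by simp
      qed
      moreover have p0: "p \<noteq> 0" and "(p - 1) div p = 0" using p_gt_1 by auto
      ultimately show ?thesis by (simp only: div_mult_self2[OF p0] add_0_right)
    qed
    ultimately show ?thesis unfolding cartier_coeff_sc p_root_low_coeff cartier_coeff_mon_p by auto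
  qed
  have "cartier_coeff (mon (int a) b) = (\<Sum>l\<le>b mod p. if l = k then ?m l else 0)"
    by (subst mon_expand_p) (simp only: cartier_coeff_sum, intro sum.cong refl, rule t, simp)
  also have "\<dots> = (if k \<le> b mod p then ?m k else 0)" by simp
  also have "\<dots> = (if a mod p + b mod p < p - 1 then 0 else ?m k)" using a by (auto simp: k_def)
  finally show ?thesis by (simp only: k_def)
qed

lemma cscale_omega_cochain: "cscale c (omega_cochain (i, j))
    = (0, fmul (sc c (mon (int i) j)) dx, fmul (sc c (mon (int i) j)) dx)"
  by (simp add: omega_cochain_def cscale_fmul)

lemma Ver_cochain_omega_cochain: "Ver_cochain (omega_cochain (i, j))
    = (0, fmul (cartier_coeff (mon (int i) j)) dx, fmul (cartier_coeff (mon (int i) j)) dx)"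
  by (simp add: omega_cochain_def Ver_cochain_fmul mon_regular)

lemma Ver_cochain_omega_cochain_Dom1: "a \<in> Dom1 \<Longrightarrow> \<exists>u. u \<noteq> 0 \<and> Ver_cochain (omega_cochain a)
    = cscale u (omega_cochain (alpha a))"
proof -
  assume a: "a \<in> Dom1"
  obtain i j where ij: "a = (i, j)" by (cases a)
  have 1: "p - 1 \<le> i mod p + j mod p" using a by (simp add: Dom1_def ij)
  have 2: "i mod p < p" "j mod p < p" using p_gt_1 by auto
  define u where "u = low_coeff (j mod p) (p - 1 - i mod p)"
  have "j mod p - (p - 1 - i mod p) = i mod p + j mod p - (p - 1)" using 1 2 by linarith
  hence "cartier_coeff (mon (int i) j) = sc u (mon (int (fst (alpha a))) (snd (alpha a)))"
    using 1 by (simp add: cartier_coeff_mon_nat u_def alpha_def ij)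
  hence "Ver_cochain (omega_cochain a) = cscale u (omega_cochain (alpha a))"
    unfolding ij Ver_cochain_omega_cochain using cscale_omega_cochain[of u "fst (alpha a)"
        "snd (alpha a)"] ij by simp
  moreover have "u \<noteq> 0" unfolding u_def using 1 2 by (intro low_coeff_nonzero) auto
  ultimately show ?thesis by blast
qed

lemma Ver_cochain_omega_cochain_Dom2: "a \<in> Dom2 \<Longrightarrow> Ver_cochain (omega_cochain a) = 0"
  by (cases a) (simp add: Dom2_def Ver_cochain_omega_cochain cartier_coeff_mon_nat fmul_simps
      zero_prod_def)

text \<open>The two forms of the cochain differ by an exact one, so the Cartier operator sends them
  to the same form and the result has the shape of a class \<omega>.\<close>

lemma Ver_cochain_f_cochain:
  assumes "(i, j) \<in> Delta q"
  shows "Ver_cochain (f_cochain (i, j)) =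
      (0, fmul (cartier_coeff (f_coeff1 i j)) dx, fmul (cartier_coeff (f_coeff1 i j)) dx)"
proof -
  have "f_coeff1 i j = D0 (mon (- int (i + 1)) (q - 1 - j)) + f_coeff2 i j" using D0_f[OF assms]
    by simp
  hence "cartier_coeff (f_coeff1 i j) = cartier_coeff (f_coeff2 i j)"
    by (simp only: cartier_coeff_add cartier_coeff_D0[OF mon_regular] add_0_left)
  thus ?thesis by (simp add: f_cochain_def Ver_cochain_fmul f_coeff_in_A)
qed

lemma cartier_coeff_f_coeff1:
  assumes "(i, j) \<in> Delta q"
  shows "cartier_coeff (f_coeff1 i j) = sc (p_root (- of_nat (j + 1)))
      (cartier_coeff (mon (int (q - 1 - i)) (q - 1 - (j + 1))))"
proof -
  have "int q - int i - 1 = int (q - 1 - i)" "q - j - 2 = q - 1 - (j + 1)"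
    using assms by (auto simp: Delta_iff)
  thus ?thesis by (simp only: f_coeff1_def cartier_coeff_sc)
qed

text \<open>Provides quotients and remainders of the exponents q - 1 - i and q - 2 - j. The case j
  mod p = p - 1 is set aside because passing from j to j + 1 then produces a carry.\<close>

lemma Delta_complement:
  assumes "(i, j) \<in> Delta q"
  shows "(q - 1 - i) div p = q' - 1 - i div p" "(q - 1 - i) mod p = p - 1 - i mod p" "i div p < q'"
    "j mod p \<noteq> p - 1 \<Longrightarrow> (q - 1 - (j + 1)) div p = q' - 1 - j div p"
    "j mod p \<noteq> p - 1 \<Longrightarrow> (q - 1 - (j + 1)) mod p = p - 2 - j mod p" "j div p < q'"
proof -
  have i: "i < p * q'" "j + 1 < p * q'" "j < p * q'" using assms unfolding q_eq[symmetric]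
    by (auto simp: Delta_iff)
  have m: "p - 1 - x < p" for x using p_gt_1 by simp
  have gen: "(q - 1 - x) div p = q' - 1 - x div p" "(q - 1 - x) mod p = p - 1 - x mod p"
      if "x < p * q'" for x
    unfolding q_eq complement_div_mod(1)[OF that] using m[of "x mod p"] p_gt_1 by simp_all
  show "(q - 1 - i) div p = q' - 1 - i div p" "(q - 1 - i) mod p = p - 1 - i mod p"
    using gen[OF i(1)] by simp_all
  show "i div p < q'" "j div p < q'" using complement_div_mod(2) i by blast+
  assume "j mod p \<noteq> p - 1"
  hence "(j + 1) div p = j div p" "(j + 1) mod p = j mod p + 1"
    using p_gt_1 by (auto simp: div_Suc mod_Suc)
  thus "(q - 1 - (j + 1)) div p = q' - 1 - j div p" "(q - 1 - (j + 1)) mod p = p - 2 - j mod p"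
    using gen[OF i(2)] by simp_all
qed

lemma of_nat_eq_0_mod: "(of_nat m :: 'k) = 0 \<longleftrightarrow> m mod p = 0"
  using of_nat_eq_0_iff_char_dvd[of m, where ?'a = 'k] char_k by (auto simp: dvd_eq_mod_eq_0)

text \<open>Complementing turns the sum s of the lowest digits into 2p - 3 - s, which is at least p
  - 1 exactly when s < p - 1. The extra factor j + 1 is nonzero because j mod p is not p -
  1.\<close>

lemma Ver_cochain_f_cochain_Dom2: "a \<in> Dom2 \<Longrightarrow> \<exists>u. u \<noteq> 0 \<and> Ver_cochain (f_cochain a)
    = cscale u (omega_cochain (beta a))"
proof -
  assume a: "a \<in> Dom2"
  obtain i j where ij: "a = (i, j)" by (cases a)
  have D: "(i, j) \<in> Delta q" and 1: "i mod p + j mod p < p - 1" using a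
    by (simp_all add: Dom2_def ij)
  have 2: "i mod p < p" using p_gt_1 by auto
  have j: "j mod p \<noteq> p - 1" using 1 by auto
  note c = Delta_complement[OF D] 
  note d = c(4)[OF j] c(5)[OF j]
  define v where "v = low_coeff (p - 2 - j mod p) (i mod p)"
  define u where "u = p_root (- of_nat (j + 1)) * v"
  have e: "p - 1 - (p - 1 - i mod p) = i mod p" using 2 by linarith
  have ge: "\<not> p - 1 - i mod p + (p - 2 - j mod p) < p - 1" using 1 by linarith
  have f: "p - 2 - j mod p - i mod p = p - 2 - i mod p - j mod p" by simp
  have "cartier_coeff (mon (int (q - 1 - i)) (q - 1 - (j + 1)))
      = sc v (mon (int (fst (beta a))) (snd (beta a)))"
    unfolding cartier_coeff_mon_nat c(1,2) d e f if_not_P[OF ge]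
        v_def beta_def ij prod.case fst_conv snd_conv
    by (simp add: add.commute)
  hence "cartier_coeff (f_coeff1 i j) = sc u (mon (int (fst (beta a))) (snd (beta a)))"
    unfolding cartier_coeff_f_coeff1[OF D] u_def by simp
  hence "Ver_cochain (f_cochain a) = cscale u (omega_cochain (beta a))"
    unfolding ij Ver_cochain_f_cochain[OF D] using cscale_omega_cochain[of u "fst (beta a)"
        "snd (beta a)"] ij by simp
  moreover have "u \<noteq> 0"
  proof -
    have "(j + 1) mod p \<noteq> 0" using j p_gt_1 by (auto simp: mod_Suc)
    hence "- (of_nat (j + 1) :: 'k) \<noteq> 0"
      by (simp only: neg_equal_0_iff_equal of_nat_eq_0_mod not_False_eq_True)
    hence "p_root (- of_nat (j + 1)) \<noteq> 0" by (simp only: p_root_eq_0_iff not_False_eq_True)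
    moreover have "v \<noteq> 0" unfolding v_def using 1 by (intro low_coeff_nonzero) auto
    ultimately show ?thesis by (simp add: u_def)
  qed
  ultimately show ?thesis by blast
qed

text \<open>If j mod p = p - 1, the coefficient j + 1 is zero in k; otherwise the complemented
  digits have too small a sum for any term to survive.\<close>

lemma Ver_cochain_f_cochain_Dom1: "a \<in> Dom1 \<Longrightarrow> Ver_cochain (f_cochain a) = 0"
proof -
  assume a: "a \<in> Dom1"
  obtain i j where ij: "a = (i, j)" by (cases a)
  have D: "(i, j) \<in> Delta q" and 1: "p - 1 \<le> i mod p + j mod p" using a
    by (simp_all add: Dom1_def ij)
  have 2: "i mod p < p" "j mod p < p" using p_gt_1 by auto
  have "cartier_coeff (f_coeff1 i j) = 0"
  proof (cases "j mod p = p - 1")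
    case True
    hence "(j + 1) mod p = 0" using p_gt_1 by (simp add: mod_Suc)
    hence "(of_nat (j + 1) :: 'k) = 0" by (simp only: of_nat_eq_0_mod)
    thus ?thesis unfolding cartier_coeff_f_coeff1[OF D] by (simp del: of_nat_Suc of_nat_add)
  next
    case False
    note c = Delta_complement[OF D]
    have "(q - 1 - i) mod p + (q - 1 - (j + 1)) mod p < p - 1"
      unfolding c(2) c(5)[OF False] using 1 2 False by linarith
    thus ?thesis unfolding cartier_coeff_f_coeff1[OF D] cartier_coeff_mon_nat by simp
  qed
  thus ?thesis unfolding ij Ver_cochain_f_cochain[OF D] by (simp add: fmul_simps zero_prod_def)
qed

section \<open>The action of Frobenius on the basis\<close>

lemma mon_res_U1: "a \<ge> 0 \<Longrightarrow> mon a b \<in> res_U1"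
  using mon_from_U1[of a b] unfolding res_U1_def by (metis image_eqI)

lemma mon_res_U2: "(q + 1) * b \<le> q * d \<Longrightarrow> mon (- int d) b \<in> res_U2"
  using mon_from_U2[of b d] unfolding res_U2_def by (metis image_eqI)

definition frob_coeff :: "nat \<Rightarrow> nat \<Rightarrow> 'k" where "frob_coeff s l = of_nat (s choose l) * (- 1) ^ l"

lemma frob_coeff_nonzero: "l \<le> s \<Longrightarrow> s < p \<Longrightarrow> frob_coeff s l \<noteq> 0"
  by (simp add: frob_coeff_def binomial_nonzero)

lemma mon_power_expand:
  "mon b (a + q * s) = (\<Sum>l\<le>s. sc (frob_coeff s l) (mon (b + int ((q + 1) * (s - l))) (a + l)))"
proof
  fix P
  show "mon b (a + q * s) P = (\<Sum>l\<le>s. sc (frob_coeff s l)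
      (mon (b + int ((q + 1) * (s - l))) (a + l))) P"
  proof (cases "P \<in> U12 q")
    case True
    define x y where "x = xc P" and "y = yc P"
    have x: "x \<noteq> 0" using U12_coords(1)[OF True] by (simp add: x_def)
    have y: "y ^ q = - y + x ^ (q + 1)" using U12_coords(2)[OF True] by (simp add: x_def y_def)
    have "y ^ (a + q * s) = y ^ a * (- y + x ^ (q + 1)) ^ s" by (simp only: power_add power_mult y)
    also have "\<dots> = (\<Sum>l\<le>s. y ^ a * (of_nat (s choose l) * (- y) ^ l * (x ^ (q + 1)) ^ (s - l)))"
      by (simp only: binomial_ring sum_distrib_left)
    finally have yb: "y ^ (a + q * s) = \<dots>" .
    have "mon b (a + q * s) P = x powi b * y ^ (a + q * s)" using True
      by (simp only: mon_def x_def y_def if_True)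
    also have "\<dots> = (\<Sum>l\<le>s. frob_coeff s l * (x powi (b + int ((q + 1) * (s - l))) * y ^ (a + l)))"
      unfolding yb sum_distrib_left
    proof (intro sum.cong refl)
      fix l
      have "x powi (b + int ((q + 1) * (s - l))) = x powi b * (x ^ (q + 1)) ^ (s - l)"
        using x by (simp only: power_int_add power_int_of_nat power_mult simp_thms)
      moreover have "(- y) ^ l = (- 1) ^ l * y ^ l" by (rule power_minus)
      ultimately show "x powi b * (y ^ a *
          (of_nat (s choose l) * (- y) ^ l * (x ^ (q + 1)) ^ (s - l)))
          = frob_coeff s l * (x powi (b + int ((q + 1) * (s - l))) * y ^ (a + l))"
        by (simp only: frob_coeff_def power_add mult_ac)
    qed
    also have "\<dots> = (\<Sum>l\<le>s. sc (frob_coeff s l) (mon (b + int ((q + 1) * (s - l))) (a + l))) P"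
      using True by (simp only: fun_simps mon_def x_def y_def if_True)
    finally show ?thesis .
  qed (simp add: fun_simps mon_outside)
qed

text \<open>Modulo p the exponents in the l-th term are s - l and l, so its derivative has two
  monomials. The first of them cancels against the second one from term l + 1, by (l + 1) C(s, l +
  1) = (s - l) C(s, l) and the alternating sign; only the contribution at the upper end is
  left.\<close>

lemma D0_partial_sum:
  assumes "(of_int b :: 'k) = 0" "(of_nat a :: 'k) = 0" "K \<le> s"
  shows "D0 (\<Sum>l<K. sc (frob_coeff s l) (mon (b + int ((q + 1) * (s - l))) (a + l)))
    = sc (- (of_nat K * frob_coeff s K)) (mon (b + int ((q + 1) * (s - K)) + int q) (a + K - 1))"
  using assms(3)
proof (induction K)
  case (Suc K)
  have sK: "s - K = Suc (s - Suc K)" using Suc.prems by simp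
  define X where "X = mon (b + int ((q + 1) * (s - K)) + int q) (a + K - 1)"
  define Y where "Y = mon (b + int ((q + 1) * (s - K)) - 1) (a + K)"
  have Y: "Y = mon (b + int ((q + 1) * (s - Suc K)) + int q) (a + Suc K - 1)"
    unfolding Y_def sK by (simp add: algebra_simps)
  have c1: "(of_int (b + int ((q + 1) * (s - K))) :: 'k) = of_nat (s - K)" using assms(1) by simp
  have c2: "(of_nat (a + K) :: 'k) = of_nat K" using assms(2) by simp
  have co: "frob_coeff s K * of_nat (s - K) = - (of_nat (Suc K) * frob_coeff s (Suc K))"
  proof -
    have "Suc K * (s choose Suc K) = (s - K) * (s choose K)"
      unfolding binomial_absorption binomial_absorb_comp ..
    hence "(of_nat (Suc K) :: 'k) * of_nat (s choose Suc K) = of_nat (s - K) * of_nat (s choose K)"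
      by (metis of_nat_mult)
    thus ?thesis by (simp add: frob_coeff_def algebra_simps del: of_nat_Suc)
  qed
  have "D0 (mon (b + int ((q + 1) * (s - K))) (a + K)) = sc (of_nat (s - K)) Y + sc (of_nat K) X"
    unfolding D0_mon dmon_def c1 c2 X_def Y_def ..
  hence "D0 (\<Sum>l<Suc K. sc (frob_coeff s l) (mon (b + int ((q + 1) * (s - l))) (a + l)))
      = sc (- (of_nat K * frob_coeff s K)) X
          + sc (frob_coeff s K) (sc (of_nat (s - K)) Y + sc (of_nat K) X)"
    using Suc.IH Suc.prems by (simp add: D0_add D0_sc X_def)
  also have "\<dots> = sc (frob_coeff s K * of_nat (s - K)) Y"
    by (simp add: vs.scale_right_distrib mult.commute)
  finally show ?case unfolding co Y .
qed simp

text \<open>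
  Split the expansion of the \<open>p\<close>-th power into its regular parts on \<open>U1\<close> and \<open>U2\<close> and one middle
  monomial; the derivative of the first part telescopes to a single monomial.
\<close>

lemma frobenius_decomposition:
  assumes il: "il < q'" "jl < q'" and top: "it + jt \<le> p - 1"
  defines "i \<equiv> q' * it + il" and "j \<equiv> q' * jt + jl" and "L \<equiv> p - 1 - jt - it"
  obtains PA PB where "PA \<in> res_U1" "PB \<in> res_U2"
    "mon (- int (i + 1)) (q - 1 - j) ^ p
      = PA + sc (frob_coeff (p - 1 - jt) L)
          (mon (int it - int (p * (il + 1))) (p * (q' - 1 - jl) + L)) + PB"
    "D0 PA = sc (- (of_nat L * frob_coeff (p - 1 - jt) L))
      (mon (int it - int (p * (il + 1)) + int q) (p * (q' - 1 - jl) + L - 1))"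
proof -
  define s where "s = p - 1 - jt"
  define a where "a = p * (q' - 1 - jl)"
  define b where "b = - int (p * (i + 1))"
  have jt: "jt < p" "it < p" using top p_gt_1 by auto
  \<comment> \<open>The middle term is the one whose factor (x^(q+1))^(s-L) nearly cancels the pole
    x^(-q it) contained in x^b.\<close>
  have Ls: "L \<le> s" "s - L = it" using top by (auto simp: L_def s_def)
  define t where "t l = sc (frob_coeff s l) (mon (b + int ((q + 1) * (s - l))) (a + l))" for l
  have b: "b = - int (p * (il + 1)) - int (q * it)" by (simp add: b_def i_def q_eq algebra_simps)
  have mid: "b + int ((q + 1) * it) = int it - int (p * (il + 1))" by (simp add: b algebra_simps)
  have "j < q' * p"
  proof -
    have "q' * (jt + 1) \<le> q' * p" using jt by (intro mult_le_mono2) auto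
    thus ?thesis using il by (simp add: j_def)
  qed
  from complement_div_mod(1)[OF this]
  have "q - 1 - j = q' * s + (q' - 1 - jl)" using il q'_pos
    by (simp add: q_eq mult.commute[of p] j_def s_def)
  hence "p * (q - 1 - j) = a + q * s" by (simp add: a_def q_eq algebra_simps)
  hence fp: "mon (- int (i + 1)) (q - 1 - j) ^ p = mon b (a + q * s)"
    using mon_power[of p "- int (i + 1)" "q - 1 - j"] p_gt_1 unfolding b_def
    by (simp only: of_nat_mult mult_minus_right)
  also have "\<dots> = (\<Sum>l\<le>s. t l)" unfolding t_def by (rule mon_power_expand)
  also have "{..s} = insert L ({..<L} \<union> {L<..s})" using Ls by auto
  also have "(\<Sum>l\<in>insert L ({..<L} \<union> {L<..s}). t l) = t L + ((\<Sum>l<L. t l) + (\<Sum>l\<in>{L<..s}. t l))"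
  proof -
    have "{..<L} \<inter> {L<..s} = {}" by (auto simp: set_eq_iff Int_iff)
    thus ?thesis by (subst sum.insert) (auto simp: sum.union_disjoint)
  qed
  finally have split: "mon (- int (i + 1)) (q - 1 - j) ^ p = (\<Sum>l<L. t l) + t L + (\<Sum>l\<in>{L<..s}. t l)"
    by (simp add: add_ac)
  have "p * (il + 1) \<le> q" unfolding q_eq using il by (intro mult_le_mono2) auto
  \<comment> \<open>Here s - l is at least it + 1, and the additional x^(q+1) outweighs the
    remaining pole of order p (il + 1) \<le> q in x.\<close>
  have "t l \<in> res_U1" if "l < L" for l
  proof -
    have "it + 1 \<le> s - l" using that Ls by linarith
    hence "(q + 1) * (it + 1) \<le> (q + 1) * (s - l)" by (rule mult_le_mono2)
    moreover have "(q + 1) * (it + 1) = q * it + q + it + 1" by (simp add: algebra_simps)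
    ultimately have "p * (il + 1) + q * it \<le> (q + 1) * (s - l)" using \<open>p * (il + 1) \<le> q\<close> by linarith
    hence "b + int ((q + 1) * (s - l)) \<ge> 0" unfolding b by linarith
    thus ?thesis unfolding t_def by (intro vs.subspace_scale[OF subspace_res_U1] mon_res_U1)
  qed
  hence A: "(\<Sum>l<L. t l) \<in> res_U1" by (intro vs.subspace_sum[OF subspace_res_U1]) auto
  have "t l \<in> res_U2" if "l \<in> {L<..s}" for l
  proof -
    have "s - l + 1 \<le> it" using that Ls by auto
    hence "(q + 1) * (s - l + 1) \<le> (q + 1) * it" by (rule mult_le_mono2)
    hence 1: "(q + 1) * (s - l) + q + 1 \<le> q * it + it" by (simp add: algebra_simps)
    define d where "d = p * (il + 1) + q * it - (q + 1) * (s - l)"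
    \<comment> \<open>This summand absorbs it < p, so the negative exponent of x is at least q + 1
      in size. Since the exponent of y stays below q, the criterion for regularity on
      \<open>U2 q\<close> holds.\<close>
    have "p \<le> p * (il + 1)" by simp
    hence d: "q + 1 \<le> d" "b + int ((q + 1) * (s - l)) = - int d"
      using 1 jt unfolding d_def b by linarith+
    have "a + l \<le> q - 1"
    proof -
      have "q' - 1 - jl + 1 \<le> q'" using q'_pos by linarith
      from mult_le_mono2[OF this, of p] have "p * (q' - 1 - jl) + p \<le> p * q'"
        by (simp add: distrib_left)
      moreover have "l \<le> p - 1" using that by (auto simp: s_def)
      ultimately show ?thesis unfolding a_def q_eq using p_gt_1 by linarith
    qed
    hence "(q + 1) * (a + l) \<le> (q + 1) * q" by (intro mult_le_mono2) auto
    also have "\<dots> \<le> q * d" using mult_le_mono2[OF d(1), of q]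
      by (simp only: mult.commute[of "q + 1"])
    finally show ?thesis unfolding t_def d(2)
      by (intro vs.subspace_scale[OF subspace_res_U2] mon_res_U2)
  qed
  hence B: "(\<Sum>l\<in>{L<..s}. t l) \<in> res_U2" by (intro vs.subspace_sum[OF subspace_res_U2]) auto
  have "(of_int b :: 'k) = 0" "(of_nat a :: 'k) = 0" by (simp_all add: b_def a_def)
  from D0_partial_sum[OF this Ls(1)]
  have D: "D0 (\<Sum>l<L. t l) = sc (- (of_nat L * frob_coeff s L))
      (mon (int it - int (p * (il + 1)) + int q) (a + L - 1))"
    unfolding t_def Ls(2) mid .
  have "t L = sc (frob_coeff s L) (mon (int it - int (p * (il + 1))) (a + L))"
    unfolding t_def Ls(2) mid ..
  with that[OF A B] split D show ?thesis unfolding s_def a_def by simp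
qed

lemma Frob_cochain_f_cochain: "Frob_cochain (f_cochain (i, j))
    = (mon (- int (i + 1)) (q - 1 - j) ^ p, 0, 0)"
  by (simp add: Frob_cochain_def f_cochain_def)

lemma D0_p_power: "D0 (mon a b ^ p) = 0"
  by (rule derivation_p_power[OF D0_derivation mon_regular])

lemma boundary_in_E: "f \<in> res_U1 \<Longrightarrow> g \<in> res_U2 \<Longrightarrow> (f - g, fmul (D0 f) dx, fmul (D0 g) dx) \<in> E"
  unfolding E_eq by (intro CollectI exI[of _ f] exI[of _ g]) (simp add: dd_eq R_subset_A)

lemma fmul_uminus: "fmul (- f) \<omega> = - fmul f \<omega>"
  by (simp add: fmul_def fun_eq_iff fun_simps)

text \<open>For the index \<alpha> a the middle monomial is the function of f_a itself. A p-th power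
  has derivative 0, so \<open>D0 PB\<close> is determined by \<open>D0 PA\<close>, and both match
  the forms of f_a.\<close>

lemma Frob_cochain_f_cochain_alpha: "a \<in> Dom1 \<Longrightarrow> \<exists>u. u \<noteq> 0
    \<and> Frob_cochain (f_cochain (alpha a)) - cscale u (f_cochain a) \<in> E"
proof -
  assume a: "a \<in> Dom1"
  obtain i j where ij: "a = (i, j)" by (cases a)
  have D: "(i, j) \<in> Delta q" and 1: "p - 1 \<le> i mod p + j mod p" using a
    by (simp_all add: Dom1_def ij)
  have 2: "i mod p < p" "j mod p < p" using p_gt_1 by auto
  have b: "i div p < q'" "j div p < q'" using Dom1_bound a ij by fastforce+
  define it jt where "it = p - 1 - i mod p" and "jt = i mod p + j mod p - (p - 1)"
  have tj: "it + jt = j mod p" unfolding it_def jt_def using 1 2 by linarith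
  hence top: "it + jt \<le> p - 1" using 2 by linarith
  define L where "L = p - 1 - jt - it"
  define u where "u = frob_coeff (p - 1 - jt) L"
  have L: "L = p - 1 - j mod p" using tj by (simp add: L_def)
  have jlt: "j < p * q'" using D unfolding q_eq[symmetric] by (auto simp: Delta_iff)
  have e1: "int it - int (p * (i div p + 1)) = - int (i + 1)"
  proof -
    have "int i = int (p * (i div p)) + int (i mod p)" by (simp only: of_nat_add[symmetric]) simp
    moreover have "int it = int p - 1 - int (i mod p)" unfolding it_def using 2 by linarith
    ultimately show ?thesis by (simp add: algebra_simps)
  qed
  have e2: "p * (q' - 1 - j div p) + L = q - 1 - j"
    unfolding L q_eq complement_div_mod(1)[OF jlt] ..
  have e3: "- int (i + 1) + int q = int q - int i - 1" "q - 1 - j - 1 = q - j - 2" by auto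
  have alpha: "alpha a = (q' * it + i div p, q' * jt + j div p)"
    by (simp add: alpha_def ij it_def jt_def add.commute)
  obtain PA PB where P: "PA \<in> res_U1" "PB \<in> res_U2"
    "mon (- int (q' * it + i div p + 1)) (q - 1 - (q' * jt + j div p)) ^ p = PA
        + sc u (mon (- int (i + 1)) (q - 1 - j)) + PB"
    "D0 PA = sc (- (of_nat L * u)) (mon (int q - int i - 1) (q - j - 2))"
    using frobenius_decomposition[OF b top] unfolding L_def[symmetric] u_def[symmetric] e1 e2 e3
      by metis
  \<comment> \<open>L complements the lowest digit of j, so p divides L + j + 1. This identifies the
    telescoped coefficient with the factor - (j + 1) in \<open>f_coeff1\<close>.\<close>
  have "(of_nat L :: 'k) + of_nat (j + 1) = 0"
  proof -
    have "L + (j + 1) = p * (j div p + 1)"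
      using 2 p_gt_1 mult_div_mod_eq[of p j] unfolding L distrib_left by linarith
    thus ?thesis
      by (simp only: of_nat_add[symmetric]) (simp only: of_nat_mult of_nat_p mult_zero_left)
  qed
  hence "(of_nat L :: 'k) = - of_nat (j + 1)" by (simp only: eq_neg_iff_add_eq_0)
  hence DA: "D0 PA = - sc u (f_coeff1 i j)"
    unfolding P(4) f_coeff1_def by (simp add: mult.commute flip: vs.scale_minus_left)
  have "D0 (PA + sc u (mon (- int (i + 1)) (q - 1 - j)) + PB) = 0"
    unfolding P(3)[symmetric] by (rule D0_p_power)
  hence "D0 PA + sc u (f_coeff1 i j - f_coeff2 i j) + D0 PB = 0"
    by (simp only: D0_add D0_sc D0_f[OF D])
  hence DB: "D0 PB = sc u (f_coeff2 i j)"
    unfolding DA vs.scale_right_diff_distrib by (simp add: add_eq_0_iff algebra_simps)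
  have nPB: "- PB \<in> res_U2" using P(2) by (rule vs.subspace_neg[OF subspace_res_U2])
  have nDB: "D0 (- PB) = - sc u (f_coeff2 i j)"
    using D0_diff[of 0 PB] DB by simp
  have "Frob_cochain (f_cochain (alpha a)) - cscale u (f_cochain a)
      = (PA - - PB, fmul (D0 PA) dx, fmul (D0 (- PB)) dx)"
    unfolding alpha Frob_cochain_f_cochain P(3)
      unfolding ij f_cochain_def prod.case cscale_fmul DA nDB by (simp add: fmul_uminus)
  also have "\<dots> \<in> E" by (rule boundary_in_E[OF P(1) nPB])
  finally have "Frob_cochain (f_cochain (alpha a)) - cscale u (f_cochain a) \<in> E" .
  moreover have "u \<noteq> 0" unfolding u_def using p_gt_1 top
    by (intro frob_coeff_nonzero) (auto simp: L_def)
  ultimately show ?thesis by blast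
qed

text \<open>Now the middle monomial x^(i-q) y^(j+1) is regular on \<open>U2 q\<close>, so the
  function is a difference of regular ones. Subtracting their boundary leaves the form -
  d\<open>PA\<close>, which is a multiple of x^i y^j dx; its scalar contains L = j mod p + 1,
  nonzero in k.\<close>

lemma Frob_cochain_f_cochain_beta: "a \<in> Dom2 \<Longrightarrow> \<exists>u. u \<noteq> 0
    \<and> Frob_cochain (f_cochain (beta a)) - cscale u (omega_cochain a) \<in> E"
proof -
  assume a: "a \<in> Dom2"
  obtain i j where ij: "a = (i, j)" by (cases a)
  have D: "(i, j) \<in> Delta q" and 1: "i mod p + j mod p + 2 \<le> p" using a by (auto simp: Dom2_def ij)
  have b: "i div p < q'" "j div p < q'" using Dom2_bound a ij by fastforce+
  have b': "q' - 1 - i div p < q'" "q' - 1 - j div p < q'" using q'_pos by auto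
  define it jt where "it = i mod p" and "jt = p - 2 - i mod p - j mod p"
  have top: "it + jt \<le> p - 1" using 1 by (auto simp: it_def jt_def)
  define L where "L = p - 1 - jt - it"
  define v where "v = frob_coeff (p - 1 - jt) L"
  have L: "L = j mod p + 1" using 1 by (auto simp: L_def it_def jt_def)
  have iq: "i + j + 2 \<le> q" using D by (simp add: Delta_iff)
  have e1: "int it - int (p * (q' - 1 - i div p + 1)) = - int (q - i)"
  proof -
    have "q' - 1 - i div p + 1 + i div p = q'" using b by simp
    hence "p * (q' - 1 - i div p + 1) + p * (i div p) = q" unfolding q_eq by (metis distrib_left)
    moreover have "p * (i div p) + it = i" by (simp add: it_def)
    ultimately show ?thesis using iq by linarith
  qed
  have e2: "p * (q' - 1 - (q' - 1 - j div p)) + L = j + 1"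
  proof -
    have "q' - 1 - (q' - 1 - j div p) = j div p" using b by simp
    thus ?thesis by (simp add: L)
  qed
  have e3: "- int (q - i) + int q = int i" "j + 1 - 1 = j" using iq by auto
  have beta: "beta a = (q' * it + (q' - 1 - i div p), q' * jt + (q' - 1 - j div p))"
    by (simp add: beta_def ij it_def jt_def)
  obtain PA PB where P: "PA \<in> res_U1" "PB \<in> res_U2"
    "mon (- int (q' * it + (q' - 1 - i div p) + 1)) (q - 1 - (q' * jt + (q' - 1 - j div p))) ^ p
        = PA + sc v (mon (- int (q - i)) (j + 1)) + PB"
    "D0 PA = sc (- (of_nat L * v)) (mon (int i) j)"
    using frobenius_decomposition[OF b' top] unfolding L_def[symmetric] v_def[symmetric] e1 e2 e3
      by metis
  have "mon (- int (q - i)) (j + 1) \<in> res_U2"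
  proof (rule mon_res_U2)
    have "q * (i + j + 2) \<le> q * q" using iq by (rule mult_le_mono2)
    moreover have "q * (q - i) + q * i = q * q" using iq by (simp flip: distrib_left)
    moreover have "q * (i + j + 2) = q * i + q * (j + 1) + q"
        "(q + 1) * (j + 1) = q * (j + 1) + (j + 1)"
      by (simp_all add: algebra_simps)
    ultimately show "(q + 1) * (j + 1) \<le> q * (q - i)" using iq by linarith
  qed
  define PC where "PC = - (sc v (mon (- int (q - i)) (j + 1)) + PB)"
  have PC: "PC \<in> res_U2" unfolding PC_def
    using P(2) \<open>mon (- int (q - i)) (j + 1) \<in> res_U2\<close>
    by (intro vs.subspace_neg[OF subspace_res_U2] vs.subspace_add[OF subspace_res_U2]
        vs.subspace_scale[OF subspace_res_U2])
  have sum: "PA + sc v (mon (- int (q - i)) (j + 1)) + PB = PA - PC" by (simp add: PC_def)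
  have "D0 (PA - PC) = 0" unfolding sum[symmetric] P(3)[symmetric] by (rule D0_p_power)
  hence DC: "D0 PC = D0 PA" by (simp add: D0_diff)
  define u where "u = of_nat L * v"
  have DA: "D0 PA = - sc u (mon (int i) j)" unfolding P(4) u_def by (simp only: vs.scale_minus_left)
  have "Frob_cochain (f_cochain (beta a)) - cscale u (omega_cochain a)
      = (PA - PC, fmul (D0 PA) dx, fmul (D0 PC) dx)"
    unfolding beta Frob_cochain_f_cochain P(3) sum DC unfolding ij cscale_omega_cochain DA
      by (simp add: fmul_uminus)
  also have "\<dots> \<in> E" by (rule boundary_in_E[OF P(1) PC])
  finally have "Frob_cochain (f_cochain (beta a)) - cscale u (omega_cochain a) \<in> E" .
  moreover have "v \<noteq> 0" unfolding v_def using p_gt_1 top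
    by (intro frob_coeff_nonzero) (auto simp: L_def)
  moreover have "(of_nat L :: 'k) \<noteq> 0" unfolding L using 1 by (intro of_nat_nonzero) auto
  ultimately show ?thesis unfolding u_def by (metis mult_eq_0_iff)
qed

section \<open>Linear independence\<close>

text \<open>A function without poles is constant: for nonnegative exponents the weight q a + (q + 1)
  b is at most 0 only for a = b = 0.\<close>

lemma poly_part_deg_le_0:
  assumes "f \<in> poly_part" "f \<in> deg_le 0"
  shows "D0 f = 0"
proof -
  have "f \<in> vs.span (e ` {0})"
  proof (rule span_eI)
    show "f \<in> vs.span (range e)" using assms(1) span_eD unfolding poly_part_def by blast
    fix m :: int assume "m \<notin> {0}"
    show "e_coeff f m = 0"
    proof (cases "x_exp m \<ge> 0 \<and> m \<le> 0")
      case True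
      hence "int q * x_exp m \<ge> 0" "int (q + 1) * int (y_exp m) \<ge> 0" by simp_all
      hence "m = 0" using weight_x_exp_y_exp[of m] True by linarith
      thus ?thesis using \<open>m \<notin> {0}\<close> by simp
    next
      case False
      thus ?thesis using e_coeff_outside[OF assms(1)[unfolded poly_part_def], of m]
          e_coeff_outside[OF assms(2)[unfolded deg_le_def], of m] by auto
    qed
  qed
  moreover have "D0 (e 0) = 0" by (simp add: D0_e dmon_def x_exp_def y_exp_def)
  ultimately show ?thesis by (auto simp: vs.span_singleton D0_sc)
qed

lemma e_coeff_sum:
  "(\<And>a. a \<in> I \<Longrightarrow> f a \<in> vs.span (range e)) \<Longrightarrow> e_coeff (\<Sum>a\<in>I. f a) m = (\<Sum>a\<in>I. e_coeff (f a) m)"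
proof (induction I rule: infinite_finite_induct)
  case (insert x F)
  thus ?case by (simp add: e_coeff_linear vs.span_sum)
qed auto

lemma e_coeff_mon:
  assumes "b < q"
  shows "e_coeff (mon a b) m = (if x_exp m = a \<and> y_exp m = b then 1 else 0)"
proof -
  define k where "k = int q * a + int (q + 1) * int b"
  have e: "e k = mon a b" unfolding k_def by (rule e_weight[OF assms])
  have k: "x_exp k = a" "y_exp k = b" unfolding k_def x_exp_weight y_exp_weight using assms
    by simp_all
  have "k = m \<longleftrightarrow> x_exp m = a \<and> y_exp m = b"
    using weight_x_exp_y_exp[of k] weight_x_exp_y_exp[of m] k by auto
  thus ?thesis using e_coeff_e[of k m] by (simp add: e)
qed

lemma finite_Delta: "finite (Delta q)"
  by (rule finite_subset[of _ "{..q} \<times> {..q}"]) (auto simp: Delta_def)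

lemma mon_span: "mon a b \<in> vs.span (range e)"
  using mon_regular A_eq_span by blast

lemma comb_omega_cochain: "comb J omega_cochain d
    = (0, fmul (\<Sum>(i, j)\<in>J. sc (d (i, j)) (mon (int i) j)) dx,
        fmul (\<Sum>(i, j)\<in>J. sc (d (i, j)) (mon (int i) j)) dx)"
proof (induction J rule: infinite_finite_induct)
  case (insert a J)
  obtain i j where "a = (i, j)" by (cases a)
  thus ?case using insert by (simp add: comb_def cscale_omega_cochain fmul_simps)
qed (simp_all add: comb_def zero_prod_def fmul_simps)

lemma comb_f_cochain: "fst (comb J f_cochain d)
    = (\<Sum>(i, j)\<in>J. sc (d (i, j)) (mon (- int (i + 1)) (q - 1 - j)))"
proof (induction J rule: infinite_finite_induct)
  case (insert a J)
  obtain i j where "a = (i, j)" by (cases a)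
  thus ?case using insert by (simp add: comb_def f_cochain_def cscale_fmul)
qed (simp_all add: comb_def)

text \<open>If the combination is the boundary of f and g, then f = g is regular on both open sets,
  so df = 0. The combined form vanishes, and its coefficients are coordinates in the basis
  \<open>e\<close>.\<close>

lemma independent_omega_cochain:
  assumes J: "J \<subseteq> Delta q" and comb: "comb J omega_cochain d \<in> E" and a: "a \<in> J"
  shows "d a = 0"
proof -
  have fin: "finite J" using J finite_Delta by (rule finite_subset)
  define G where "G = (\<Sum>(i, j)\<in>J. sc (d (i, j)) (mon (int i) j))"
  have GA: "G \<in> A" unfolding G_def
    by (intro vs.subspace_sum[OF subspace_regular]) (auto intro: regular_sc mon_regular)
  obtain f g where fg: "f \<in> res_U1" "g \<in> res_U2" "0 = f - g" "fmul G dx = dd q f"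
    using comb unfolding comb_omega_cochain G_def[symmetric] E_eq by auto
  have "f \<in> poly_part" using fg(1) regular_U1_poly_part by (auto simp: res_U1_def)
  moreover have "f \<in> deg_le 0" using fg(2,3) regular_U2_deg_le by (auto simp: res_U2_def)
  ultimately have "D0 f = 0" by (rule poly_part_deg_le_0)
  hence "fmul G dx D0 = 0" unfolding fg(4) dd_eq[OF R_subset_A(1)[OF fg(1)]]
    by (simp add: fmul_simps fun_simps)
  hence G0: "G = 0" using fmul_dx_D0[OF GA] by simp
  obtain i j where ij: "a = (i, j)" by (cases a)
  have jq: "snd b < q" if "b \<in> J" for b using J that q_gt_1 by (cases b) (auto simp: Delta_def)
  define k where "k = int q * int i + int (q + 1) * int j"
  have k: "x_exp k = int i" "y_exp k = j" unfolding k_def x_exp_weight y_exp_weight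
    using jq[OF a] ij by simp_all
  have "e_coeff G k = (\<Sum>b\<in>J. e_coeff (case b of (i, j) \<Rightarrow> sc (d (i, j)) (mon (int i) j)) k)"
    unfolding G_def by (rule e_coeff_sum) (auto intro: vs.span_scale mon_span)
  also have "\<dots> = (\<Sum>b\<in>J. if b = a then d a else 0)"
  proof (rule sum.cong)
    fix b assume "b \<in> J"
    obtain i' j' where b: "b = (i', j')" by (cases b)
    show "e_coeff (case b of (i, j) \<Rightarrow> sc (d (i, j)) (mon (int i) j)) k = (if b = a then d a else 0)"
      using jq[OF \<open>b \<in> J\<close>] k
        by (auto simp: b ij e_coeff_linear(3)[OF mon_span mon_span] e_coeff_mon)
  qed simp
  also have "\<dots> = d a" using fin a by simp
  finally show ?thesis using G0 by simp
qed

text \<open>The monomial x^-(i+1) y^(q-1-j) has a negative exponent of x and a pole of positive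
  order at infinity, so it occurs neither in functions on \<open>U1 q\<close> nor in functions on
  \<open>U2 q\<close>.\<close>

lemma independent_f_cochain:
  assumes J: "J \<subseteq> Delta q" and comb: "comb J f_cochain d \<in> E" and a: "a \<in> J"
  shows "d a = 0"
proof -
  have fin: "finite J" using J finite_Delta by (rule finite_subset)
  define G where "G = (\<Sum>(i, j)\<in>J. sc (d (i, j)) (mon (- int (i + 1)) (q - 1 - j)))"
  obtain f g where fg: "f \<in> res_U1" "g \<in> res_U2" "G = f - g"
    using comb comb_f_cochain[of J d] unfolding G_def[symmetric] E_eq by auto
  have f: "f \<in> poly_part" using fg(1) regular_U1_poly_part by (auto simp: res_U1_def)
  have g: "g \<in> deg_le 0" using fg(2) regular_U2_deg_le by (auto simp: res_U2_def)
  obtain i j where ij: "a = (i, j)" by (cases a)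
  have iq: "i + j + 2 \<le> q" using J a ij Delta_iff by blast
  define k where "k = int q * (- int (i + 1)) + int (q + 1) * int (q - 1 - j)"
  have k: "x_exp k = - int (i + 1)" "y_exp k = q - 1 - j"
    unfolding k_def x_exp_weight y_exp_weight using q_gt_1 by simp_all
  have "k > 0"
  proof -
    have "q * (i + 1) < (q + 1) * (q - 1 - j)"
    proof -
      have "i + 1 \<le> q - 1 - j" using iq by linarith
      hence "q * (i + 1) \<le> q * (q - 1 - j)" by (rule mult_le_mono2)
      moreover have "(q + 1) * (q - 1 - j) = q * (q - 1 - j) + (q - 1 - j)" by simp
      ultimately show ?thesis using iq by linarith
    qed
    hence "int (q * (i + 1)) < int ((q + 1) * (q - 1 - j))" by (simp only: of_nat_less_iff)
    thus ?thesis unfolding k_def by (simp only: of_nat_mult)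
  qed
  have "e_coeff f k = 0" "e_coeff g k = 0"
    using e_coeff_outside[OF f[unfolded poly_part_def], of k]
        e_coeff_outside[OF g[unfolded deg_le_def], of k] k \<open>k > 0\<close> by auto
  moreover have "f \<in> vs.span (range e)" "g \<in> vs.span (range e)"
    using f g span_eD unfolding poly_part_def deg_le_def by blast+
  ultimately have "e_coeff G k = 0" unfolding fg(3) by (simp add: e_coeff_linear)
  moreover have "e_coeff G k = (\<Sum>b\<in>J. e_coeff
      (case b of (i, j) \<Rightarrow> sc (d (i, j)) (mon (- int (i + 1)) (q - 1 - j))) k)"
    unfolding G_def by (rule e_coeff_sum) (auto intro: vs.span_scale mon_span)
  moreover have "\<dots> = (\<Sum>b\<in>J. if b = a then d a else 0)"
  proof (rule sum.cong)
    fix b assume b: "b \<in> J"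
    obtain i' j' where b': "b = (i', j')" by (cases b)
    have "j' + 2 \<le> q" using J b b' Delta_iff[of i' j'] by auto
    moreover have "q - 1 - j' < q" using q_gt_1 by simp
    ultimately show "e_coeff (case b of (i, j) \<Rightarrow> sc (d (i, j)) (mon (- int (i + 1)) (q - 1 - j)))
        k = (if b = a then d a else 0)"
      using k iq by (auto simp: b' ij e_coeff_linear(3)[OF mon_span mon_span] e_coeff_mon)
  qed simp
  moreover have "\<dots> = d a" using fin a by simp
  ultimately show ?thesis by simp
qed

section \<open>The final and canonical decomposition\<close>

definition I_omega :: "nat \<Rightarrow> (nat \<times> nat) set" where
    "I_omega t = {a \<in> Delta q. S_index p n a + 1 = t}"
text \<open>Stated as a sum to avoid truncated subtraction; \<open>S_index_less\<close> gives the
  equivalence with T.\<close>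

definition I_f :: "nat \<Rightarrow> (nat \<times> nat) set" where "I_f t = {a \<in> Delta q. S_index p n a + t = 2 ^ n}"

lemma finite_I: "finite (I_omega t)" "finite (I_f t)"
  using finite_Delta by (simp_all add: I_omega_def I_f_def)

lemma B_space_eq: "B_space p n t = class_span q
    ((\<lambda>a. cl (omega_cochain a)) ` I_omega t \<union> (\<lambda>a. cl (f_cochain a)) ` I_f t)"
proof -
  have "{omega_class q i j | i j. (i, j) \<in> Delta q \<and> T_index n (omega_vec p n i j) = t}
      = (\<lambda>a. cl (omega_cochain a)) ` I_omega t"
    unfolding T_index_omega omega_class_eq I_omega_def by auto
  moreover have eq: "T_index n (f_vec p n i j) = t \<longleftrightarrow> S_index p n (i, j) + t = 2 ^ n"
      if "(i, j) \<in> Delta q" for i j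
    unfolding T_index_f using S_index_less[OF that] by auto
  moreover have "{f_class q i j | i j. (i, j) \<in> Delta q \<and> T_index n (f_vec p n i j) = t}
      = (\<lambda>a. cl (f_cochain a)) ` I_f t"
    (is "?K = _")
  proof (intro set_eqI iffI)
    fix K
    {
      assume "K \<in> ?K"
      then obtain i j where ij: "K = f_class q i j" "(i, j) \<in> Delta q"
          "T_index n (f_vec p n i j) = t" by blast
      hence "(i, j) \<in> I_f t" "K = cl (f_cochain (i, j))" by (simp_all add: I_f_def eq f_class_eq)
      thus "K \<in> (\<lambda>a. cl (f_cochain a)) ` I_f t" by blast
    }
    assume "K \<in> (\<lambda>a. cl (f_cochain a)) ` I_f t"
    then obtain i j where ij: "K = cl (f_cochain (i, j))" "(i, j) \<in> I_f t" by auto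
    hence "(i, j) \<in> Delta q" "T_index n (f_vec p n i j) = t" "K = f_class q i j"
      by (simp_all add: I_f_def eq f_class_eq)
    thus "K \<in> ?K" by blast
  qed
  ultimately show ?thesis unfolding B_space_def q_def[symmetric] by simp
qed

lemma B_space_odd: "odd t \<Longrightarrow> B_space p n t = class_span q ((\<lambda>a. cl (omega_cochain a)) ` I_omega t)"
proof -
  assume t: "odd t"
  have "I_f t = {}"
  proof -
    have "even ((2 :: nat) ^ n)" using n_pos by simp
    hence "S_index p n a + t \<noteq> 2 ^ n" for a using even_S_index[of a] t by (metis even_add)
    thus ?thesis by (auto simp: I_f_def)
  qed
  thus ?thesis by (simp add: B_space_eq)
qed

lemma B_space_even: "even t \<Longrightarrow> B_space p n t = class_span q ((\<lambda>a. cl (f_cochain a)) ` I_f t)"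
proof -
  assume t: "even t"
  have "I_omega t = {}" using t even_S_index by (auto simp: I_omega_def)
  thus ?thesis by (simp add: B_space_eq)
qed

lemma two_power: "2 ^ n = 2 * (2 :: nat) ^ (n - 1)"
  using n_pos by (cases n) auto

lemma omega_cochain_Omega_cochains: "omega_cochain a \<in> Omega_cochains"
  unfolding Omega_cochains_def omega_cochain_def using mon_regular
    by (cases a) (simp only: prod.case mem_Collect_eq, blast)

lemma f_cochain_Omega_cochains: "f_cochain a \<in> Omega_cochains"
  unfolding Omega_cochains_def f_cochain_def using f_coeff_in_A
    by (cases a) (simp only: prod.case mem_Collect_eq, blast)

text \<open>The position of t relative to 2^(n-1) shows bit 0, which separates \<open>Dom1\<close>
  from \<open>Dom2\<close>. For the f the two cases are interchanged, since S is subtracted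
  there.\<close>

lemma I_omega_Dom1: "2 ^ (n - 1) < t \<Longrightarrow> I_omega t = {a \<in> Dom1. S_index p n a + 1 = t}"
  using S_index_Dom2 two_power Dom_cases unfolding I_omega_def by fastforce

lemma I_omega_Dom2: "t \<le> 2 ^ (n - 1) \<Longrightarrow> I_omega t = {a \<in> Dom2. S_index p n a + 1 = t}"
  using S_index_Dom1 two_power Dom_cases unfolding I_omega_def by fastforce

lemma I_f_Dom2: "2 ^ (n - 1) < t \<Longrightarrow> I_f t = {a \<in> Dom2. S_index p n a + t = 2 ^ n}"
  using S_index_Dom1 two_power Dom_cases unfolding I_f_def by fastforce

lemma I_f_Dom1: "t \<le> 2 ^ (n - 1) \<Longrightarrow> I_f t = {a \<in> Dom1. S_index p n a + t = 2 ^ n}"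
  using S_index_Dom2 two_power Dom_cases unfolding I_f_def by fastforce

lemma Ver_kernel:
  assumes "t \<le> 2 ^ (n - 1)"
  shows "Ver p q ` B_space p n t = {cl 0}"
proof (cases "odd t")
  case True
  show ?thesis unfolding Ver_eq B_space_odd[OF True]
    by (rule induced_kernel[OF semilinear_Ver_cochain finite_I(1) omega_cochain_Omega_cochains])
      (use I_omega_Dom2[OF assms] Ver_cochain_omega_cochain_Dom2 zero_in_E in auto)
next
  case False
  show ?thesis unfolding Ver_eq B_space_even[OF False[unfolded not_not]]
    by (rule induced_kernel[OF semilinear_Ver_cochain finite_I(2) f_cochain_Omega_cochains])
      (use I_f_Dom1[OF assms] Ver_cochain_f_cochain_Dom1 zero_in_E in auto)
qed

lemma Frob_kernel:
  assumes "odd t"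
  shows "Frob p q ` B_space p n t = {cl 0}"
proof -
  have "Frob_cochain (omega_cochain a) = 0" for a
    using p_gt_1
      by (cases a) (simp add: Frob_cochain_def omega_cochain_def zero_prod_def power_0_left)
  thus ?thesis unfolding Frob_eq B_space_odd[OF assms]
    by (intro induced_kernel[OF semilinear_Frob_cochain finite_I(1)]) (simp_all add: zero_in_E)
qed

lemma bij_p_root: "bij p_root"
  unfolding p_root_def by (rule bij_imp_bij_inv[OF bij_frobenius])

lemma Ver_iso:
  assumes t: "2 ^ (n - 1) < t" "t \<le> 2 ^ n"
  shows "semilinear_iso q p_root (Ver p q) (B_space p n t) (B_space p n (2 * t - 2 ^ n - 1))"
proof -
  define t' where "t' = 2 * t - 2 ^ n - 1"
  \<comment> \<open>Both subtractions are exact because t > 2^(n-1).\<close>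
  have t': "t' + 2 ^ n + 1 = 2 * t" using t two_power unfolding t'_def by linarith
  have odd: "odd t'"
  proof -
    have "even (t' + 2 ^ n + 1)" unfolding t' by simp
    thus ?thesis using n_pos by simp
  qed
  have J: "I_omega t' \<subseteq> Delta q" by (auto simp: I_omega_def)
  show ?thesis
  proof (cases "odd t")
    case True
    have "bij_betw alpha (I_omega t) (I_omega t')"
    proof -
      have "I_omega t' = {a \<in> Im1. S_index p n a + 1 = t'}"
      proof -
        \<comment> \<open>For odd t the number 2t is 2 modulo 4, which excludes \<open>Im2\<close>;
          so \<alpha> reaches every form of index t'.\<close>
        have "a \<notin> Im2" if "S_index p n a + 1 = t'" for a
        proof
          assume "a \<in> Im2"
          hence "4 dvd S_index p n a + 2 ^ n + 2" by (rule S_index_Im2)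
          moreover have "S_index p n a + 2 ^ n + 2 = 2 * t" using t' that by linarith
          ultimately have "4 dvd 2 * t" by (simp only:)
          thus False using True by (auto elim!: dvdE)
        qed
        thus ?thesis using Im_cases by (auto simp: I_omega_def)
      qed
      moreover have "S_index p n a + 1 = t \<longleftrightarrow> S_index p n (alpha a) + 1 = t'" if "a \<in> Dom1" for a
        using S_index_alpha[OF that] t' by linarith
      ultimately show ?thesis unfolding I_omega_Dom1[OF t(1)] using bij_betw_Collect[OF bij_alpha]
        by simp
    qed
    moreover obtain u where
        "\<And>a. a \<in> Dom1 \<Longrightarrow> u a \<noteq> 0 \<and> Ver_cochain (omega_cochain a)
            = cscale (u a) (omega_cochain (alpha a))"
      using Ver_cochain_omega_cochain_Dom1 by metis
    ultimately show ?thesis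
      unfolding t'_def[symmetric] Ver_eq B_space_odd[OF True] B_space_odd[OF odd]
      by (intro induced_semilinear_iso[OF semilinear_Ver_cochain finite_I(1)
          omega_cochain_Omega_cochains bij_p_root, where \<pi> = alpha and u = u])
        (use I_omega_Dom1[OF t(1)] zero_in_E independent_omega_cochain[OF J] in auto)
  next
    case False
    have "bij_betw beta (I_f t) (I_omega t')"
    proof -
      have "I_omega t' = {a \<in> Im2. S_index p n a + 1 = t'}"
      proof -
        have "a \<notin> Im1" if "S_index p n a + 1 = t'" for a
        proof
          assume "a \<in> Im1"
          hence "4 dvd S_index p n a + 2 ^ n" by (rule S_index_Im1)
          moreover have "S_index p n a + 2 ^ n + 2 = 2 * t" using t' that by linarith
          moreover have "4 dvd 2 * t" using False by (auto elim!: dvdE)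
          ultimately have "4 dvd (2 :: nat)" by (metis dvd_add_right_iff)
          thus False by simp
        qed
        thus ?thesis using Im_cases by (auto simp: I_omega_def)
      qed
      moreover have "S_index p n a + t = 2 ^ n \<longleftrightarrow> S_index p n (beta a) + 1 = t'" if "a \<in> Dom2" for a
        using S_index_beta[OF that] t' by linarith
      ultimately show ?thesis unfolding I_f_Dom2[OF t(1)] using bij_betw_Collect[OF bij_beta]
        by simp
    qed
    moreover obtain u where
        "\<And>a. a \<in> Dom2 \<Longrightarrow> u a \<noteq> 0 \<and> Ver_cochain (f_cochain a) = cscale (u a) (omega_cochain (beta a))"
      using Ver_cochain_f_cochain_Dom2 by metis
    ultimately show ?thesis
      unfolding t'_def[symmetric] Ver_eq B_space_even[OF False[unfolded not_not]]
          B_space_odd[OF odd]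
      by (intro induced_semilinear_iso[OF semilinear_Ver_cochain finite_I(2)
          f_cochain_Omega_cochains bij_p_root, where \<pi> = beta and u = u])
        (use I_f_Dom2[OF t(1)] zero_in_E independent_omega_cochain[OF J] in auto)
  qed
qed

text \<open>Frobenius undoes \<alpha> and \<beta>, so the bijection of index sets is an inverse of
  one of them. Odd t/2 means that the target consists of forms and \<beta> is inverted; even t/2
  means that it consists of the f and \<alpha> is inverted.\<close>

lemma Frob_iso:
  assumes t: "t \<le> 2 ^ n" "even t"
  shows "semilinear_iso q (\<lambda>c :: 'k. c ^ p) (Frob p q) (B_space p n t) (B_space p n (t div 2))"
proof -
  obtain t' where t': "t = 2 * t'" using t(2) by auto
  hence half: "t div 2 = t'" "t' \<le> 2 ^ (n - 1)" using t(1) two_power by auto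
  have I_f_E: "I_f t = {a \<in> X. S_index p n a + t = 2 ^ n}"
    if "\<And>a. S_index p n a + t = 2 ^ n \<Longrightarrow> a \<in> Delta q \<Longrightarrow> a \<in> X" "X \<subseteq> Delta q" for X
    using that by (auto simp: I_f_def)
  show ?thesis
  proof (cases "odd t'")
    case True
    have "bij_betw beta (I_omega t') (I_f t)"
    proof -
      have "a \<in> Im2" if "S_index p n a + t = 2 ^ n" "a \<in> Delta q" for a
      proof (rule ccontr)
        assume "a \<notin> Im2"
        hence "4 dvd S_index p n a + 2 ^ n" using S_index_Im1 Im_cases that(2) by blast
        moreover have "S_index p n a + 2 ^ n + 2 * t' = 4 * 2 ^ (n - 1)"
          using that(1) t' two_power by linarith
        ultimately have "4 dvd 2 * t'" by (metis dvd_add_right_iff dvd_triv_left)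
        thus False using True by (auto elim!: dvdE)
      qed
      hence "I_f t = {a \<in> Im2. S_index p n a + t = 2 ^ n}" by (rule I_f_E) (auto simp: Im_cases)
      moreover have "S_index p n a + 1 = t' \<longleftrightarrow> S_index p n (beta a) + t = 2 ^ n" if "a \<in> Dom2" for a
        using S_index_beta[OF that] t' by linarith
      ultimately show ?thesis unfolding I_omega_Dom2[OF half(2)]
        using bij_betw_Collect[OF bij_beta] by simp
    qed
    hence "bij_betw (inv_into (I_omega t') beta) (I_f t) (I_omega t')"
        "\<And>a. a \<in> I_f t \<Longrightarrow> beta (inv_into (I_omega t') beta a) = a"
      "\<And>a. a \<in> I_f t \<Longrightarrow> inv_into (I_omega t') beta a \<in> Dom2"
      using I_omega_Dom2[OF half(2)]
        by (auto simp: bij_betw_inv_into bij_betw_inv_into_right dest: bij_betw_apply[OF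
            bij_betw_inv_into])
    moreover obtain u where
        "\<And>a. a \<in> Dom2 \<Longrightarrow> u a \<noteq> 0 \<and> Frob_cochain (f_cochain (beta a))
            - cscale (u a) (omega_cochain a) \<in> E"
      using Frob_cochain_f_cochain_beta by metis
    moreover have "I_omega t' \<subseteq> Delta q" by (auto simp: I_omega_def)
    note independent_omega_cochain[OF this]
    ultimately show ?thesis
      unfolding half(1) Frob_eq B_space_even[OF t(2)] B_space_odd[OF True]
      by (intro induced_semilinear_iso[OF semilinear_Frob_cochain finite_I(2) UNIV_I
          bij_frobenius, where u = "\<lambda>a. u (inv_into (I_omega t') beta a)"
            and \<pi> = "inv_into (I_omega t') beta"]) (assumption | metis)+
  next
    case False
    have "bij_betw alpha (I_f t') (I_f t)"
    proof -
      have "a \<in> Im1" if "S_index p n a + t = 2 ^ n" "a \<in> Delta q" for a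
      proof (rule ccontr)
        assume "a \<notin> Im1"
        hence "4 dvd S_index p n a + 2 ^ n + 2" using S_index_Im2 Im_cases that(2) by blast
        moreover have "S_index p n a + 2 ^ n + 2 + 2 * t' = 4 * 2 ^ (n - 1) + 2"
          using that(1) t' two_power by linarith
        moreover have "4 dvd 2 * t'" using False by (auto elim!: dvdE)
        ultimately have "4 dvd 4 * 2 ^ (n - 1) + (2 :: nat)" by (metis dvd_add)
        hence "4 dvd (2 :: nat)" by (metis dvd_add_right_iff dvd_triv_left)
        thus False by simp
      qed
      hence "I_f t = {a \<in> Im1. S_index p n a + t = 2 ^ n}" by (rule I_f_E) (auto simp: Im_cases)
      moreover have "S_index p n a + t' = 2 ^ n \<longleftrightarrow> S_index p n (alpha a) + t = 2 ^ n"
          if "a \<in> Dom1" for a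
        using S_index_alpha[OF that] t' by linarith
      ultimately show ?thesis unfolding I_f_Dom1[OF half(2)] using bij_betw_Collect[OF bij_alpha]
        by simp
    qed
    hence "bij_betw (inv_into (I_f t') alpha) (I_f t) (I_f t')"
        "\<And>a. a \<in> I_f t \<Longrightarrow> alpha (inv_into (I_f t') alpha a) = a"
      "\<And>a. a \<in> I_f t \<Longrightarrow> inv_into (I_f t') alpha a \<in> Dom1"
      using I_f_Dom1[OF half(2)]
        by (auto simp: bij_betw_inv_into bij_betw_inv_into_right dest: bij_betw_apply[OF
            bij_betw_inv_into])
    moreover obtain u where
        "\<And>a. a \<in> Dom1 \<Longrightarrow> u a \<noteq> 0 \<and> Frob_cochain (f_cochain (alpha a)) - cscale (u a) (f_cochain a)
            \<in> E"
      using Frob_cochain_f_cochain_alpha by metis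
    moreover have "I_f t' \<subseteq> Delta q" by (auto simp: I_f_def)
    note independent_f_cochain[OF this]
    ultimately show ?thesis
      unfolding half(1) Frob_eq B_space_even[OF t(2)] B_space_even[OF False[unfolded not_not]]
      by (intro induced_semilinear_iso[OF semilinear_Frob_cochain finite_I(2) UNIV_I
          bij_frobenius, where u = "\<lambda>a. u (inv_into (I_f t') alpha a)"
            and \<pi> = "inv_into (I_f t') alpha"]) (assumption | metis)+
  qed
qed

end

theorem theorem4p6:
  fixes p n q :: nat
  assumes "prime p" and "n \<ge> 1" and "q = p ^ n" and "CHAR('k::alg_closed_field) = p"
  shows
    "(\<forall>t. 1 \<le> t \<and> t \<le> 2 ^ (n - 1) \<longrightarrow>
        Ver p q ` (B_space p n t :: 'k cochain set set) = {dR_class q 0}) \<and>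
     (\<forall>t. 2 ^ (n - 1) + 1 \<le> t \<and> t \<le> 2 ^ n \<longrightarrow>
        semilinear_iso q (inv (\<lambda>c::'k. c ^ p)) (Ver p q) (B_space p n t) (B_space p n (2 * t - 2 ^ n - 1))) \<and>
     (\<forall>t. 1 \<le> t \<and> t \<le> 2 ^ n \<and> odd t \<longrightarrow>
        Frob p q ` (B_space p n t :: 'k cochain set set) = {dR_class q 0}) \<and>
     (\<forall>t. 1 \<le> t \<and> t \<le> 2 ^ n \<and> even t \<longrightarrow>
        semilinear_iso q (\<lambda>c::'k. c ^ p) (Frob p q) (B_space p n t) (B_space p n (t div 2)))"
proof -
  interpret hermitian p n q "TYPE('k)"
    using assms by unfold_locales
  show ?thesis
  proof (intro conjI allI impI; (elim conjE)?)
    fix t :: nat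
    show "Ver p q ` B_space p n t = {cl 0}" if "t \<le> 2 ^ (n - 1)"
      by (rule Ver_kernel[OF that])
    show "semilinear_iso q (inv (\<lambda>c::'k. c ^ p)) (Ver p q) (B_space p n t) (B_space p n (2 * t - 2 ^ n - 1))"
      if "2 ^ (n - 1) + 1 \<le> t" "t \<le> 2 ^ n"
      using Ver_iso[of t] that by (simp add: p_root_def)
    show "Frob p q ` B_space p n t = {cl 0}" if "odd t"
      by (rule Frob_kernel[OF that])
    show "semilinear_iso q (\<lambda>c::'k. c ^ p) (Frob p q) (B_space p n t) (B_space p n (t div 2))"
      if "t \<le> 2 ^ n" "even t"
      by (rule Frob_iso[OF that])
  qed
qed

end
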